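(* Let $H$ be a Hopf algebra with invertible antipode and $B$ a $\sigma$-twisted left $H$-module algebra. Given a bicovariant FODC $(\Omega^1(H),\mathrm{d}_H)$ on $H$ and a $\sigma$-twisted $H$-module FODC $(\Omega^1(B),\mathrm{d}_B)$ on $B$, there is a regular and strong quantum principal bundle on the crossed product algebra $B\#_\sigma H$. Explicitly, $$0\longrightarrow\Omega^1(B)\otimes H\overset{\iota_1}{\longrightarrow}\Omega^1(B\#_\sigma H)\overset{\mathrm{ver}}{\longrightarrow}(B\#_\sigma H)\otimes{}^{\mathrm{co}H}\Omega^1(H)\longrightarrow0$$ is an exact sequence of left $B\#_\sigma H$-modules, where $\iota_1$ is the inclusion and $(\Omega^1(B\#_\sigma H),\mathrm{d}_{\#_\sigma})$ is the crossed product calculus, a right $H$-covariant FODC on $B\#_\sigma H$.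
   Context: Everything is over a field $\Bbbk$; algebras are associative and unital. Sweedler notation: $\Delta(h)=h_1\otimes h_2$; right coactions $m\mapsto m_0\otimes m_1$; left coactions $m\mapsto m_{-1}\otimes m_0$, with $m_{-2}\otimes m_{-1}\otimes m_0$ the iterated left coaction. $B$ is a $\sigma$-twisted left $H$-module algebra: there are a linear map $\cdot:H\otimes B\to B$ (a measure) with $h\cdot 1_B=\varepsilon(h)1_B$, $h\cdot(bb')=(h_1\cdot b)(h_2\cdot b')$, and a convolution invertible linear map $\sigma:H\otimes H\to B$ with convolution inverse $\sigma^{-1}$, such that $1_H\cdot b=b$, $h\cdot(h'\cdot b)=\sigma(h_1\otimes h'_1)(h_2h'_2\cdot b)\sigma^{-1}(h_3\otimes h'_3)$, $\sigma(h\otimes1_H)=\varepsilon(h)1_B=\sigma(1_H\otimes h)$ and $(h_1\cdot\sigma(h'_1\otimes h''_1))\sigma(h_2\otimes h'_2h''_2)=\sigma(h_1\otimes h'_1)\sigma(h_2h'_2\otimes h'')$. The crossed product algebra $B\#_\sigma H$ is $B\otimes H$ with unit $1_B\otimes1_H$ and product $(b\otimes h)(b'\otimes h')=b(h_1\cdot b')\sigma(h_2\otimes h'_1)\otimes h_3h'_2$; it is a right $H$-comodule algebra via $\mathrm{Id}_B\otimes\Delta$, with coinvariant subalgebra $B\otimes\Bbbk1_H\cong B$. A FODC on an algebra $A$ is a pair $(\Omega^1(A),\mathrm{d}_A)$ with $\Omega^1(A)$ an $A$-bimodule, $\mathrm{d}_A:A\to\Omega^1(A)$ linear satisfying the Leibniz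 rule, and $\Omega^1(A)=\mathrm{span}_\Bbbk\{a\,\mathrm{d}_Ab\}$. For a right $H$-comodule algebra $A$ it is right $H$-covariant if $\Omega^1(A)$ is a right $H$-comodule with coaction compatible with both $A$-actions and $\mathrm{d}_A$ is right $H$-colinear. A FODC on $H$ is bicovariant if $\Omega^1(H)$ is an $H$-bicomodule with coactions compatible with the $H$-bimodule structure and $\mathrm{d}_H$ is left and right $H$-colinear; ${}^{\mathrm{co}H}\Omega^1(H)=\{\gamma:\gamma_{-1}\otimes\gamma_0=1_H\otimes\gamma\}$. $(\Omega^1(B),\mathrm{d}_B)$ is a $\sigma$-twisted $H$-module FODC if there is a linear map $\cdot:H\otimes\Omega^1(B)\to\Omega^1(B)$ with $h\cdot(b\,\mathrm{d}_Bb')=(h_1\cdot b)(h_2\cdot\mathrm{d}_Bb')$, $\mathrm{d}_B(h\cdot b)=h\cdot\mathrm{d}_Bb$ and $\mathrm{d}_B\circ\sigma=0$. The crossed product calculus: $\Omega^1(B\#_\sigma H)=(\Omega^1(B)\otimes H)\oplus(B\otimes\Omega^1(H))$, $\mathrm{d}_{\#_\sigma}(b\otimes h)=\mathrm{d}_Bb\otimes h+b\otimes\mathrm{d}_Hh$, with actions $(b'\otimes h')\cdot(\beta\otimes h+b\otimes\gamma)=b'(h'_1\cdot\beta)\sigma(h'_2\otimes h_1)\otimes h'_3h_2+b'(h'_1\cdot b)\sigma(h'_2\otimes\gamma_{-1})\otimes h'_3\gamma_0$, $(\beta\otimes h+b\otimes\gamma)\cdot(b'\otimes h')=\beta(h_1\cdot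 b')\sigma(h_2\otimes h'_1)\otimes h_3h'_2+b(\gamma_{-2}\cdot b')\sigma(\gamma_{-1}\otimes h'_1)\otimes\gamma_0h'_2$, and right coaction $\beta\otimes h+b\otimes\gamma\mapsto\beta\otimes h_1\otimes h_2+b\otimes\gamma_0\otimes\gamma_1$. Let $A$ be a right $H$-comodule algebra with coinvariants $B=A^{\mathrm{co}H}$. A quantum principal bundle (QPB) on $A$ is the data of a right $H$-covariant FODC $(\Omega^1(A),\mathrm{d}_A)$ and a bicovariant FODC $(\Omega^1(H),\mathrm{d}_H)$ such that the vertical map $\mathrm{ver}:\Omega^1(A)\to A\otimes{}^{\mathrm{co}H}\Omega^1(H)$, $a\,\mathrm{d}_Aa'\mapsto aa'_0\otimes S(a'_1)\mathrm{d}_Ha'_2$, is well-defined and $0\to\Omega^1_{\mathrm{hor}}(A)\hookrightarrow\Omega^1(A)\overset{\mathrm{ver}}{\to}A\otimes{}^{\mathrm{co}H}\Omega^1(H)\to0$ is exact in left $A$-modules ($A$ acting on the first tensor factor of the last term). Here $\Omega^1(B):=B\,\mathrm{d}_AB\subseteq\Omega^1(A)$ is the pullback calculus and $\Omega^1_{\mathrm{hor}}(A):=A\Omega^1(B)A$. For $A=B\#_\sigma H$ the pullback calculus on $B\otimes\Bbbk1_H$ is $\Omega^1(B)\otimes\Bbbk1_H$ and the horizontal forms are $\Omega^1(B)\otimes H$. A QPB is strong if $A\Omega^1(B)=\Omega^1(B)A$ in $\Omega^1(A)$. A connection is a right $H$-colinear, left $A$-linear map $c:A\otimes{}^{\mathrm{co}H}\Omega^1(H)\to\Omega^1(A)$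 (diagonal coaction on the source) with $\mathrm{ver}\circ c=\mathrm{Id}$; it is strong if $(\mathrm{Id}-c\circ\mathrm{ver})\mathrm{d}_AA\subseteq\Omega^1(B)A$. A QPB is regular if it descends (as a quotient) from the universal QPB, i.e. $B\subseteq A$ is a Hopf–Galois extension ($A\otimes_BA\to A\otimes H$, $a\otimes_Ba'\mapsto aa'_0\otimes a'_1$, is bijective, equivalently the universal FODCi on $A$ and $H$ form a QPB), and this universal QPB admits a strong connection. *)

theory Defs
  imports Complex_Main "HOL-Library.Function_Algebras" "HOL-Library.Product_Plus"
begin

section \<open>Vector spaces and linear maps\<close>

text \<open>
  A vector space over the field \<open>'k\<close> is a subspace \<open>carr V\<close> of an ambient vector space
  \<open>(UNIV :: 'v set, scl V)\<close> in the sense of \<^theory>\<open>HOL.Vector_Spaces\<close>.  Carriers are needed because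
  coinvariants, horizontal forms, kernels and tensor products are not types.
  Maps are only constrained on carriers.
\<close>

record ('v, 'k) vs =
  carr :: "'v set"
  scl :: "'k \<Rightarrow> 'v \<Rightarrow> 'v"

definition vect :: "('v::ab_group_add, 'k::field, 'z) vs_scheme \<Rightarrow> bool" where
  "vect V \<longleftrightarrow> vector_space (scl V) \<and> module.subspace (scl V) (carr V)"

abbreviation vspan :: "('v::ab_group_add, 'k::field, 'z) vs_scheme \<Rightarrow> 'v set \<Rightarrow> 'v set" where
  "vspan V S \<equiv> module.span (scl V) S"

definition ground :: "('k::field, 'k) vs" where
  "ground = \<lparr> carr = UNIV, scl = (*) \<rparr>"

definition linear_on ::
  "('v::ab_group_add, 'k::field, 'y) vs_scheme \<Rightarrow> ('w::ab_group_add, 'k, 'z) vs_scheme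
    \<Rightarrow> ('v \<Rightarrow> 'w) \<Rightarrow> bool" where
  "linear_on V W f \<longleftrightarrow>
     (\<forall>v\<in>carr V. f v \<in> carr W) \<and>
     (\<forall>v\<in>carr V. \<forall>v'\<in>carr V. f (v + v') = f v + f v') \<and>
     (\<forall>c. \<forall>v\<in>carr V. f (scl V c v) = scl W c (f v))"

text \<open>Linear maps \<open>V \<otimes> W \<rightarrow> U\<close> given as structure (multiplications, actions, \<open>\<sigma>\<close>) are
  represented by bilinear maps.\<close>

definition bilinear_on ::
  "('v::ab_group_add, 'k::field, 'x) vs_scheme \<Rightarrow> ('w::ab_group_add, 'k, 'y) vs_scheme
    \<Rightarrow> ('u::ab_group_add, 'k, 'z) vs_scheme \<Rightarrow> ('v \<Rightarrow> 'w \<Rightarrow> 'u) \<Rightarrow> bool" where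
  "bilinear_on V W U f \<longleftrightarrow>
     (\<forall>v\<in>carr V. linear_on W U (f v)) \<and> (\<forall>w\<in>carr W. linear_on V U (\<lambda>v. f v w))"

definition direct_sum ::
  "('v::ab_group_add, 'k::field, 'y) vs_scheme \<Rightarrow> ('w::ab_group_add, 'k, 'z) vs_scheme
    \<Rightarrow> ('v \<times> 'w, 'k) vs" where
  "direct_sum V W = \<lparr> carr = carr V \<times> carr W, scl = (\<lambda>c (v, w). (scl V c v, scl W c w)) \<rparr>"


section \<open>Tensor products\<close>

text \<open>
  Over a field, bilinear forms separate the points of \<open>V \<otimes> W\<close>, so \<open>V \<otimes> W\<close> is
  realized as the space of functionals on bilinear forms spanned by the evaluations
  \<open>v \<otimes> w = (\<phi> \<mapsto> \<phi> v w)\<close>.  Likewise, \<open>A \<otimes>\<^sub>B A\<close> is obtained from the \<open>B\<close>-balanced bilinear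
  forms.  Forms are taken on the ambient spaces; since these restrict onto the forms on subspaces,
  \<open>V \<otimes> W\<close> is contained in \<open>V' \<otimes> W'\<close> for subspaces \<open>V \<subseteq> V'\<close>, \<open>W \<subseteq> W'\<close>.
  The universal properties are \<open>tensor_universal\<close>, \<open>tensor_unique\<close> and \<open>tensor_over_universal\<close> below.
\<close>

type_synonym ('v, 'w, 'k) tens = "('v \<Rightarrow> 'w \<Rightarrow> 'k) \<Rightarrow> 'k"

definition bilforms ::
  "('v::ab_group_add, 'k::field, 'y) vs_scheme \<Rightarrow> ('w::ab_group_add, 'k, 'z) vs_scheme
    \<Rightarrow> ('v \<Rightarrow> 'w \<Rightarrow> 'k) set" where
  "bilforms V W = {\<phi>. (\<forall>v. Vector_Spaces.linear (scl W) (*) (\<phi> v)) \<and>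
                      (\<forall>w. Vector_Spaces.linear (scl V) (*) (\<lambda>v. \<phi> v w))}"

definition evaluation :: "('v \<Rightarrow> 'w \<Rightarrow> 'k) set \<Rightarrow> 'v \<Rightarrow> 'w \<Rightarrow> ('v, 'w, 'k::zero) tens" where
  "evaluation F v w = (\<lambda>\<phi>. if \<phi> \<in> F then \<phi> v w else 0)"

definition eval_space ::
  "('v \<Rightarrow> 'w \<Rightarrow> 'k) set \<Rightarrow> 'v set \<Rightarrow> 'w set \<Rightarrow> (('v, 'w, 'k::field) tens, 'k) vs" where
  "eval_space F V W =
     \<lparr> carr = module.span (\<lambda>c t \<phi>. c * t \<phi>) {evaluation F v w | v w. v \<in> V \<and> w \<in> W},
       scl = (\<lambda>c t \<phi>. c * t \<phi>) \<rparr>"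

text \<open>\<open>eval_sum F V W t f\<close> is \<open>\<Sum>\<^sub>i f v\<^sub>i w\<^sub>i\<close> for a chosen representation
  \<open>t = \<Sum>\<^sub>i v\<^sub>i \<otimes> w\<^sub>i\<close> with \<open>v\<^sub>i \<in> V\<close> and \<open>w\<^sub>i \<in> W\<close>.\<close>

definition eval_sum ::
  "('v \<Rightarrow> 'w \<Rightarrow> 'k) set \<Rightarrow> 'v set \<Rightarrow> 'w set \<Rightarrow> ('v, 'w, 'k::field) tens
    \<Rightarrow> ('v \<Rightarrow> 'w \<Rightarrow> 'u::comm_monoid_add) \<Rightarrow> 'u" where
  "eval_sum F V W t f =
     (let xs = (SOME xs. set xs \<subseteq> V \<times> W \<and> t = (\<Sum>(v, w)\<leftarrow>xs. evaluation F v w))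
      in (\<Sum>(v, w)\<leftarrow>xs. f v w))"

definition ptensor ::
  "('v::ab_group_add, 'k::field, 'y) vs_scheme \<Rightarrow> ('w::ab_group_add, 'k, 'z) vs_scheme
    \<Rightarrow> 'v \<Rightarrow> 'w \<Rightarrow> ('v, 'w, 'k) tens" where
  "ptensor V W = evaluation (bilforms V W)"

definition tensor ::
  "('v::ab_group_add, 'k::field, 'y) vs_scheme \<Rightarrow> ('w::ab_group_add, 'k, 'z) vs_scheme
    \<Rightarrow> (('v, 'w, 'k) tens, 'k) vs" where
  "tensor V W = eval_space (bilforms V W) (carr V) (carr W)"

text \<open>Sweedler-style summation: for \<open>f\<close> bilinear, \<open>t \<mapsto> tsum V W t f\<close> is the linear map
  \<open>V \<otimes> W \<rightarrow> U\<close>, \<open>v \<otimes> w \<mapsto> f v w\<close>.\<close>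

definition tsum ::
  "('v::ab_group_add, 'k::field, 'y) vs_scheme \<Rightarrow> ('w::ab_group_add, 'k, 'z) vs_scheme
    \<Rightarrow> ('v, 'w, 'k) tens \<Rightarrow> ('v \<Rightarrow> 'w \<Rightarrow> 'u::comm_monoid_add) \<Rightarrow> 'u" where
  "tsum V W = eval_sum (bilforms V W) (carr V) (carr W)"


lemma vector_space_pointwise: "vector_space (\<lambda>(c::'k::field) (t :: 'x \<Rightarrow> 'k) \<phi>. c * t \<phi>)"
  by unfold_locales (auto simp: fun_eq_iff algebra_simps)

lemma sum_list_apply: "(\<Sum>x\<leftarrow>xs. f x) \<phi> = (\<Sum>x\<leftarrow>xs. f x \<phi>)"
  by (induction xs) auto

lemma eval_space_representation:
  fixes F :: "('v \<Rightarrow> 'w \<Rightarrow> 'k::field) set" and s :: "'k \<Rightarrow> 'v \<Rightarrow> 'v"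
  assumes V: "\<And>c v. v \<in> V \<Longrightarrow> s c v \<in> V"
    and F: "\<And>c v w \<phi>. \<phi> \<in> F \<Longrightarrow> \<phi> (s c v) w = c * \<phi> v w"
    and t: "t \<in> carr (eval_space F V W)"
  shows "\<exists>xs. set xs \<subseteq> V \<times> W \<and> t = (\<Sum>(v, w)\<leftarrow>xs. evaluation F v w)"
proof -
  interpret vector_space "\<lambda>(c::'k) t (\<phi> :: 'v \<Rightarrow> 'w \<Rightarrow> 'k). c * t \<phi>" by (rule vector_space_pointwise)
  let ?P = "\<lambda>t. \<exists>xs. set xs \<subseteq> V \<times> W \<and> t = (\<Sum>(v, w)\<leftarrow>xs. evaluation F v w)"
  have "t \<in> span {evaluation F v w | v w. v \<in> V \<and> w \<in> W}"
    using t by (simp add: eval_space_def)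
  then show ?thesis
  proof (induction rule: span_induct_alt)
    case base
    show ?case by (rule exI[of _ "[]"]) simp
  next
    case (step c x y)
    from step obtain v w xs where vw: "x = evaluation F v w" "v \<in> V" "w \<in> W"
      and xs: "set xs \<subseteq> V \<times> W" "y = (\<Sum>(v, w)\<leftarrow>xs. evaluation F v w)" by blast
    have "(\<lambda>\<phi>. c * x \<phi>) = evaluation F (s c v) w"
      by (auto simp: vw evaluation_def F)
    with vw xs V show ?case
      by (intro exI[of _ "(s c v, w) # xs"]) auto
  qed
qed

lemma eval_sum_representation:
  fixes F :: "('v \<Rightarrow> 'w \<Rightarrow> 'k::field) set" and s :: "'k \<Rightarrow> 'v \<Rightarrow> 'v"
  assumes "\<And>c v. v \<in> V \<Longrightarrow> s c v \<in> V"
    and "\<And>c v w \<phi>. \<phi> \<in> F \<Longrightarrow> \<phi> (s c v) w = c * \<phi> v w"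
    and "t \<in> carr (eval_space F V W)"
  obtains xs where "set xs \<subseteq> V \<times> W" "t = (\<Sum>(v, w)\<leftarrow>xs. evaluation F v w)"
    "\<And>f :: 'v \<Rightarrow> 'w \<Rightarrow> 'u::comm_monoid_add. eval_sum F V W t f = (\<Sum>(v, w)\<leftarrow>xs. f v w)"
proof -
  let ?xs = "SOME xs. set xs \<subseteq> V \<times> W \<and> t = (\<Sum>(v, w)\<leftarrow>xs. evaluation F v w)"
  have "\<exists>xs. set xs \<subseteq> V \<times> W \<and> t = (\<Sum>(v, w)\<leftarrow>xs. evaluation F v w)"
    using eval_space_representation[of V s F t W] assms(1,2,3) by blast
  then have "set ?xs \<subseteq> V \<times> W \<and> t = (\<Sum>(v, w)\<leftarrow>?xs. evaluation F v w)"
    by (rule someI_ex)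
  then show ?thesis
    using that[of ?xs] by (simp add: eval_sum_def Let_def)
qed

lemma separating_functional:
  fixes s :: "'k::field \<Rightarrow> 'u::ab_group_add \<Rightarrow> 'u"
  assumes "vector_space s" and "u \<noteq> 0"
  obtains \<psi> :: "'u \<Rightarrow> 'k" where "Vector_Spaces.linear s (*) \<psi>" "\<psi> u = 1"
proof -
  interpret vector_space s by fact
  interpret vector_space_pair s "(*) :: 'k \<Rightarrow> 'k \<Rightarrow> 'k"
    by unfold_locales (auto simp: algebra_simps)
  have "independent {u}" using assms(2) by (simp add: dependent_single)
  from linear_independent_extend[OF this, of "\<lambda>_. 1"] show ?thesis using that by auto
qed

lemma subspace_projection:
  fixes s :: "'k::field \<Rightarrow> 'v::ab_group_add \<Rightarrow> 'v"
  assumes "vector_space s" and "module.subspace s V"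
  obtains p where "Vector_Spaces.linear s s p" "range p \<subseteq> V" "\<And>v. v \<in> V \<Longrightarrow> p v = v"
proof -
  interpret vector_space s by fact
  interpret vector_space_pair s s ..
  have "Vector_Spaces.linear s s id" by (rule linear_id)
  from linear_exists_left_inverse_on[OF this assms(2)] obtain p where
    "p ` UNIV \<subseteq> V" "Vector_Spaces.linear s s p" "\<forall>v\<in>V. p (id v) = v" by auto
  then show ?thesis using that by auto
qed

lemma sum_list_functional:
  assumes "Vector_Spaces.linear s (*) \<psi>"
  shows "\<psi> (\<Sum>x\<leftarrow>xs. f x) = (\<Sum>x\<leftarrow>xs. \<psi> (f x))"
proof -
  interpret Vector_Spaces.linear s "(*)" \<psi> by fact
  show ?thesis by (induction xs) (auto simp: add zero)
qed

lemma linear_iff: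
  "Vector_Spaces.linear s s' f \<longleftrightarrow> vector_space s \<and> vector_space s' \<and>
     (\<forall>x y. f (x + y) = f x + f y) \<and> (\<forall>c x. f (s c x) = s' c (f x))"
  unfolding Vector_Spaces.linear_def module_hom_def module_hom_axioms_def
  by (auto simp: module_iff_vector_space)

lemma vector_space_field: "vector_space ((*) :: 'k::field \<Rightarrow> 'k \<Rightarrow> 'k)"
  by unfold_locales (auto simp: algebra_simps)

lemma extend_form:
  assumes "vect V" and "vect W" and "bilinear_on V W U f"
    and "Vector_Spaces.linear (scl U) (*) \<psi>"
  shows "\<exists>\<phi>\<in>bilforms V W. \<forall>v\<in>carr V. \<forall>w\<in>carr W. \<phi> v w = \<psi> (f v w)"
proof -
  obtain p where p: "Vector_Spaces.linear (scl V) (scl V) p" "range p \<subseteq> carr V"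
    "\<And>v. v \<in> carr V \<Longrightarrow> p v = v"
    by (rule subspace_projection[of "scl V" "carr V"]) (use assms(1) in \<open>auto simp: vect_def\<close>)
  obtain q where q: "Vector_Spaces.linear (scl W) (scl W) q" "range q \<subseteq> carr W"
    "\<And>v. v \<in> carr W \<Longrightarrow> q v = v"
    by (rule subspace_projection[of "scl W" "carr W"]) (use assms(2) in \<open>auto simp: vect_def\<close>)
  have pq: "p v \<in> carr V" "q w \<in> carr W" for v w using p(2) q(2) by auto
  let ?\<phi> = "\<lambda>v w. \<psi> (f (p v) (q w))"
  have "?\<phi> \<in> bilforms V W"
    using p(1) q(1) pq assms(3,4) by (auto simp: bilforms_def bilinear_on_def linear_on_def linear_iff)
  then show ?thesis using p(3) q(3) by (intro bexI[of _ ?\<phi>]) auto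
qed

lemma eval_sum_universal:
  fixes V :: "('v::ab_group_add, 'k::field, 'x) vs_scheme"
    and W :: "('w::ab_group_add, 'k, 'y) vs_scheme"
    and U :: "('u::ab_group_add, 'k, 'z) vs_scheme"
  assumes V: "vect V" and U: "vect U" and F: "F \<subseteq> bilforms V W" and f: "bilinear_on V W U f"
    and ext: "\<And>\<psi>. Vector_Spaces.linear (scl U) (*) \<psi> \<Longrightarrow>
      \<exists>\<phi>\<in>F. \<forall>v\<in>carr V. \<forall>w\<in>carr W. \<phi> v w = \<psi> (f v w)"
  shows "linear_on (eval_space F (carr V) (carr W)) U (\<lambda>t. eval_sum F (carr V) (carr W) t f)"
    and "v \<in> carr V \<Longrightarrow> w \<in> carr W \<Longrightarrow>
      eval_sum F (carr V) (carr W) (evaluation F v w) f = f v w"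
proof -
  let ?T = "eval_space F (carr V) (carr W)"
  let ?e = "\<lambda>xs. \<Sum>(v, w)\<leftarrow>xs. evaluation F v w"
  let ?s = "\<lambda>xs. \<Sum>(v, w)\<leftarrow>xs. f v w"
  interpret U: vector_space "scl U" using U by (simp add: vect_def)
  interpret V: vector_space "scl V" using V by (simp add: vect_def)
  interpret T: vector_space "\<lambda>(c::'k) t (\<phi> :: 'v \<Rightarrow> 'w \<Rightarrow> 'k). c * t \<phi>"
    by (rule vector_space_pointwise)
  have sV: "scl V c v \<in> carr V" if "v \<in> carr V" for c v
    using that V V.subspace_scale by (auto simp: vect_def)
  have sF: "\<phi> (scl V c v) w = c * \<phi> v w" if "\<phi> \<in> F" for \<phi> c v w
    using that F by (auto simp: bilforms_def linear_iff)
  have uniq: "?s xs = ?s ys"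
    if "set xs \<subseteq> carr V \<times> carr W" "set ys \<subseteq> carr V \<times> carr W" "?e xs = ?e ys" for xs ys
  proof (rule ccontr)
    assume "?s xs \<noteq> ?s ys"
    then have "?s xs - ?s ys \<noteq> 0" by simp
    then obtain \<psi> :: "'u \<Rightarrow> 'k"
      where \<psi>: "Vector_Spaces.linear (scl U) (*) \<psi>" "\<psi> (?s xs - ?s ys) = 1"
      using separating_functional[OF U.vector_space_axioms] by metis
    interpret psi: Vector_Spaces.linear "scl U" "(*)" \<psi> by fact
    from ext[OF \<psi>(1)] obtain \<phi> where \<phi>: "\<phi> \<in> F"
      "\<And>v w. v \<in> carr V \<Longrightarrow> w \<in> carr W \<Longrightarrow> \<phi> v w = \<psi> (f v w)" by blast
    have e: "?e zs \<phi> = \<psi> (?s zs)" if "set zs \<subseteq> carr V \<times> carr W" for zs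
      using that by (induction zs) (auto simp: evaluation_def \<phi> psi.add psi.zero)
    have "\<psi> (?s xs) = \<psi> (?s ys)" using e that by metis
    then show False using \<psi>(2) by (simp add: psi.diff)
  qed
  have rep: "\<exists>xs. set xs \<subseteq> carr V \<times> carr W \<and> t = ?e xs" if "t \<in> carr ?T" for t
    using eval_space_representation[of "carr V" "scl V" F t "carr W"] sV sF that by blast
  have val: "eval_sum F (carr V) (carr W) (?e xs) f = ?s xs"
    if "set xs \<subseteq> carr V \<times> carr W" for xs
  proof -
    let ?ys = "SOME ys. set ys \<subseteq> carr V \<times> carr W \<and> ?e xs = ?e ys"
    have ys: "set ?ys \<subseteq> carr V \<times> carr W \<and> ?e xs = ?e ?ys"
      by (rule someI[where P = "\<lambda>ys. set ys \<subseteq> carr V \<times> carr W \<and> ?e xs = ?e ys"]) (use that in simp)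
    have "?s xs = ?s ?ys" using ys by (intro uniq[OF that]) (erule conjunct1, erule conjunct2)
    then show ?thesis unfolding eval_sum_def Let_def by (rule sym)
  qed
  show "eval_sum F (carr V) (carr W) (evaluation F v w) f = f v w"
    if "v \<in> carr V" "w \<in> carr W" for v w
    using val[of "[(v, w)]"] that by simp
  have cU: "?s xs \<in> carr U" if "set xs \<subseteq> carr V \<times> carr W" for xs
    using that
  proof (induction xs)
    case Nil
    show ?case using U U.subspace_0 by (auto simp: vect_def)
  next
    case (Cons x xs)
    then show ?case using U U.subspace_add f
      by (auto simp: vect_def bilinear_on_def linear_on_def split: prod.splits)
  qed
  show "linear_on ?T U (\<lambda>t. eval_sum F (carr V) (carr W) t f)"
    unfolding linear_on_def
  proof (intro conjI ballI allI)
    fix t assume "t \<in> carr ?T"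
    then obtain xs where xs: "set xs \<subseteq> carr V \<times> carr W" "t = ?e xs" using rep by blast
    show "eval_sum F (carr V) (carr W) t f \<in> carr U" using xs val cU by simp
    fix c
    let ?ys = "map (\<lambda>(v, w). (scl V c v, w)) xs"
    have ys: "set ?ys \<subseteq> carr V \<times> carr W" using xs sV by auto
    have "?s ?ys = scl U c (?s xs)"
      using xs(1) f by (induction xs)
        (auto simp: bilinear_on_def linear_on_def U.scale_right_distrib)
    moreover have "?e zs \<phi> * c = ?e (map (\<lambda>(v, w). (scl V c v, w)) zs) \<phi>" for zs \<phi>
      by (induction zs) (auto simp: evaluation_def sF algebra_simps)
    then have "scl ?T c t = ?e ?ys"
      by (auto simp: eval_space_def xs(2) fun_eq_iff mult.commute)
    ultimately show "eval_sum F (carr V) (carr W) (scl ?T c t) f =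
        scl U c (eval_sum F (carr V) (carr W) t f)"
      using val[OF ys] val[OF xs(1)] xs(2) by simp
  next
    fix t t' assume "t \<in> carr ?T" "t' \<in> carr ?T"
    then obtain xs ys where xs: "set xs \<subseteq> carr V \<times> carr W" "t = ?e xs"
      and ys: "set ys \<subseteq> carr V \<times> carr W" "t' = ?e ys" using rep by metis
    show "eval_sum F (carr V) (carr W) (t + t') f =
        eval_sum F (carr V) (carr W) t f + eval_sum F (carr V) (carr W) t' f"
      using val[of "xs @ ys"] val[of xs] val[of ys] xs ys by simp
  qed
qed

text \<open>Universal property of \<open>V \<otimes> W\<close>: existence and uniqueness of the linear map induced by a
  bilinear map.\<close>

theorem tensor_universal:
  assumes "vect V" and "vect W" and "vect U" and "bilinear_on V W U f"
  shows "linear_on (tensor V W) U (\<lambda>t. tsum V W t f)"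
    and "v \<in> carr V \<Longrightarrow> w \<in> carr W \<Longrightarrow> tsum V W (ptensor V W v w) f = f v w"
  using eval_sum_universal[OF assms(1,3) subset_refl assms(4) extend_form[OF assms(1,2,4)]]
  by (simp_all add: tensor_def tsum_def ptensor_def)

lemma eval_space_unique:
  fixes F :: "('v::ab_group_add \<Rightarrow> 'w \<Rightarrow> 'k::field) set"
  assumes "vector_space (scl U)"
    and "linear_on (eval_space F V W) U g" and "linear_on (eval_space F V W) U g'"
    and "\<And>v w. v \<in> V \<Longrightarrow> w \<in> W \<Longrightarrow> g (evaluation F v w) = g' (evaluation F v w)"
    and "t \<in> carr (eval_space F V W)"
  shows "g t = g' t"
proof -
  interpret vector_space "\<lambda>(c::'k) t (\<phi> :: 'v \<Rightarrow> 'w \<Rightarrow> 'k). c * t \<phi>" by (rule vector_space_pointwise)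
  let ?T = "eval_space F V W"
  let ?S = "{evaluation F v w | v w. v \<in> V \<and> w \<in> W}"
  have T: "carr ?T = span ?S" "scl ?T = (\<lambda>c t \<phi>. c * t \<phi>)" by (simp_all add: eval_space_def)
  interpret U: vector_space "scl U" by fact
  have "0 \<in> span ?S" by (rule span_zero)
  then have "g (0 + 0) = g 0 + g 0" "g' (0 + 0) = g' 0 + g' 0"
    using assms(2,3) unfolding linear_on_def T(1) by blast+
  then have z: "g 0 = 0" "g' 0 = 0" by simp_all
  have "t \<in> span ?S" using assms(5) T by simp
  then have "t \<in> span ?S \<and> g t = g' t"
  proof (induction rule: span_induct_alt)
    case base
    show ?case by (rule conjI[OF span_zero]) (simp only: z)
  next
    case (step c x y)
    let ?cx = "\<lambda>\<phi>. c * x \<phi>"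
    have x: "x \<in> span ?S" using step(1) by (rule span_base)
    then have cx: "?cx \<in> span ?S" by (rule span_scale)
    have "g (?cx + y) = scl U c (g x) + g y" "g' (?cx + y) = scl U c (g' x) + g' y"
      using assms(2,3) x cx step by (auto simp: linear_on_def T)
    moreover have "g x = g' x" using step(1) assms(4) by auto
    ultimately have "g (?cx + y) = g' (?cx + y)" using step by simp
    moreover have "?cx + y \<in> span ?S" using cx step by (intro span_add) auto
    ultimately show ?case by blast
  qed
  then show ?thesis ..
qed

theorem tensor_unique:
  assumes "vect U" and "linear_on (tensor V W) U g" and "linear_on (tensor V W) U g'"
    and "\<And>v w. v \<in> carr V \<Longrightarrow> w \<in> carr W \<Longrightarrow> g (ptensor V W v w) = g' (ptensor V W v w)"
    and "t \<in> carr (tensor V W)"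
  shows "g t = g' t"
  using assms eval_space_unique[of U "bilforms V W" "carr V" "carr W" g g' t]
  by (simp add: tensor_def ptensor_def vect_def)


section \<open>Algebras, Hopf algebras, comodule algebras\<close>

record ('v, 'k) alg = "('v, 'k) vs" +
  amul :: "'v \<Rightarrow> 'v \<Rightarrow> 'v"
  aone :: "'v"

definition algebra :: "('a::ab_group_add, 'k::field, 'z) alg_scheme \<Rightarrow> bool" where
  "algebra A \<longleftrightarrow>
     vect A \<and> bilinear_on A A A (amul A) \<and> aone A \<in> carr A \<and>
     (\<forall>a\<in>carr A. \<forall>b\<in>carr A. \<forall>c\<in>carr A. amul A (amul A a b) c = amul A a (amul A b c)) \<and>
     (\<forall>a\<in>carr A. amul A (aone A) a = a \<and> amul A a (aone A) = a)"

text \<open>Balanced bilinear forms \<open>\<phi>(ab, a') = \<phi>(a, ba')\<close> and the tensor product \<open>A \<otimes>\<^sub>B A\<close> over a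
  subalgebra \<open>B \<subseteq> A\<close>.\<close>

definition balforms ::
  "('a::ab_group_add, 'k::field, 'z) alg_scheme \<Rightarrow> 'a set \<Rightarrow> ('a \<Rightarrow> 'a \<Rightarrow> 'k) set" where
  "balforms A B = {\<phi> \<in> bilforms A A. \<forall>a\<in>carr A. \<forall>b\<in>B. \<forall>a'\<in>carr A.
     \<phi> (amul A a b) a' = \<phi> a (amul A b a')}"

definition tensor_over ::
  "('a::ab_group_add, 'k::field, 'z) alg_scheme \<Rightarrow> 'a set \<Rightarrow> (('a, 'a, 'k) tens, 'k) vs" where
  "tensor_over A B = eval_space (balforms A B) (carr A) (carr A)"

definition tsum_over ::
  "('a::ab_group_add, 'k::field, 'z) alg_scheme \<Rightarrow> 'a set \<Rightarrow> ('a, 'a, 'k) tens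
    \<Rightarrow> ('a \<Rightarrow> 'a \<Rightarrow> 'u::comm_monoid_add) \<Rightarrow> 'u" where
  "tsum_over A B = eval_sum (balforms A B) (carr A) (carr A)"

theorem tensor_over_universal:
  assumes A: "algebra A" and B: "B \<subseteq> carr A" and U: "vect U" and f: "bilinear_on A A U f"
    and bal: "\<And>a b a'. a \<in> carr A \<Longrightarrow> b \<in> B \<Longrightarrow> a' \<in> carr A \<Longrightarrow>
      f (amul A a b) a' = f a (amul A b a')"
  shows "linear_on (tensor_over A B) U (\<lambda>t. tsum_over A B t f)"
    and "a \<in> carr A \<Longrightarrow> a' \<in> carr A \<Longrightarrow>
      tsum_over A B (evaluation (balforms A B) a a') f = f a a'"
proof -
  have V: "vect A" and cl: "\<And>a b. a \<in> carr A \<Longrightarrow> b \<in> carr A \<Longrightarrow> amul A a b \<in> carr A"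
    using A by (auto simp: algebra_def bilinear_on_def linear_on_def)
  have "\<exists>\<phi>\<in>balforms A B. \<forall>v\<in>carr A. \<forall>w\<in>carr A. \<phi> v w = \<psi> (f v w)"
    if "Vector_Spaces.linear (scl U) (*) \<psi>" for \<psi>
  proof -
    from extend_form[OF V V f that] obtain \<phi> where \<phi>: "\<phi> \<in> bilforms A A"
      "\<And>v w. v \<in> carr A \<Longrightarrow> w \<in> carr A \<Longrightarrow> \<phi> v w = \<psi> (f v w)" by blast
    have "\<phi> \<in> balforms A B" using \<phi> bal B cl by (auto simp: balforms_def subset_iff)
    with \<phi>(2) show ?thesis by blast
  qed
  from eval_sum_universal[OF V U _ f this]
  show "linear_on (tensor_over A B) U (\<lambda>t. tsum_over A B t f)"
    and "a \<in> carr A \<Longrightarrow> a' \<in> carr A \<Longrightarrow>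
      tsum_over A B (evaluation (balforms A B) a a') f = f a a'"
    by (simp_all add: tensor_over_def tsum_over_def balforms_def)
qed

lemma balanced:
  assumes "a \<in> carr A" and "b \<in> B" and "a' \<in> carr A"
  shows "evaluation (balforms A B) (amul A a b) a' = evaluation (balforms A B) a (amul A b a')"
  using assms by (auto simp: evaluation_def balforms_def)

record ('h, 'k) hopf = "('h, 'k) alg" +
  comul :: "'h \<Rightarrow> ('h, 'h, 'k) tens"
  counit :: "'h \<Rightarrow> 'k"
  antipode :: "'h \<Rightarrow> 'h"

text \<open>\<open>cop H h (\<lambda>h\<^sub>1 h\<^sub>2. \<dots>)\<close> and \<open>cop3 H h (\<lambda>h\<^sub>1 h\<^sub>2 h\<^sub>3. \<dots>)\<close> are Sweedler sums over
  the (iterated) comultiplication of \<open>h\<close>.\<close>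

definition cop ::
  "('h::ab_group_add, 'k::field, 'z) hopf_scheme \<Rightarrow> 'h
    \<Rightarrow> ('h \<Rightarrow> 'h \<Rightarrow> 'u::comm_monoid_add) \<Rightarrow> 'u" where
  "cop H h f = tsum H H (comul H h) f"

definition cop3 ::
  "('h::ab_group_add, 'k::field, 'z) hopf_scheme \<Rightarrow> 'h
    \<Rightarrow> ('h \<Rightarrow> 'h \<Rightarrow> 'h \<Rightarrow> 'u::comm_monoid_add) \<Rightarrow> 'u" where
  "cop3 H h f = cop H h (\<lambda>g h3. cop H g (\<lambda>h1 h2. f h1 h2 h3))"

definition hopf_algebra :: "('h::ab_group_add, 'k::field, 'z) hopf_scheme \<Rightarrow> bool" where
  "hopf_algebra H \<longleftrightarrow>
     algebra H \<and>
     linear_on H (tensor H H) (comul H) \<and> linear_on H ground (counit H) \<and>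
     linear_on H H (antipode H) \<and>
     (\<forall>h\<in>carr H.
        cop H h (\<lambda>h1 h2. cop H h1 (\<lambda>x y. ptensor H (tensor H H) x (ptensor H H y h2))) =
        cop H h (\<lambda>h1 h2. cop H h2 (\<lambda>x y. ptensor H (tensor H H) h1 (ptensor H H x y)))) \<and>
     (\<forall>h\<in>carr H. cop H h (\<lambda>h1 h2. scl H (counit H h1) h2) = h \<and>
                 cop H h (\<lambda>h1 h2. scl H (counit H h2) h1) = h) \<and>
     comul H (aone H) = ptensor H H (aone H) (aone H) \<and> counit H (aone H) = 1 \<and>
     (\<forall>h\<in>carr H. \<forall>g\<in>carr H.
        comul H (amul H h g) =
          cop H h (\<lambda>h1 h2. cop H g (\<lambda>g1 g2. ptensor H H (amul H h1 g1) (amul H h2 g2))) \<and>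
        counit H (amul H h g) = counit H h * counit H g) \<and>
     (\<forall>h\<in>carr H.
        cop H h (\<lambda>h1 h2. amul H (antipode H h1) h2) = scl H (counit H h) (aone H) \<and>
        cop H h (\<lambda>h1 h2. amul H h1 (antipode H h2)) = scl H (counit H h) (aone H))"

definition right_comodule ::
  "('h::ab_group_add, 'k::field, 'y) hopf_scheme \<Rightarrow> ('v::ab_group_add, 'k, 'z) vs_scheme
    \<Rightarrow> ('v \<Rightarrow> ('v, 'h, 'k) tens) \<Rightarrow> bool" where
  "right_comodule H V \<rho> \<longleftrightarrow>
     vect V \<and> linear_on V (tensor V H) \<rho> \<and>
     (\<forall>v\<in>carr V.
        tsum V H (\<rho> v) (\<lambda>v0 h. tsum V H (\<rho> v0)
          (\<lambda>x y. ptensor V (tensor H H) x (ptensor H H y h))) =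
        tsum V H (\<rho> v) (\<lambda>v0 h. cop H h
          (\<lambda>h1 h2. ptensor V (tensor H H) v0 (ptensor H H h1 h2)))) \<and>
     (\<forall>v\<in>carr V. tsum V H (\<rho> v) (\<lambda>v0 h. scl V (counit H h) v0) = v)"

definition left_comodule ::
  "('h::ab_group_add, 'k::field, 'y) hopf_scheme \<Rightarrow> ('v::ab_group_add, 'k, 'z) vs_scheme
    \<Rightarrow> ('v \<Rightarrow> ('h, 'v, 'k) tens) \<Rightarrow> bool" where
  "left_comodule H V \<delta> \<longleftrightarrow>
     vect V \<and> linear_on V (tensor H V) \<delta> \<and>
     (\<forall>v\<in>carr V.
        tsum H V (\<delta> v) (\<lambda>h v0. tsum H V (\<delta> v0)
          (\<lambda>x y. ptensor H (tensor H V) h (ptensor H V x y))) =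
        tsum H V (\<delta> v) (\<lambda>h v0. cop H h
          (\<lambda>h1 h2. ptensor H (tensor H V) h1 (ptensor H V h2 v0)))) \<and>
     (\<forall>v\<in>carr V. tsum H V (\<delta> v) (\<lambda>h v0. scl V (counit H h) v0) = v)"

record ('a, 'k, 'h) comodalg = "('a, 'k) alg" +
  coact :: "'a \<Rightarrow> ('a, 'h, 'k) tens"

definition right_comodule_algebra ::
  "('h::ab_group_add, 'k::field, 'y) hopf_scheme \<Rightarrow> ('a::ab_group_add, 'k, 'h, 'z) comodalg_scheme
    \<Rightarrow> bool" where
  "right_comodule_algebra H A \<longleftrightarrow>
     algebra A \<and> right_comodule H A (coact A) \<and>
     coact A (aone A) = ptensor A H (aone A) (aone H) \<and>
     (\<forall>a\<in>carr A. \<forall>b\<in>carr A. coact A (amul A a b) =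
        tsum A H (coact A a) (\<lambda>a0 a1. tsum A H (coact A b)
          (\<lambda>b0 b1. ptensor A H (amul A a0 b0) (amul H a1 b1))))"

definition right_coinv ::
  "('h::ab_group_add, 'k::field, 'y) hopf_scheme \<Rightarrow> ('a::ab_group_add, 'k, 'h, 'z) comodalg_scheme
    \<Rightarrow> 'a set" where
  "right_coinv H A = {a \<in> carr A. coact A a = ptensor A H a (aone H)}"

definition self_comodalg ::
  "('h, 'k, 'z) hopf_scheme \<Rightarrow> ('h, 'k, 'h) comodalg" where
  "self_comodalg H = \<lparr> carr = carr H, scl = scl H, amul = amul H, aone = aone H, coact = comul H \<rparr>"


section \<open>Modules and exact sequences\<close>

definition left_module ::
  "('a::ab_group_add, 'k::field, 'y) alg_scheme \<Rightarrow> ('m::ab_group_add, 'k, 'z) vs_scheme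
    \<Rightarrow> ('a \<Rightarrow> 'm \<Rightarrow> 'm) \<Rightarrow> bool" where
  "left_module A M l \<longleftrightarrow>
     vect M \<and> bilinear_on A M M l \<and>
     (\<forall>m\<in>carr M. l (aone A) m = m) \<and>
     (\<forall>a\<in>carr A. \<forall>b\<in>carr A. \<forall>m\<in>carr M. l (amul A a b) m = l a (l b m))"

definition right_module ::
  "('a::ab_group_add, 'k::field, 'y) alg_scheme \<Rightarrow> ('m::ab_group_add, 'k, 'z) vs_scheme
    \<Rightarrow> ('m \<Rightarrow> 'a \<Rightarrow> 'm) \<Rightarrow> bool" where
  "right_module A M r \<longleftrightarrow>
     vect M \<and> bilinear_on M A M r \<and>
     (\<forall>m\<in>carr M. r m (aone A) = m) \<and>
     (\<forall>a\<in>carr A. \<forall>b\<in>carr A. \<forall>m\<in>carr M. r m (amul A a b) = r (r m a) b)"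

definition left_module_hom ::
  "('a::ab_group_add, 'k::field, 'x) alg_scheme
    \<Rightarrow> ('m::ab_group_add, 'k, 'y) vs_scheme \<Rightarrow> ('a \<Rightarrow> 'm \<Rightarrow> 'm)
    \<Rightarrow> ('n::ab_group_add, 'k, 'z) vs_scheme \<Rightarrow> ('a \<Rightarrow> 'n \<Rightarrow> 'n)
    \<Rightarrow> ('m \<Rightarrow> 'n) \<Rightarrow> bool" where
  "left_module_hom A M l N l' f \<longleftrightarrow>
     linear_on M N f \<and> (\<forall>a\<in>carr A. \<forall>m\<in>carr M. f (l a m) = l' a (f m))"

text \<open>Exactness of \<open>0 \<rightarrow> M \<rightarrow> N \<rightarrow> P \<rightarrow> 0\<close> (maps \<open>f\<close>, \<open>g\<close>) in left \<open>A\<close>-modules.\<close>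

definition short_exact ::
  "('a::ab_group_add, 'k::field, 'w) alg_scheme
    \<Rightarrow> ('m::ab_group_add, 'k, 'x) vs_scheme \<Rightarrow> ('a \<Rightarrow> 'm \<Rightarrow> 'm)
    \<Rightarrow> ('n::ab_group_add, 'k, 'y) vs_scheme \<Rightarrow> ('a \<Rightarrow> 'n \<Rightarrow> 'n)
    \<Rightarrow> ('p::ab_group_add, 'k, 'z) vs_scheme \<Rightarrow> ('a \<Rightarrow> 'p \<Rightarrow> 'p)
    \<Rightarrow> ('m \<Rightarrow> 'n) \<Rightarrow> ('n \<Rightarrow> 'p) \<Rightarrow> bool" where
  "short_exact A M lM N lN P lP f g \<longleftrightarrow>
     left_module A M lM \<and> left_module A N lN \<and> left_module A P lP \<and>
     left_module_hom A M lM N lN f \<and> left_module_hom A N lN P lP g \<and>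
     inj_on f (carr M) \<and> f ` carr M = {n \<in> carr N. g n = 0} \<and> g ` carr N = carr P"


section \<open>First order differential calculi\<close>

record ('w, 'k, 'a) calc = "('w, 'k) vs" +
  lmul :: "'a \<Rightarrow> 'w \<Rightarrow> 'w"
  rmul :: "'w \<Rightarrow> 'a \<Rightarrow> 'w"
  dif :: "'a \<Rightarrow> 'w"

record ('w, 'k, 'a, 'h) rcalc = "('w, 'k, 'a) calc" +
  rcoact :: "'w \<Rightarrow> ('w, 'h, 'k) tens"

record ('w, 'k, 'a, 'h) bicalc = "('w, 'k, 'a, 'h) rcalc" +
  lcoact :: "'w \<Rightarrow> ('h, 'w, 'k) tens"

definition fodc ::
  "('a::ab_group_add, 'k::field, 'y) alg_scheme \<Rightarrow> ('w::ab_group_add, 'k, 'a, 'z) calc_scheme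
    \<Rightarrow> bool" where
  "fodc A \<Omega> \<longleftrightarrow>
     left_module A \<Omega> (lmul \<Omega>) \<and> right_module A \<Omega> (rmul \<Omega>) \<and>
     (\<forall>a\<in>carr A. \<forall>\<omega>\<in>carr \<Omega>. \<forall>b\<in>carr A. rmul \<Omega> (lmul \<Omega> a \<omega>) b = lmul \<Omega> a (rmul \<Omega> \<omega> b)) \<and>
     linear_on A \<Omega> (dif \<Omega>) \<and>
     (\<forall>a\<in>carr A. \<forall>b\<in>carr A.
        dif \<Omega> (amul A a b) = rmul \<Omega> (dif \<Omega> a) b + lmul \<Omega> a (dif \<Omega> b)) \<and>
     carr \<Omega> = vspan \<Omega> {lmul \<Omega> a (dif \<Omega> b) | a b. a \<in> carr A \<and> b \<in> carr A}"

definition right_covariant_fodc ::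
  "('h::ab_group_add, 'k::field, 'x) hopf_scheme \<Rightarrow> ('a::ab_group_add, 'k, 'h, 'y) comodalg_scheme
    \<Rightarrow> ('w::ab_group_add, 'k, 'a, 'h, 'z) rcalc_scheme \<Rightarrow> bool" where
  "right_covariant_fodc H A \<Omega> \<longleftrightarrow>
     fodc A \<Omega> \<and> right_comodule H \<Omega> (rcoact \<Omega>) \<and>
     (\<forall>a\<in>carr A. \<forall>\<omega>\<in>carr \<Omega>.
        rcoact \<Omega> (lmul \<Omega> a \<omega>) =
          tsum A H (coact A a) (\<lambda>a0 a1. tsum \<Omega> H (rcoact \<Omega> \<omega>)
            (\<lambda>w0 w1. ptensor \<Omega> H (lmul \<Omega> a0 w0) (amul H a1 w1))) \<and>
        rcoact \<Omega> (rmul \<Omega> \<omega> a) =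
          tsum \<Omega> H (rcoact \<Omega> \<omega>) (\<lambda>w0 w1. tsum A H (coact A a)
            (\<lambda>a0 a1. ptensor \<Omega> H (rmul \<Omega> w0 a0) (amul H w1 a1)))) \<and>
     (\<forall>a\<in>carr A. rcoact \<Omega> (dif \<Omega> a) =
        tsum A H (coact A a) (\<lambda>a0 a1. ptensor \<Omega> H (dif \<Omega> a0) a1))"

definition bicovariant_fodc ::
  "('h::ab_group_add, 'k::field, 'y) hopf_scheme
    \<Rightarrow> ('w::ab_group_add, 'k, 'h, 'h, 'z) bicalc_scheme \<Rightarrow> bool" where
  "bicovariant_fodc H \<Gamma> \<longleftrightarrow>
     right_covariant_fodc H (self_comodalg H) \<Gamma> \<and> left_comodule H \<Gamma> (lcoact \<Gamma>) \<and>
     (\<forall>\<gamma>\<in>carr \<Gamma>.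
        tsum \<Gamma> H (rcoact \<Gamma> \<gamma>) (\<lambda>g h. tsum H \<Gamma> (lcoact \<Gamma> g)
          (\<lambda>x y. ptensor H (tensor \<Gamma> H) x (ptensor \<Gamma> H y h))) =
        tsum H \<Gamma> (lcoact \<Gamma> \<gamma>) (\<lambda>x g. tsum \<Gamma> H (rcoact \<Gamma> g)
          (\<lambda>y h. ptensor H (tensor \<Gamma> H) x (ptensor \<Gamma> H y h)))) \<and>
     (\<forall>h\<in>carr H. \<forall>\<gamma>\<in>carr \<Gamma>.
        lcoact \<Gamma> (lmul \<Gamma> h \<gamma>) =
          cop H h (\<lambda>h1 h2. tsum H \<Gamma> (lcoact \<Gamma> \<gamma>)
            (\<lambda>x g. ptensor H \<Gamma> (amul H h1 x) (lmul \<Gamma> h2 g))) \<and>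
        lcoact \<Gamma> (rmul \<Gamma> \<gamma> h) =
          tsum H \<Gamma> (lcoact \<Gamma> \<gamma>) (\<lambda>x g. cop H h
            (\<lambda>h1 h2. ptensor H \<Gamma> (amul H x h1) (rmul \<Gamma> g h2)))) \<and>
     (\<forall>h\<in>carr H. lcoact \<Gamma> (dif \<Gamma> h) = cop H h (\<lambda>h1 h2. ptensor H \<Gamma> h1 (dif \<Gamma> h2)))"

definition left_coinv_forms ::
  "('h::ab_group_add, 'k::field, 'y) hopf_scheme
    \<Rightarrow> ('w::ab_group_add, 'k, 'h, 'h, 'z) bicalc_scheme \<Rightarrow> ('w, 'k) vs" where
  "left_coinv_forms H \<Gamma> =
     \<lparr> carr = {\<gamma> \<in> carr \<Gamma>. lcoact \<Gamma> \<gamma> = ptensor H \<Gamma> (aone H) \<gamma>}, scl = scl \<Gamma> \<rparr>"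


section \<open>Quantum principal bundles\<close>

definition pullback_forms ::
  "('w::ab_group_add, 'k::field, 'a, 'z) calc_scheme \<Rightarrow> 'a set \<Rightarrow> 'w set" where
  "pullback_forms \<Omega> B = vspan \<Omega> {lmul \<Omega> b (dif \<Omega> b') | b b'. b \<in> B \<and> b' \<in> B}"

definition horizontal_forms ::
  "('h::ab_group_add, 'k::field, 'x) hopf_scheme \<Rightarrow> ('a::ab_group_add, 'k, 'h, 'y) comodalg_scheme
    \<Rightarrow> ('w::ab_group_add, 'k, 'a, 'z) calc_scheme \<Rightarrow> ('w, 'k) vs" where
  "horizontal_forms H A \<Omega> =
     \<lparr> carr = vspan \<Omega> {rmul \<Omega> (lmul \<Omega> a \<beta>) a' | a \<beta> a'.
          a \<in> carr A \<and> \<beta> \<in> pullback_forms \<Omega> (right_coinv H A) \<and> a' \<in> carr A},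
       scl = scl \<Omega> \<rparr>"

definition left_act_tensor ::
  "('a::ab_group_add, 'k::field, 'y) alg_scheme \<Rightarrow> ('v::ab_group_add, 'k, 'z) vs_scheme
    \<Rightarrow> 'a \<Rightarrow> ('a, 'v, 'k) tens \<Rightarrow> ('a, 'v, 'k) tens" where
  "left_act_tensor A X a t = tsum A X t (\<lambda>a' x. ptensor A X (amul A a a') x)"

text \<open>In \<open>a a'\<^sub>0 \<otimes> S(a'\<^sub>1) d a'\<^sub>2\<close> the sum over \<open>a'\<^sub>1 \<otimes> a'\<^sub>2\<close> is taken inside the second tensor
  factor, since only this sum is left coinvariant.\<close>

definition vertical_map ::
  "('h::ab_group_add, 'k::field, 'w) hopf_scheme \<Rightarrow> ('a::ab_group_add, 'k, 'h, 'x) comodalg_scheme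
    \<Rightarrow> ('o::ab_group_add, 'k, 'a, 'y) calc_scheme \<Rightarrow> ('g::ab_group_add, 'k, 'h, 'h, 'z) bicalc_scheme
    \<Rightarrow> ('o \<Rightarrow> ('a, 'g, 'k) tens) \<Rightarrow> bool" where
  "vertical_map H A \<Omega> \<Gamma> ver \<longleftrightarrow>
     linear_on \<Omega> (tensor A (left_coinv_forms H \<Gamma>)) ver \<and>
     (\<forall>a\<in>carr A. \<forall>a'\<in>carr A.
        ver (lmul \<Omega> a (dif \<Omega> a')) =
          tsum A H (coact A a') (\<lambda>a0 h. ptensor A (left_coinv_forms H \<Gamma>) (amul A a a0)
            (cop H h (\<lambda>h1 h2. lmul \<Gamma> (antipode H h1) (dif \<Gamma> h2)))))"

definition quantum_principal_bundle ::
  "('h::ab_group_add, 'k::field, 'w) hopf_scheme \<Rightarrow> ('a::ab_group_add, 'k, 'h, 'x) comodalg_scheme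
    \<Rightarrow> ('o::ab_group_add, 'k, 'a, 'h, 'y) rcalc_scheme
    \<Rightarrow> ('g::ab_group_add, 'k, 'h, 'h, 'z) bicalc_scheme \<Rightarrow> bool" where
  "quantum_principal_bundle H A \<Omega> \<Gamma> \<longleftrightarrow>
     right_comodule_algebra H A \<and> right_covariant_fodc H A \<Omega> \<and> bicovariant_fodc H \<Gamma> \<and>
     (\<exists>ver. vertical_map H A \<Omega> \<Gamma> ver \<and>
        short_exact A (horizontal_forms H A \<Omega>) (lmul \<Omega>) \<Omega> (lmul \<Omega>)
          (tensor A (left_coinv_forms H \<Gamma>)) (left_act_tensor A (left_coinv_forms H \<Gamma>))
          (\<lambda>\<omega>. \<omega>) ver)"

definition strong_bundle ::
  "('h::ab_group_add, 'k::field, 'x) hopf_scheme \<Rightarrow> ('a::ab_group_add, 'k, 'h, 'y) comodalg_scheme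
    \<Rightarrow> ('o::ab_group_add, 'k, 'a, 'z) calc_scheme \<Rightarrow> bool" where
  "strong_bundle H A \<Omega> \<longleftrightarrow>
     vspan \<Omega> {lmul \<Omega> a \<beta> | a \<beta>. a \<in> carr A \<and> \<beta> \<in> pullback_forms \<Omega> (right_coinv H A)} =
     vspan \<Omega> {rmul \<Omega> \<beta> a | a \<beta>. a \<in> carr A \<and> \<beta> \<in> pullback_forms \<Omega> (right_coinv H A)}"

definition diagonal_coaction ::
  "('h::ab_group_add, 'k::field, 'x) hopf_scheme
    \<Rightarrow> ('v::ab_group_add, 'k, 'y) vs_scheme \<Rightarrow> ('v \<Rightarrow> ('v, 'h, 'k) tens)
    \<Rightarrow> ('w::ab_group_add, 'k, 'z) vs_scheme \<Rightarrow> ('w \<Rightarrow> ('w, 'h, 'k) tens)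
    \<Rightarrow> ('v, 'w, 'k) tens \<Rightarrow> (('v, 'w, 'k) tens, 'h, 'k) tens" where
  "diagonal_coaction H V \<rho> W \<rho>' t =
     tsum V W t (\<lambda>v w. tsum V H (\<rho> v) (\<lambda>v0 v1. tsum W H (\<rho>' w)
       (\<lambda>w0 w1. ptensor (tensor V W) H (ptensor V W v0 w0) (amul H v1 w1))))"

definition connection ::
  "('h::ab_group_add, 'k::field, 'w) hopf_scheme \<Rightarrow> ('a::ab_group_add, 'k, 'h, 'x) comodalg_scheme
    \<Rightarrow> ('o::ab_group_add, 'k, 'a, 'h, 'y) rcalc_scheme
    \<Rightarrow> ('g::ab_group_add, 'k, 'h, 'h, 'z) bicalc_scheme
    \<Rightarrow> ('o \<Rightarrow> ('a, 'g, 'k) tens) \<Rightarrow> (('a, 'g, 'k) tens \<Rightarrow> 'o) \<Rightarrow> bool" where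
  "connection H A \<Omega> \<Gamma> ver c \<longleftrightarrow>
     (let X = left_coinv_forms H \<Gamma>; AX = tensor A X in
        left_module_hom A AX (left_act_tensor A X) \<Omega> (lmul \<Omega>) c \<and>
        (\<forall>t\<in>carr AX. rcoact \<Omega> (c t) =
           tsum AX H (diagonal_coaction H A (coact A) X (rcoact \<Gamma>) t)
             (\<lambda>u h. ptensor \<Omega> H (c u) h)) \<and>
        (\<forall>t\<in>carr AX. ver (c t) = t))"

definition strong_connection ::
  "('h::ab_group_add, 'k::field, 'w) hopf_scheme \<Rightarrow> ('a::ab_group_add, 'k, 'h, 'x) comodalg_scheme
    \<Rightarrow> ('o::ab_group_add, 'k, 'a, 'h, 'y) rcalc_scheme
    \<Rightarrow> ('g::ab_group_add, 'k, 'h, 'h, 'z) bicalc_scheme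
    \<Rightarrow> ('o \<Rightarrow> ('a, 'g, 'k) tens) \<Rightarrow> (('a, 'g, 'k) tens \<Rightarrow> 'o) \<Rightarrow> bool" where
  "strong_connection H A \<Omega> \<Gamma> ver c \<longleftrightarrow>
     connection H A \<Omega> \<Gamma> ver c \<and>
     (\<forall>a\<in>carr A. dif \<Omega> a - c (ver (dif \<Omega> a)) \<in>
        vspan \<Omega> {rmul \<Omega> \<beta> a' | \<beta> a'.
          \<beta> \<in> pullback_forms \<Omega> (right_coinv H A) \<and> a' \<in> carr A})"

text \<open>The universal calculus: kernel of the multiplication \<open>A \<otimes> A \<rightarrow> A\<close>, with
  \<open>d a = 1 \<otimes> a - a \<otimes> 1\<close> and diagonal coactions.\<close>

definition universal_calc ::
  "('h::ab_group_add, 'k::field, 'y) hopf_scheme \<Rightarrow> ('a::ab_group_add, 'k, 'h, 'z) comodalg_scheme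
    \<Rightarrow> (('a, 'a, 'k) tens, 'k, 'a, 'h) rcalc" where
  "universal_calc H A =
     \<lparr> carr = {t \<in> carr (tensor A A). tsum A A t (amul A) = 0},
       scl = scl (tensor A A),
       lmul = (\<lambda>a t. tsum A A t (\<lambda>x y. ptensor A A (amul A a x) y)),
       rmul = (\<lambda>t a. tsum A A t (\<lambda>x y. ptensor A A x (amul A y a))),
       dif = (\<lambda>a. ptensor A A (aone A) a - ptensor A A a (aone A)),
       rcoact = diagonal_coaction H A (coact A) A (coact A) \<rparr>"

definition universal_bicalc ::
  "('h::ab_group_add, 'k::field, 'y) hopf_scheme \<Rightarrow> (('h, 'h, 'k) tens, 'k, 'h, 'h) bicalc" where
  "universal_bicalc H =
     rcalc.extend (universal_calc H (self_comodalg H))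
       (bicalc.fields
         (\<lambda>t. tsum H H t (\<lambda>x y. cop H x (\<lambda>x1 x2. cop H y
            (\<lambda>y1 y2. ptensor H (tensor H H) (amul H x1 y1) (ptensor H H x2 y2))))))"

text \<open>\<open>\<pi>\<close> exhibits the covariant calculus \<open>\<Omega>\<close> as a quotient of the covariant calculus \<open>\<Omega>'\<close>.\<close>

definition calc_quotient ::
  "('h::ab_group_add, 'k::field, 'w) hopf_scheme \<Rightarrow> ('a::ab_group_add, 'k, 'x) alg_scheme
    \<Rightarrow> ('u::ab_group_add, 'k, 'a, 'h, 'y) rcalc_scheme
    \<Rightarrow> ('o::ab_group_add, 'k, 'a, 'h, 'z) rcalc_scheme \<Rightarrow> ('u \<Rightarrow> 'o) \<Rightarrow> bool" where
  "calc_quotient H A \<Omega>' \<Omega> \<pi> \<longleftrightarrow>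
     linear_on \<Omega>' \<Omega> \<pi> \<and> \<pi> ` carr \<Omega>' = carr \<Omega> \<and>
     (\<forall>a\<in>carr A. \<forall>\<omega>\<in>carr \<Omega>'.
        \<pi> (lmul \<Omega>' a \<omega>) = lmul \<Omega> a (\<pi> \<omega>) \<and> \<pi> (rmul \<Omega>' \<omega> a) = rmul \<Omega> (\<pi> \<omega>) a) \<and>
     (\<forall>a\<in>carr A. \<pi> (dif \<Omega>' a) = dif \<Omega> a) \<and>
     (\<forall>\<omega>\<in>carr \<Omega>'. rcoact \<Omega> (\<pi> \<omega>) =
        tsum \<Omega>' H (rcoact \<Omega>' \<omega>) (\<lambda>w h. ptensor \<Omega> H (\<pi> w) h))"

definition bicalc_quotient ::
  "('h::ab_group_add, 'k::field, 'w) hopf_scheme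
    \<Rightarrow> ('u::ab_group_add, 'k, 'h, 'h, 'y) bicalc_scheme
    \<Rightarrow> ('o::ab_group_add, 'k, 'h, 'h, 'z) bicalc_scheme \<Rightarrow> ('u \<Rightarrow> 'o) \<Rightarrow> bool" where
  "bicalc_quotient H \<Gamma>' \<Gamma> \<pi> \<longleftrightarrow>
     calc_quotient H H \<Gamma>' \<Gamma> \<pi> \<and>
     (\<forall>\<omega>\<in>carr \<Gamma>'. lcoact \<Gamma> (\<pi> \<omega>) =
        tsum H \<Gamma>' (lcoact \<Gamma>' \<omega>) (\<lambda>h w. ptensor H \<Gamma> h (\<pi> w)))"

definition hopf_galois ::
  "('h::ab_group_add, 'k::field, 'y) hopf_scheme \<Rightarrow> ('a::ab_group_add, 'k, 'h, 'z) comodalg_scheme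
    \<Rightarrow> bool" where
  "hopf_galois H A \<longleftrightarrow>
     (let B = right_coinv H A in
        bij_betw
          (\<lambda>t. tsum_over A B t
            (\<lambda>a a'. tsum A H (coact A a') (\<lambda>a0 a1. ptensor A H (amul A a a0) a1)))
          (carr (tensor_over A B)) (carr (tensor A H)))"

definition regular_bundle ::
  "('h::ab_group_add, 'k::field, 'w) hopf_scheme \<Rightarrow> ('a::ab_group_add, 'k, 'h, 'x) comodalg_scheme
    \<Rightarrow> ('o::ab_group_add, 'k, 'a, 'h, 'y) rcalc_scheme
    \<Rightarrow> ('g::ab_group_add, 'k, 'h, 'h, 'z) bicalc_scheme \<Rightarrow> bool" where
  "regular_bundle H A \<Omega> \<Gamma> \<longleftrightarrow>
     hopf_galois H A \<and>
     quantum_principal_bundle H A (universal_calc H A) (universal_bicalc H) \<and>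
     (\<exists>ver c. vertical_map H A (universal_calc H A) (universal_bicalc H) ver \<and>
        strong_connection H A (universal_calc H A) (universal_bicalc H) ver c) \<and>
     (\<exists>\<pi>. calc_quotient H A (universal_calc H A) \<Omega> \<pi>) \<and>
     (\<exists>\<pi>. bicalc_quotient H (universal_bicalc H) \<Gamma> \<pi>)"


section \<open>Crossed products\<close>

text \<open>\<open>\<sigma>i\<close> is the convolution inverse \<open>\<sigma>\<^sup>-\<^sup>1\<close>.\<close>

definition twisted_module_algebra ::
  "('h::ab_group_add, 'k::field, 'y) hopf_scheme \<Rightarrow> ('b::ab_group_add, 'k, 'z) alg_scheme
    \<Rightarrow> ('h \<Rightarrow> 'b \<Rightarrow> 'b) \<Rightarrow> ('h \<Rightarrow> 'h \<Rightarrow> 'b) \<Rightarrow> ('h \<Rightarrow> 'h \<Rightarrow> 'b) \<Rightarrow> bool" where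
  "twisted_module_algebra H B act \<sigma> \<sigma>i \<longleftrightarrow>
     algebra B \<and> bilinear_on H B B act \<and>
     (\<forall>h\<in>carr H. act h (aone B) = scl B (counit H h) (aone B)) \<and>
     (\<forall>h\<in>carr H. \<forall>b\<in>carr B. \<forall>b'\<in>carr B.
        act h (amul B b b') = cop H h (\<lambda>h1 h2. amul B (act h1 b) (act h2 b'))) \<and>
     bilinear_on H H B \<sigma> \<and> bilinear_on H H B \<sigma>i \<and>
     (\<forall>h\<in>carr H. \<forall>g\<in>carr H.
        cop H h (\<lambda>h1 h2. cop H g (\<lambda>g1 g2. amul B (\<sigma> h1 g1) (\<sigma>i h2 g2))) =
          scl B (counit H h * counit H g) (aone B) \<and>
        cop H h (\<lambda>h1 h2. cop H g (\<lambda>g1 g2. amul B (\<sigma>i h1 g1) (\<sigma> h2 g2))) =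
          scl B (counit H h * counit H g) (aone B)) \<and>
     (\<forall>b\<in>carr B. act (aone H) b = b) \<and>
     (\<forall>h\<in>carr H. \<forall>g\<in>carr H. \<forall>b\<in>carr B.
        act h (act g b) = cop3 H h (\<lambda>h1 h2 h3. cop3 H g (\<lambda>g1 g2 g3.
          amul B (amul B (\<sigma> h1 g1) (act (amul H h2 g2) b)) (\<sigma>i h3 g3)))) \<and>
     (\<forall>h\<in>carr H. \<sigma> h (aone H) = scl B (counit H h) (aone B) \<and>
                 \<sigma> (aone H) h = scl B (counit H h) (aone B)) \<and>
     (\<forall>h\<in>carr H. \<forall>g\<in>carr H. \<forall>k\<in>carr H.
        cop H h (\<lambda>h1 h2. cop H g (\<lambda>g1 g2. cop H k (\<lambda>k1 k2.
          amul B (act h1 (\<sigma> g1 k1)) (\<sigma> h2 (amul H g2 k2))))) =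
        cop H h (\<lambda>h1 h2. cop H g (\<lambda>g1 g2.
          amul B (\<sigma> h1 g1) (\<sigma> (amul H h2 g2) k))))"

definition crossed_product ::
  "('h::ab_group_add, 'k::field, 'y) hopf_scheme \<Rightarrow> ('b::ab_group_add, 'k, 'z) alg_scheme
    \<Rightarrow> ('h \<Rightarrow> 'b \<Rightarrow> 'b) \<Rightarrow> ('h \<Rightarrow> 'h \<Rightarrow> 'b) \<Rightarrow> (('b, 'h, 'k) tens, 'k, 'h) comodalg" where
  "crossed_product H B act \<sigma> =
     \<lparr> carr = carr (tensor B H),
       scl = scl (tensor B H),
       amul = (\<lambda>x y. tsum B H x (\<lambda>b h. tsum B H y (\<lambda>b' h'.
         cop3 H h (\<lambda>h1 h2 h3. cop H h' (\<lambda>g1 g2.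
           ptensor B H (amul B (amul B b (act h1 b')) (\<sigma> h2 g1)) (amul H h3 g2)))))),
       aone = ptensor B H (aone B) (aone H),
       coact = (\<lambda>x. tsum B H x (\<lambda>b h. cop H h (\<lambda>h1 h2.
         ptensor (tensor B H) H (ptensor B H b h1) h2))) \<rparr>"

definition twisted_module_fodc ::
  "('h::ab_group_add, 'k::field, 'x) hopf_scheme \<Rightarrow> ('b::ab_group_add, 'k, 'y) alg_scheme
    \<Rightarrow> ('h \<Rightarrow> 'b \<Rightarrow> 'b) \<Rightarrow> ('h \<Rightarrow> 'h \<Rightarrow> 'b)
    \<Rightarrow> ('o::ab_group_add, 'k, 'b, 'z) calc_scheme \<Rightarrow> ('h \<Rightarrow> 'o \<Rightarrow> 'o) \<Rightarrow> bool" where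
  "twisted_module_fodc H B act \<sigma> \<Omega> wact \<longleftrightarrow>
     fodc B \<Omega> \<and> bilinear_on H \<Omega> \<Omega> wact \<and>
     (\<forall>h\<in>carr H. \<forall>b\<in>carr B. \<forall>b'\<in>carr B.
        wact h (lmul \<Omega> b (dif \<Omega> b')) =
          cop H h (\<lambda>h1 h2. lmul \<Omega> (act h1 b) (wact h2 (dif \<Omega> b')))) \<and>
     (\<forall>h\<in>carr H. \<forall>b\<in>carr B. dif \<Omega> (act h b) = wact h (dif \<Omega> b)) \<and>
     (\<forall>h\<in>carr H. \<forall>g\<in>carr H. dif \<Omega> (\<sigma> h g) = 0)"

text \<open>The left action of \<open>B #\<^sub>\<sigma> H\<close> on \<open>\<Omega>\<^sup>1(B) \<otimes> H\<close> and on \<open>B \<otimes> \<Omega>\<^sup>1(H)\<close>.\<close>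

definition crossed_lmul_hor ::
  "('h::ab_group_add, 'k::field, 'x) hopf_scheme \<Rightarrow> ('b::ab_group_add, 'k, 'y) alg_scheme
    \<Rightarrow> ('h \<Rightarrow> 'h \<Rightarrow> 'b)
    \<Rightarrow> ('o::ab_group_add, 'k, 'b, 'z) calc_scheme \<Rightarrow> ('h \<Rightarrow> 'o \<Rightarrow> 'o)
    \<Rightarrow> ('b, 'h, 'k) tens \<Rightarrow> ('o, 'h, 'k) tens \<Rightarrow> ('o, 'h, 'k) tens" where
  "crossed_lmul_hor H B \<sigma> \<Omega> wact x s =
     tsum B H x (\<lambda>b' h'. tsum \<Omega> H s (\<lambda>\<beta> h.
       cop3 H h' (\<lambda>g1 g2 g3. cop H h (\<lambda>h1 h2.
         ptensor \<Omega> H (rmul \<Omega> (lmul \<Omega> b' (wact g1 \<beta>)) (\<sigma> g2 h1)) (amul H g3 h2)))))"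

definition crossed_lmul_ver ::
  "('h::ab_group_add, 'k::field, 'x) hopf_scheme \<Rightarrow> ('b::ab_group_add, 'k, 'y) alg_scheme
    \<Rightarrow> ('h \<Rightarrow> 'b \<Rightarrow> 'b) \<Rightarrow> ('h \<Rightarrow> 'h \<Rightarrow> 'b)
    \<Rightarrow> ('g::ab_group_add, 'k, 'h, 'h, 'z) bicalc_scheme
    \<Rightarrow> ('b, 'h, 'k) tens \<Rightarrow> ('b, 'g, 'k) tens \<Rightarrow> ('b, 'g, 'k) tens" where
  "crossed_lmul_ver H B act \<sigma> \<Gamma> x t =
     tsum B H x (\<lambda>b' h'. tsum B \<Gamma> t (\<lambda>b \<gamma>.
       cop3 H h' (\<lambda>g1 g2 g3. tsum H \<Gamma> (lcoact \<Gamma> \<gamma>) (\<lambda>\<gamma>1 \<gamma>0.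
         ptensor B \<Gamma> (amul B (amul B b' (act g1 b)) (\<sigma> g2 \<gamma>1)) (lmul \<Gamma> g3 \<gamma>0)))))"

definition crossed_calc ::
  "('h::ab_group_add, 'k::field, 'w) hopf_scheme \<Rightarrow> ('b::ab_group_add, 'k, 'x) alg_scheme
    \<Rightarrow> ('h \<Rightarrow> 'b \<Rightarrow> 'b) \<Rightarrow> ('h \<Rightarrow> 'h \<Rightarrow> 'b)
    \<Rightarrow> ('o::ab_group_add, 'k, 'b, 'y) calc_scheme \<Rightarrow> ('h \<Rightarrow> 'o \<Rightarrow> 'o)
    \<Rightarrow> ('g::ab_group_add, 'k, 'h, 'h, 'z) bicalc_scheme
    \<Rightarrow> (('o, 'h, 'k) tens \<times> ('b, 'g, 'k) tens, 'k, ('b, 'h, 'k) tens, 'h) rcalc" where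
  "crossed_calc H B act \<sigma> \<Omega> wact \<Gamma> =
     (let M = direct_sum (tensor \<Omega> H) (tensor B \<Gamma>) in
     \<lparr> carr = carr M,
       scl = scl M,
       lmul = (\<lambda>x (s, t). (crossed_lmul_hor H B \<sigma> \<Omega> wact x s, crossed_lmul_ver H B act \<sigma> \<Gamma> x t)),
       rmul = (\<lambda>(s, t) x.
         (tsum \<Omega> H s (\<lambda>\<beta> h. tsum B H x (\<lambda>b' h'.
            cop3 H h (\<lambda>h1 h2 h3. cop H h' (\<lambda>g1 g2.
              ptensor \<Omega> H (rmul \<Omega> (rmul \<Omega> \<beta> (act h1 b')) (\<sigma> h2 g1)) (amul H h3 g2))))),
          tsum B \<Gamma> t (\<lambda>b \<gamma>. tsum B H x (\<lambda>b' h'.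
            tsum H \<Gamma> (lcoact \<Gamma> \<gamma>) (\<lambda>k \<gamma>0. cop H k (\<lambda>\<gamma>2 \<gamma>1. cop H h' (\<lambda>g1 g2.
              ptensor B \<Gamma> (amul B (amul B b (act \<gamma>2 b')) (\<sigma> \<gamma>1 g1)) (rmul \<Gamma> \<gamma>0 g2)))))))),
       dif = (\<lambda>x. tsum B H x (\<lambda>b h. (ptensor \<Omega> H (dif \<Omega> b) h, ptensor B \<Gamma> b (dif \<Gamma> h)))),
       rcoact = (\<lambda>(s, t).
         tsum \<Omega> H s (\<lambda>\<beta> h. cop H h (\<lambda>h1 h2. ptensor M H (ptensor \<Omega> H \<beta> h1, 0) h2)) +
         tsum B \<Gamma> t (\<lambda>b \<gamma>. tsum \<Gamma> H (rcoact \<Gamma> \<gamma>)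
           (\<lambda>\<gamma>0 \<gamma>1. ptensor M H (0, ptensor B \<Gamma> b \<gamma>0) \<gamma>1))) \<rparr>)"

end

theory Submission
  imports Defs
begin

text \<open>
  Write \<open>A = B #\<^sub>\<sigma> H\<close>, \<open>\<Omega>\<close> and \<open>\<Gamma>\<close> for the calculi on \<open>B\<close> and \<open>H\<close>, and \<open>X\<close> for the left coinvariant
  forms in \<open>\<Gamma>\<close>.

  Both summands of \<open>(\<Omega> \<otimes> H) \<oplus> (B \<otimes> \<Gamma>)\<close> are instances of one construction (locale
  \<open>crossed\<close>): if \<open>M\<close> is a \<open>B\<close>-bimodule with a twisted action of \<open>H\<close> and \<open>N\<close> is a bicovariant
  \<open>H\<close>-bimodule, then \<open>M \<otimes> N\<close> is an \<open>A\<close>-bimodule with an \<open>H\<close>-coaction.  The pair \<open>(B, H)\<close> gives \<open>A\<close>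
  itself, so associativity of the product is the same computation as the bimodule axioms
  (\<open>gl_mul\<close>, \<open>gr_mul\<close>, \<open>gl_gr\<close>): it uses the cocycle identity and the twisted module identity only.
  The Leibniz rule holds in each summand separately because \<open>d \<circ> \<sigma> = 0\<close>, and invertibility of \<open>\<sigma>\<close>
  lets the forms \<open>x dy\<close> reach all of \<open>B \<otimes> \<Gamma>\<close> (\<open>calc_gen_ver\<close>).

  The fundamental theorem of Hopf modules says \<open>\<Gamma> \<cong> H \<otimes> X\<close>, hence
  \<open>B \<otimes> \<Gamma> \<cong> A \<otimes> X\<close> (\<open>phi_psi\<close>, \<open>psi_phi\<close>).  The vertical map is the projection onto the second summand
  followed by this isomorphism, so its kernel is \<open>\<Omega> \<otimes> H\<close> and it is onto.

  The forms generated by the base are \<open>\<Omega> \<otimes> 1\<close>.  Right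
  multiplication by \<open>1 # h\<close> yields \<open>\<Omega> \<otimes> H\<close> at once.  For left multiplication the section
  \<open>\<gamma> h = 1 # h\<close> and its convolution inverse \<open>\<delta>\<close> are combined with the inverse of the antipode, which gives
  \<open>\<beta> \<otimes> h = \<delta>(S\<^sup>-\<^sup>1 h\<^sub>3) \<cdot> (\<gamma>(S\<^sup>-\<^sup>1 h\<^sub>2) \<cdot> (\<beta> \<otimes> h\<^sub>1))\<close>, where the inner expression lies in \<open>\<Omega> \<otimes> 1\<close>
  (\<open>strong_generator\<close>).  This is where bijectivity of the antipode enters.

  Regularity holds for every comodule algebra with a colinear, convolution invertible section
  \<open>\<gamma>\<close> (locale \<open>cleft\<close>).  With \<open>\<varpi> h = S(h\<^sub>1) d h\<^sub>2\<close>, the universal vertical map is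
  \<open>a \<otimes> a' \<mapsto> a a'\<^sub>0 \<otimes> \<varpi>(a'\<^sub>1)\<close>, it is split by the connection
  \<open>a \<otimes> \<varpi>(h) \<mapsto> a \<delta>(h\<^sub>1) \<otimes> \<gamma>(h\<^sub>2) - \<epsilon>(h) a \<otimes> 1\<close>, and \<open>a \<otimes> h \<mapsto> a \<delta>(h\<^sub>1) \<otimes>\<^sub>B \<gamma>(h\<^sub>2)\<close> inverts the
  Hopf-Galois map.  Strongness of the connection and exactness of the universal sequence both follow from
  the projection \<open>\<pi> a = a\<^sub>0 \<delta>(a\<^sub>1)\<close> of \<open>A\<close> onto \<open>B\<close>: one has \<open>a = \<pi>(a\<^sub>0) \<gamma>(a\<^sub>1)\<close>, and
  \<open>da - c(ver(da)) = d(\<pi> a\<^sub>0) \<gamma>(a\<^sub>1)\<close> (\<open>strong_formula\<close>).  Finally, every covariant calculus is the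
  quotient of the universal one by \<open>x \<otimes> y \<mapsto> x dy\<close>.

  An identity between Sweedler expressions is checked on pure tensors and
  then proved by rewriting both sides to a normal form of nested sums.  To apply an identity such as
  \<open>S(h\<^sub>1) h\<^sub>2 = \<epsilon>(h)\<close> inside a larger expression, an intermediate expression is stated in which one side of
  the identity occurs as an inner sum over a single coproduct; this explains the shape of the intermediate terms.
\<close>

section \<open>Vector spaces and linear maps on carriers\<close>

lemma vectD:
  assumes "vect V"
  shows vect_vs: "vector_space (scl V)" and vect_subspace: "module.subspace (scl V) (carr V)"
  using assms by (simp_all add: vect_def)

lemma vect_closed:
  assumes "vect V"
  shows vect_zero: "0 \<in> carr V"
    and vect_add: "x \<in> carr V \<Longrightarrow> y \<in> carr V \<Longrightarrow> x + y \<in> carr V"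
    and vect_diff: "x \<in> carr V \<Longrightarrow> y \<in> carr V \<Longrightarrow> x - y \<in> carr V"
    and vect_scl: "x \<in> carr V \<Longrightarrow> scl V c x \<in> carr V"
proof -
  interpret vector_space "scl V" using assms by (rule vect_vs)
  have S: "subspace (carr V)" using assms by (rule vect_subspace)
  show "0 \<in> carr V" "x \<in> carr V \<Longrightarrow> y \<in> carr V \<Longrightarrow> x + y \<in> carr V"
    "x \<in> carr V \<Longrightarrow> y \<in> carr V \<Longrightarrow> x - y \<in> carr V" "x \<in> carr V \<Longrightarrow> scl V c x \<in> carr V"
    using S by (auto intro: subspace_0 subspace_add subspace_diff subspace_scale)
qed

lemma vect_arith:
  assumes "vect V"
  shows scl_add: "scl V c (x + y) = scl V c x + scl V c y"
    and scl_diff: "scl V c (x - y) = scl V c x - scl V c y"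
    and scl_zero: "scl V c 0 = 0"
    and scl_one: "scl V 1 x = x"
    and scl_scl: "scl V c (scl V d x) = scl V (c * d) x"
    and scl_add_left: "scl V (c + d) x = scl V c x + scl V d x"
proof -
  interpret vector_space "scl V" using assms by (rule vect_vs)
  show "scl V c (x + y) = scl V c x + scl V c y" "scl V c (x - y) = scl V c x - scl V c y"
    "scl V c 0 = 0" "scl V 1 x = x" "scl V c (scl V d x) = scl V (c * d) x"
    "scl V (c + d) x = scl V c x + scl V d x"
    by (simp_all add: scale_right_distrib scale_right_diff_distrib scale_left_distrib)
qed

lemma vect_sum_list:
  assumes "vect V" and "\<And>x. x \<in> set xs \<Longrightarrow> f x \<in> carr V"
  shows "(\<Sum>x\<leftarrow>xs. f x) \<in> carr V"
  using assms(2) by (induction xs) (auto simp: vect_zero[OF assms(1)] vect_add[OF assms(1)])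

lemma vectI:
  assumes "vector_space (scl V)" and "0 \<in> carr V"
    and "\<And>x y. x \<in> carr V \<Longrightarrow> y \<in> carr V \<Longrightarrow> x + y \<in> carr V"
    and "\<And>c x. x \<in> carr V \<Longrightarrow> scl V c x \<in> carr V"
  shows "vect V"
proof -
  interpret vector_space "scl V" by fact
  show ?thesis using assms by (auto simp: vect_def subspace_def)
qed

lemma linear_onI:
  assumes "\<And>v. v \<in> carr V \<Longrightarrow> f v \<in> carr W"
    and "\<And>v v'. v \<in> carr V \<Longrightarrow> v' \<in> carr V \<Longrightarrow> f (v + v') = f v + f v'"
    and "\<And>c v. v \<in> carr V \<Longrightarrow> f (scl V c v) = scl W c (f v)"
  shows "linear_on V W f"
  using assms by (auto simp: linear_on_def)

lemma linear_onD:
  assumes "linear_on V W f"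
  shows linear_on_in: "v \<in> carr V \<Longrightarrow> f v \<in> carr W"
    and linear_on_add: "v \<in> carr V \<Longrightarrow> v' \<in> carr V \<Longrightarrow> f (v + v') = f v + f v'"
    and linear_on_scl: "v \<in> carr V \<Longrightarrow> f (scl V c v) = scl W c (f v)"
  using assms by (auto simp: linear_on_def)

lemma linear_on_zero:
  assumes "linear_on V W f" "vect V" shows "f 0 = 0"
  using linear_on_add[OF assms(1) vect_zero[OF assms(2)] vect_zero[OF assms(2)]] by simp

lemma linear_on_diff:
  assumes "linear_on V W f" "vect V" "v \<in> carr V" "v' \<in> carr V" shows "f (v - v') = f v - f v'"
  using linear_on_add[OF assms(1), of "v - v'" v'] vect_diff[OF assms(2-4)] assms(4)
  by (simp add: algebra_simps)

lemma linear_on_sum_list: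
  assumes "linear_on V W f" "vect V" "\<And>x. x \<in> set xs \<Longrightarrow> g x \<in> carr V"
  shows "f (\<Sum>x\<leftarrow>xs. g x) = (\<Sum>x\<leftarrow>xs. f (g x))"
  using assms(3)
  by (induction xs)
    (auto simp: linear_on_zero[OF assms(1,2)] linear_on_add[OF assms(1)] vect_sum_list[OF assms(2)])

lemma linear_on_compose:
  assumes "linear_on V W g" "linear_on Z V f" shows "linear_on Z W (\<lambda>z. g (f z))"
  using assms by (auto simp: linear_on_def)

lemma linear_on_id: "linear_on V V (\<lambda>x. x)"
  by (auto simp: linear_on_def)

lemma linear_on_cong:
  "carr V = carr V' \<Longrightarrow> scl V = scl V' \<Longrightarrow> (\<And>v. v \<in> carr V' \<Longrightarrow> f v = g v) \<Longrightarrow> vect V' \<Longrightarrow>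
    linear_on V W f \<longleftrightarrow> linear_on V' W g"
  by (auto simp: linear_on_def vect_add vect_scl)

lemma linear_on_plus:
  "linear_on Z U f \<Longrightarrow> linear_on Z U g \<Longrightarrow> vect U \<Longrightarrow> linear_on Z U (\<lambda>z. f z + g z)"
  by (auto simp: linear_on_def vect_add scl_add)

lemma linear_on_minus:
  "linear_on Z U f \<Longrightarrow> linear_on Z U g \<Longrightarrow> vect U \<Longrightarrow> linear_on Z U (\<lambda>z. f z - g z)"
  by (auto simp: linear_on_def vect_diff scl_diff)

lemma linear_on_smult:
  "linear_on Z U f \<Longrightarrow> vect U \<Longrightarrow> linear_on Z U (\<lambda>z. scl U c (f z))"
  by (auto simp: linear_on_def vect_scl scl_add scl_scl mult.commute)

lemma linear_on_const_zero: "vect U \<Longrightarrow> linear_on Z U (\<lambda>z. 0)"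
  by (auto simp: linear_on_def vect_zero scl_zero)

lemma bilinear_onI:
  assumes "\<And>v. v \<in> carr V \<Longrightarrow> linear_on W U (f v)"
    and "\<And>w. w \<in> carr W \<Longrightarrow> linear_on V U (\<lambda>v. f v w)"
  shows "bilinear_on V W U f"
  using assms by (auto simp: bilinear_on_def)

lemma bilinear_onD:
  assumes "bilinear_on V W U f"
  shows bilinear_on_right: "v \<in> carr V \<Longrightarrow> linear_on W U (f v)"
    and bilinear_on_left: "w \<in> carr W \<Longrightarrow> linear_on V U (\<lambda>v. f v w)"
  using assms by (auto simp: bilinear_on_def)

text \<open>
  Tensor products see only the carrier and the scalar multiplication, so a record with more structure may be
  exchanged for a simpler one.
\<close>

lemma tensor_cong:
  assumes "carr V = carr V'" "scl V = scl V'" "carr W = carr W'" "scl W = scl W'"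
  shows "tensor V W = tensor V' W'" "ptensor V W = ptensor V' W'" "tsum V W = tsum V' W'"
proof -
  have "bilforms V W = bilforms V' W'" using assms by (simp add: bilforms_def)
  then show "tensor V W = tensor V' W'" "ptensor V W = ptensor V' W'" "tsum V W = tsum V' W'"
    using assms by (simp_all add: tensor_def ptensor_def tsum_def)
qed

lemma ptensor_cong:
  assumes "scl V = scl V'" "scl W = scl W'"
  shows "ptensor V W = ptensor V' W'"
  using assms by (simp add: ptensor_def bilforms_def)

section \<open>Sweedler sums\<close>

text \<open>
  The representation chosen by \<open>eval_sum\<close>, exposed so that Sweedler sums become sums over a list.
\<close>

definition trep where
  "trep V W t = (SOME xs. set xs \<subseteq> carr V \<times> carr W \<and> t = (\<Sum>(v, w)\<leftarrow>xs. ptensor V W v w))"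

lemma tsum_trep: "tsum V W t f = (\<Sum>(v, w)\<leftarrow>trep V W t. f v w)"
  by (simp add: tsum_def eval_sum_def ptensor_def trep_def)

lemma trep:
  assumes V: "vect V" and t: "t \<in> carr (tensor V W)"
  shows "set (trep V W t) \<subseteq> carr V \<times> carr W"
    and "t = (\<Sum>(v, w)\<leftarrow>trep V W t. ptensor V W v w)"
proof -
  have "\<exists>xs. set xs \<subseteq> carr V \<times> carr W \<and> t = (\<Sum>(v, w)\<leftarrow>xs. ptensor V W v w)"
    unfolding ptensor_def
    by (rule eval_space_representation[of _ "scl V"])
      (use t V in \<open>auto simp: vect_scl bilforms_def linear_iff tensor_def\<close>)
  from someI_ex[OF this] show "set (trep V W t) \<subseteq> carr V \<times> carr W"
    "t = (\<Sum>(v, w)\<leftarrow>trep V W t. ptensor V W v w)" by (auto simp: trep_def)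
qed

lemma vect_tensor:
  fixes V :: "('a::ab_group_add, 'c::field, 'x) vs_scheme" and W :: "('b::ab_group_add, 'c, 'y) vs_scheme"
  shows "vect (tensor V W)"
proof -
  interpret vector_space "\<lambda>(c::'c) t (\<phi> :: 'a \<Rightarrow> 'b \<Rightarrow> 'c). c * t \<phi>" by (rule vector_space_pointwise)
  show ?thesis by (simp add: vect_def tensor_def eval_space_def subspace_span vector_space_axioms)
qed

lemma ptensor_bilinear:
  fixes V :: "('a::ab_group_add, 'c::field, 'x) vs_scheme" and W :: "('b::ab_group_add, 'c, 'y) vs_scheme"
  assumes "vect V" "vect W" shows "bilinear_on V W (tensor V W) (ptensor V W)"
proof -
  interpret vector_space "\<lambda>(c::'c) t (\<phi> :: 'a \<Rightarrow> 'b \<Rightarrow> 'c). c * t \<phi>" by (rule vector_space_pointwise)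
  have *: "ptensor V W v w \<in> carr (tensor V W)" if "v \<in> carr V" "w \<in> carr W" for v w
    using that by (auto simp: ptensor_def tensor_def eval_space_def intro!: span_base)
  show ?thesis
    unfolding bilinear_on_def linear_on_def
    by (intro conjI ballI allI *; simp?; rule ext;
        simp add: tensor_def eval_space_def ptensor_def evaluation_def bilforms_def linear_iff)
qed

lemma tsum_cong:
  assumes "t = t'" "vect V" "t' \<in> carr (tensor V W)"
    and "\<And>v w. v \<in> carr V \<Longrightarrow> w \<in> carr W \<Longrightarrow> f v w = g v w"
  shows "tsum V W t f = tsum V W t' g"
proof -
  have "map (\<lambda>(v, w). f v w) (trep V W t') = map (\<lambda>(v, w). g v w) (trep V W t')"
    using trep(1)[OF assms(2,3)] assms(4) by (intro map_cong) auto
  then show ?thesis by (simp only: tsum_trep assms(1))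
qed

lemma tsum_in:
  assumes "vect V" "t \<in> carr (tensor V W)" "vect U"
    and "\<And>v w. v \<in> carr V \<Longrightarrow> w \<in> carr W \<Longrightarrow> f v w \<in> carr U"
  shows "tsum V W t f \<in> carr U"
  unfolding tsum_trep using trep(1)[OF assms(1,2)] assms(4) by (auto intro!: vect_sum_list assms(3))

lemma sum_list_pair_swap:
  "(\<Sum>(v, w)\<leftarrow>xs. \<Sum>(x, y)\<leftarrow>ys. f v w x y) = (\<Sum>(x, y)\<leftarrow>ys. \<Sum>(v, w)\<leftarrow>xs. (f v w x y :: 'u::comm_monoid_add))"
proof (induction xs)
  case Nil show ?case by (induction ys) auto
next
  case (Cons a xs)
  have "(\<Sum>(x, y)\<leftarrow>ys. g x y + h x y) = (\<Sum>(x, y)\<leftarrow>ys. g x y) + (\<Sum>(x, y)\<leftarrow>ys. (h x y::'u))" for g h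
    by (induction ys) (auto simp: algebra_simps)
  with Cons show ?case by (auto split: prod.splits)
qed

lemma tsum_swap:
  "tsum V W t (\<lambda>v w. tsum V' W' s (\<lambda>x y. f v w x y)) =
   tsum V' W' s (\<lambda>x y. tsum V W t (\<lambda>v w. f v w x y))"
  unfolding tsum_trep by (rule sum_list_pair_swap)

lemma tsum_plus: "tsum V W t (\<lambda>v w. f v w + g v w) = tsum V W t f + tsum V W t g"
  by (simp add: tsum_trep split_def sum_list_addf)

lemma tsum_minus:
  "tsum V W t (\<lambda>v w. f v w - g v w :: 'u::ab_group_add) = tsum V W t f - tsum V W t g"
  using tsum_plus[of V W t "\<lambda>v w. f v w - g v w" g] by (simp add: algebra_simps)

lemma tsum_zero: "tsum V W t (\<lambda>v w. 0) = 0"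
  unfolding tsum_trep by (auto simp: sum_list_0 split_def)

lemma tsum_push:
  assumes "linear_on U U' F" "vect U" "vect V" "t \<in> carr (tensor V W)"
    and "\<And>v w. v \<in> carr V \<Longrightarrow> w \<in> carr W \<Longrightarrow> f v w \<in> carr U"
  shows "F (tsum V W t f) = tsum V W t (\<lambda>v w. F (f v w))"
proof -
  have "F (\<Sum>x\<leftarrow>trep V W t. case x of (v, w) \<Rightarrow> f v w) =
      (\<Sum>x\<leftarrow>trep V W t. F (case x of (v, w) \<Rightarrow> f v w))"
    using trep(1)[OF assms(3,4)] assms(5) by (intro linear_on_sum_list[OF assms(1,2)]) auto
  then show ?thesis by (simp add: tsum_trep split_def)
qed

lemma tsum_scl:
  assumes "vect U" shows "tsum V W t (\<lambda>v w. scl U c (f v w)) = scl U c (tsum V W t f)"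
proof -
  have "(\<Sum>(v,w)\<leftarrow>xs. scl U c (f v w)) = scl U c (\<Sum>(v,w)\<leftarrow>xs. f v w)" for xs
    by (induction xs) (auto simp: scl_add[OF assms] scl_zero[OF assms])
  then show ?thesis by (simp add: tsum_trep)
qed

lemma tsum_id:
  assumes "vect V" "t \<in> carr (tensor V W)"
  shows "tsum V W t (ptensor V W) = t"
  using trep(2)[OF assms] by (simp add: tsum_trep)

lemma tsum_ptensor:
  assumes "vect V" "vect W" "vect U" "v \<in> carr V" "w \<in> carr W"
    and "\<And>v. v \<in> carr V \<Longrightarrow> linear_on W U (f v)"
    and "\<And>w. w \<in> carr W \<Longrightarrow> linear_on V U (\<lambda>v. f v w)"
  shows "tsum V W (ptensor V W v w) f = f v w"
  by (intro tensor_universal(2)[of V W U] bilinear_onI assms)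

lemma linear_on_tsum_arg:
  assumes "linear_on Z (tensor V W) t" "vect V" "vect W" "vect U"
    and "\<And>v. v \<in> carr V \<Longrightarrow> linear_on W U (f v)"
    and "\<And>w. w \<in> carr W \<Longrightarrow> linear_on V U (\<lambda>v. f v w)"
  shows "linear_on Z U (\<lambda>z. tsum V W (t z) f)"
  by (rule linear_on_compose[OF tensor_universal(1) assms(1)]) (intro assms bilinear_onI)+

lemma linear_on_tsum_body:
  assumes "t \<in> carr (tensor V W)" "vect V" "vect U" "vect Z"
    and "\<And>v w. v \<in> carr V \<Longrightarrow> w \<in> carr W \<Longrightarrow> linear_on Z U (\<lambda>z. f z v w)"
  shows "linear_on Z U (\<lambda>z. tsum V W t (\<lambda>v w. f z v w))"
proof (rule linear_onI)
  fix z z' c assume z: "z \<in> carr Z" and z': "z' \<in> carr Z"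
  show "tsum V W t (f z) \<in> carr U"
    using assms z by (intro tsum_in) (blast dest: linear_on_in)+
  have "tsum V W t (f (z + z')) = tsum V W t (\<lambda>v w. f z v w + f z' v w)"
    by (intro tsum_cong linear_on_add[OF assms(5)] z z' assms refl)
  then show "tsum V W t (f (z + z')) = tsum V W t (f z) + tsum V W t (f z')"
    by (simp add: tsum_plus)
next
  fix z c assume z: "z \<in> carr Z"
  have "tsum V W t (f (scl Z c z)) = tsum V W t (\<lambda>v w. scl U c (f z v w))"
    by (intro tsum_cong linear_on_scl[OF assms(5)] z assms refl)
  then show "tsum V W t (f (scl Z c z)) = scl U c (tsum V W t (f z))"
    by (simp add: tsum_scl assms)
qed

lemma tensor_eqI:
  assumes "linear_on (tensor V W) U F" "linear_on (tensor V W) U G" "vect U"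
    and "\<And>v w. v \<in> carr V \<Longrightarrow> w \<in> carr W \<Longrightarrow> F (ptensor V W v w) = G (ptensor V W v w)"
    and "t \<in> carr (tensor V W)"
  shows "F t = G t"
  by (rule tensor_unique[OF assms(3,1,2,4,5)])

lemma tensor_eqI3:
  assumes F: "\<And>y z. y \<in> carr (tensor V' W') \<Longrightarrow> z \<in> carr (tensor V'' W'') \<Longrightarrow> linear_on (tensor V W) U (\<lambda>x. F x y z)"
    "\<And>x z. x \<in> carr (tensor V W) \<Longrightarrow> z \<in> carr (tensor V'' W'') \<Longrightarrow> linear_on (tensor V' W') U (\<lambda>y. F x y z)"
    "\<And>x y. x \<in> carr (tensor V W) \<Longrightarrow> y \<in> carr (tensor V' W') \<Longrightarrow> linear_on (tensor V'' W'') U (F x y)"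
    and G: "\<And>y z. y \<in> carr (tensor V' W') \<Longrightarrow> z \<in> carr (tensor V'' W'') \<Longrightarrow> linear_on (tensor V W) U (\<lambda>x. G x y z)"
    "\<And>x z. x \<in> carr (tensor V W) \<Longrightarrow> z \<in> carr (tensor V'' W'') \<Longrightarrow> linear_on (tensor V' W') U (\<lambda>y. G x y z)"
    "\<And>x y. x \<in> carr (tensor V W) \<Longrightarrow> y \<in> carr (tensor V' W') \<Longrightarrow> linear_on (tensor V'' W'') U (G x y)"
    and v: "vect U" "vect V" "vect W" "vect V'" "vect W'"
    and gen: "\<And>a b c d e f. a \<in> carr V \<Longrightarrow> b \<in> carr W \<Longrightarrow> c \<in> carr V' \<Longrightarrow> d \<in> carr W' \<Longrightarrow>
      e \<in> carr V'' \<Longrightarrow> f \<in> carr W'' \<Longrightarrow>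
      F (ptensor V W a b) (ptensor V' W' c d) (ptensor V'' W'' e f) =
      G (ptensor V W a b) (ptensor V' W' c d) (ptensor V'' W'' e f)"
    and m: "x \<in> carr (tensor V W)" "y \<in> carr (tensor V' W')" "z \<in> carr (tensor V'' W'')"
  shows "F x y z = G x y z"
proof (rule tensor_eqI[OF F(1)[OF m(2,3)] G(1)[OF m(2,3)] v(1) _ m(1)])
  fix a b assume a: "a \<in> carr V" "b \<in> carr W"
  note x = linear_on_in[OF bilinear_on_right[OF ptensor_bilinear[OF v(2,3)] a(1)] a(2)]
  show "F (ptensor V W a b) y z = G (ptensor V W a b) y z"
  proof (rule tensor_eqI[OF F(2)[OF x m(3)] G(2)[OF x m(3)] v(1) _ m(2)])
    fix c d assume c: "c \<in> carr V'" "d \<in> carr W'"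
    note y = linear_on_in[OF bilinear_on_right[OF ptensor_bilinear[OF v(4,5)] c(1)] c(2)]
    show "F (ptensor V W a b) (ptensor V' W' c d) z = G (ptensor V W a b) (ptensor V' W' c d) z"
      by (rule tensor_eqI[OF F(3)[OF x y] G(3)[OF x y] v(1) gen[OF a c] m(3)])
  qed
qed

lemma bilinear_rules:
  assumes f: "bilinear_on V W U f" and v: "vect V" "vect W" "vect U"
  shows "x \<in> carr V \<Longrightarrow> y \<in> carr W \<Longrightarrow> f x y \<in> carr U"
    and "linear_on Z V g \<Longrightarrow> y \<in> carr W \<Longrightarrow> linear_on Z U (\<lambda>z. f (g z) y)"
    and "x \<in> carr V \<Longrightarrow> linear_on Z W g' \<Longrightarrow> linear_on Z U (\<lambda>z. f x (g' z))"
    and "x \<in> carr V \<Longrightarrow> linear_on W U (f x)"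
proof -
  show 1: "f x y \<in> carr U" if "x \<in> carr V" "y \<in> carr W" for x y
    using f that by (auto simp: bilinear_on_def linear_on_def)
  show "linear_on Z V g \<Longrightarrow> y \<in> carr W \<Longrightarrow> linear_on Z U (\<lambda>z. f (g z) y)"
    by (rule linear_on_compose[OF bilinear_on_left[OF f]])
  show "x \<in> carr V \<Longrightarrow> linear_on Z W g' \<Longrightarrow> linear_on Z U (\<lambda>z. f x (g' z))"
    by (rule linear_on_compose[OF bilinear_on_right[OF f]])
  show "x \<in> carr V \<Longrightarrow> linear_on W U (f x)" by (rule bilinear_on_right[OF f])
qed

lemma bilinear_push:
  assumes f: "bilinear_on V W U f" and v: "vect V" "vect W" "vect U"
  shows "t \<in> carr (tensor X Y) \<Longrightarrow> vect X \<Longrightarrow> w \<in> carr W \<Longrightarrow>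
      (\<And>x y. x \<in> carr X \<Longrightarrow> y \<in> carr Y \<Longrightarrow> h x y \<in> carr V) \<Longrightarrow>
      f (tsum X Y t h) w = tsum X Y t (\<lambda>x y. f (h x y) w)"
    and "t \<in> carr (tensor X Y) \<Longrightarrow> vect X \<Longrightarrow> u \<in> carr V \<Longrightarrow>
      (\<And>x y. x \<in> carr X \<Longrightarrow> y \<in> carr Y \<Longrightarrow> h' x y \<in> carr W) \<Longrightarrow>
      f u (tsum X Y t h') = tsum X Y t (\<lambda>x y. f u (h' x y))"
    and "a \<in> carr V \<Longrightarrow> b \<in> carr W \<Longrightarrow> f (scl V c a) b = scl U c (f a b)"
    and "a \<in> carr V \<Longrightarrow> b \<in> carr W \<Longrightarrow> f a (scl W c b) = scl U c (f a b)"
proof -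
  show "f (tsum X Y t h) w = tsum X Y t (\<lambda>x y. f (h x y) w)"
    if "t \<in> carr (tensor X Y)" "vect X" "w \<in> carr W"
      "\<And>x y. x \<in> carr X \<Longrightarrow> y \<in> carr Y \<Longrightarrow> h x y \<in> carr V"
    using tsum_push[OF bilinear_on_left[OF f] v(1)] that by blast
  show "f u (tsum X Y t h') = tsum X Y t (\<lambda>x y. f u (h' x y))"
    if "t \<in> carr (tensor X Y)" "vect X" "u \<in> carr V"
      "\<And>x y. x \<in> carr X \<Longrightarrow> y \<in> carr Y \<Longrightarrow> h' x y \<in> carr W"
    using tsum_push[OF bilinear_on_right[OF f] v(2)] that by blast
  show "a \<in> carr V \<Longrightarrow> b \<in> carr W \<Longrightarrow> f (scl V c a) b = scl U c (f a b)"
    "a \<in> carr V \<Longrightarrow> b \<in> carr W \<Longrightarrow> f a (scl W c b) = scl U c (f a b)"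
    using f by (auto simp: bilinear_on_def linear_on_def)
qed

lemma linear_rules:
  assumes f: "linear_on V U f" and v: "vect V" "vect U"
  shows "x \<in> carr V \<Longrightarrow> f x \<in> carr U"
    and "linear_on Z V g \<Longrightarrow> linear_on Z U (\<lambda>z. f (g z))"
    and "linear_on V U f"
  using f linear_on_compose[OF f] by (auto intro: linear_on_in)

lemma linear_push:
  assumes f: "linear_on V U f" and v: "vect V" "vect U"
  shows "t \<in> carr (tensor X Y) \<Longrightarrow> vect X \<Longrightarrow> (\<And>x y. x \<in> carr X \<Longrightarrow> y \<in> carr Y \<Longrightarrow> h x y \<in> carr V) \<Longrightarrow>
      f (tsum X Y t h) = tsum X Y t (\<lambda>x y. f (h x y))"
    and "a \<in> carr V \<Longrightarrow> f (scl V c a) = scl U c (f a)"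
  using tsum_push[OF f v(1)] linear_on_scl[OF f] by blast+

text \<open>
  Facts in \<open>tw\<close> establish membership and linearity, which are the side conditions of all other rules.
  Rules in \<open>push\<close> move linear operations into Sweedler sums and evaluate structure maps on products
  and units; together with the rules \<open>tsum_rules\<close> below they flatten an expression to nested sums.
  The target space \<open>U\<close> of a sum cannot be inferred by rewriting, so the rules that mention it are
  instantiated with \<open>where U = \<dots>\<close> at each use.
\<close>

named_theorems tw
named_theorems push

lemmas [tw] = vect_tensor vect_add vect_diff vect_scl vect_zero tsum_in linear_on_id linear_on_plus
  linear_on_minus linear_on_smult linear_on_const_zero linear_on_tsum_arg linear_on_tsum_body

lemmas [tw] = bilinear_rules[OF ptensor_bilinear _ _ vect_tensor]
lemmas [push] = bilinear_push[OF ptensor_bilinear _ _ vect_tensor]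

lemma tsum_flat:
  assumes "vect U" "vect X" "t \<in> carr (tensor X Y)" "vect V" "vect W"
    "\<And>x y. x \<in> carr X \<Longrightarrow> y \<in> carr Y \<Longrightarrow> h x y \<in> carr (tensor V W)"
    and "\<And>v. v \<in> carr V \<Longrightarrow> linear_on W U (f v)"
    and "\<And>w. w \<in> carr W \<Longrightarrow> linear_on V U (\<lambda>v. f v w)"
  shows "tsum V W (tsum X Y t h) f = tsum X Y t (\<lambda>x y. tsum V W (h x y) f)"
proof (rule tsum_push[where U = "tensor V W" and F="\<lambda>s. tsum V W s f" and U'=U])
  show "linear_on (tensor V W) U (\<lambda>s. tsum V W s f)"
    by (intro tensor_universal bilinear_onI assms)
qed (use assms vect_tensor in auto)

lemma tsum_linear:
  assumes "vect U" "vect V" "vect W"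
    "\<And>v. v \<in> carr V \<Longrightarrow> linear_on W U (f v)" "\<And>w. w \<in> carr W \<Longrightarrow> linear_on V U (\<lambda>v. f v w)"
  shows tsum_scl_arg: "t \<in> carr (tensor V W) \<Longrightarrow> tsum V W (scl (tensor V W) c t) f = scl U c (tsum V W t f)"
    and tsum_zero_arg: "tsum V W 0 f = 0"
proof -
  have l: "linear_on (tensor V W) U (\<lambda>t. tsum V W t f)"
    by (intro tensor_universal bilinear_onI assms)
  show "t \<in> carr (tensor V W) \<Longrightarrow> tsum V W (scl (tensor V W) c t) f = scl U c (tsum V W t f)"
    by (rule linear_on_scl[OF l])
  show "tsum V W 0 f = 0" by (rule linear_on_zero[OF l vect_tensor])
qed

lemmas tsum_rules = tsum_flat tsum_ptensor tsum_scl_arg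

text \<open>
  A coassociativity law is an equation in a threefold tensor product.  It is transferred here to sums of
  an arbitrary trilinear expression.  The three legs live in different spaces so that the same
  argument covers the coproduct, left and right coactions, and the commutation of two coactions.
\<close>

lemma bracketing:
  assumes U: "vect U" and v: "vect P" "vect Q" "vect R" "vect S" "vect T"
   and t: "t \<in> carr (tensor P Q)" "t' \<in> carr (tensor R T)"
   and l: "linear_on P (tensor R S) \<alpha>" "linear_on T (tensor S Q) \<beta>"
   and eq: "tsum P Q t (\<lambda>x y. tsum R S (\<alpha> x) (\<lambda>u v. ptensor R (tensor S Q) u (ptensor S Q v y))) =
     tsum R T t' (\<lambda>u r. tsum S Q (\<beta> r) (\<lambda>v y. ptensor R (tensor S Q) u (ptensor S Q v y)))"
   and f: "\<And>u v. u \<in> carr S \<Longrightarrow> v \<in> carr Q \<Longrightarrow> linear_on R U (\<lambda>x. f x u v)"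
   "\<And>u v. u \<in> carr R \<Longrightarrow> v \<in> carr Q \<Longrightarrow> linear_on S U (\<lambda>x. f u x v)"
   "\<And>u v. u \<in> carr R \<Longrightarrow> v \<in> carr S \<Longrightarrow> linear_on Q U (\<lambda>x. f u v x)"
  shows "tsum P Q t (\<lambda>x y. tsum R S (\<alpha> x) (\<lambda>u v. f u v y)) =
    tsum R T t' (\<lambda>u r. tsum S Q (\<beta> r) (\<lambda>v y. f u v y))"
proof -
  note [simp] = U v t f tw push linear_rules[OF l(1) v(1) vect_tensor] linear_rules[OF l(2) v(5) vect_tensor]
    tsum_rules[where U=U]
  note [cong] = tsum_cong
  from arg_cong[OF eq, of "\<lambda>t. tsum R (tensor S Q) t (\<lambda>u s. tsum S Q s (f u))"]
  show ?thesis by simp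
qed

text \<open>
  The congruence rules \<open>sw_cong\<close> let the simplifier assume, inside a sum, that the bound variables lie
  in their carriers.  They also keep it from rewriting inside the atoms \<open>x \<in> carr V\<close> and
  \<open>linear_on V W f\<close>: such atoms are to be decided by \<open>tw\<close> from the shape of the expression, and
  \<open>push\<close> would change that shape.  To this end the subterm is wrapped in \<open>frz\<close>, whose own congruence
  rule is a bare reflexivity.
\<close>

definition frz :: "'a \<Rightarrow> 'a" where "frz x = x"

lemma frz_frozen: "frz x = frz x" by (rule refl)

lemma linear_on_frozen:
  assumes "\<And>x. frz (f x) = frz (g x)" shows "linear_on V W f = linear_on V W g"
proof -
  have "f = g" using assms by (simp add: frz_def fun_eq_iff)
  then show ?thesis by (rule arg_cong)
qed

lemma member_frozen: "frz x = frz y \<Longrightarrow> (x \<in> carr V) = (y \<in> carr V)" by (simp add: frz_def)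

lemmas sw_cong = tsum_cong linear_on_frozen member_frozen frz_frozen

text \<open>
  Unconditional exchange of two independent sums would loop.  Ordered rewriting replaces
  \<open>ordl t s\<close> by \<open>ordl s t\<close> only if this decreases the term, and only then does the condition
  \<open>ordl t s = ordr s t\<close> become provable by \<open>ordl_ordr\<close>.  The sums are thus sorted by a fixed term order.
\<close>

definition ordl :: "'a \<Rightarrow> 'a \<Rightarrow> bool" where "ordl x y = True"
definition ordr :: "'a \<Rightarrow> 'a \<Rightarrow> bool" where "ordr x y = True"
lemma ordl_commute: "ordl x y = ordl y x" by (simp add: ordl_def)
lemma ordl_ordr: "(ordl x y = ordr x y) = True" by (simp add: ordl_def ordr_def)

text \<open>
  The sums to be exchanged need not be adjacent: the coproducts between them depend on the variables
  of the outer sum, so they must travel with it.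
\<close>

lemma tsum_swap0:
  assumes "ordl t s = ordr s t"
  shows "tsum V W t (\<lambda>v w. tsum V W s (\<lambda>x y. f v w x y)) = tsum V W s (\<lambda>x y. tsum V W t (\<lambda>v w. f v w x y))"
  by (rule tsum_swap)
lemma tsum_swap1:
  assumes "ordl t s = ordr s t"
  shows "tsum V W t (\<lambda>v w. tsum V1 W1 (u1 v w) (\<lambda>v1 w1. tsum V W s (\<lambda>x y. f v w v1 w1 x y))) =
    tsum V W s (\<lambda>x y. tsum V W t (\<lambda>v w. tsum V1 W1 (u1 v w) (\<lambda>v1 w1. f v w v1 w1 x y)))"
  by (simp only: tsum_swap[of V W s])
lemma tsum_swap2:
  assumes "ordl t s = ordr s t"
  shows "tsum V W t (\<lambda>v w. tsum V1 W1 (u1 v w) (\<lambda>v1 w1. tsum V2 W2 (u2 v w v1 w1) (\<lambda>v2 w2. tsum V W s (\<lambda>x y. f v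
      w v1 w1 v2 w2 x y)))) =
    tsum V W s (\<lambda>x y. tsum V W t (\<lambda>v w. tsum V1 W1 (u1 v w) (\<lambda>v1 w1. tsum V2 W2 (u2 v w v1 w1) (\<lambda>v2 w2. f v w v1
        w1 v2 w2 x y))))"
  by (simp only: tsum_swap[of V W s])
lemma tsum_swap3:
  assumes "ordl t s = ordr s t"
  shows "tsum V W t (\<lambda>v w. tsum V1 W1 (u1 v w) (\<lambda>v1 w1. tsum V2 W2 (u2 v w v1 w1) (\<lambda>v2 w2. tsum V3 W3 (u3 v w v1
      w1 v2 w2) (\<lambda>v3 w3. tsum V W s (\<lambda>x y. f v w v1 w1 v2 w2 v3 w3 x y))))) =
    tsum V W s (\<lambda>x y. tsum V W t (\<lambda>v w. tsum V1 W1 (u1 v w) (\<lambda>v1 w1. tsum V2 W2 (u2 v w v1 w1) (\<lambda>v2 w2. tsum V3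
        W3 (u3 v w v1 w1 v2 w2) (\<lambda>v3 w3. f v w v1 w1 v2 w2 v3 w3 x y)))))"
  by (simp only: tsum_swap[of V W s])

lemma scl_mult [push]: "vect V \<Longrightarrow> scl V (c * d) x = scl V c (scl V d x)"
  by (simp add: scl_scl)

lemmas [push] = tsum_scl scl_one

section \<open>Hopf algebras\<close>

locale hopf =
  fixes H :: "('h::ab_group_add, 'k::field, 'z) hopf_scheme"
  assumes hopf: "hopf_algebra H"
begin

text \<open>The Sweedler sum over \<open>h\<^sub>1 \<otimes> h\<^sub>2\<close>.\<close>

abbreviation "sw h f \<equiv> tsum H H (comul H h) f"

lemma algH: "algebra H"
  using hopf by (simp add: hopf_algebra_def)

lemma vectH [tw]: "vect H" and mulH: "bilinear_on H H H (amul H)"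
  and comulH: "linear_on H (tensor H H) (comul H)" and antipodeH: "linear_on H H (antipode H)"
  and counitH: "linear_on H ground (counit H)" and oneH [tw]: "aone H \<in> carr H"
  using hopf by (simp_all add: hopf_algebra_def algebra_def)

lemma counit_smult: "vect U \<Longrightarrow> bilinear_on H U U (\<lambda>h u. scl U (counit H h) u)"
  using counitH unfolding bilinear_on_def linear_on_def
  by (auto simp: scl_add scl_scl vect_scl mult.commute scl_add_left ground_def)

lemmas [tw] = bilinear_rules[OF mulH vectH vectH vectH]
  linear_rules[OF comulH vectH vect_tensor] linear_rules[OF antipodeH vectH vectH]
  bilinear_rules(2,3)[OF counit_smult vectH]

lemmas [push] = bilinear_push[OF mulH vectH vectH vectH] linear_push[OF comulH vectH vect_tensor]
  linear_push[OF antipodeH vectH vectH]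

lemma counit_scl [push]: "h \<in> carr H \<Longrightarrow> counit H (scl H c h) = c * counit H h"
  using counitH by (simp add: linear_on_def ground_def)

lemma mulH_assoc [push]: "a \<in> carr H \<Longrightarrow> b \<in> carr H \<Longrightarrow> c \<in> carr H \<Longrightarrow>
    amul H (amul H a b) c = amul H a (amul H b c)"
  and oneH_left [push]: "a \<in> carr H \<Longrightarrow> amul H (aone H) a = a"
  and oneH_right [push]: "a \<in> carr H \<Longrightarrow> amul H a (aone H) = a"
  using algH by (simp_all add: algebra_def)

lemma comul_mul [push]:
  "h \<in> carr H \<Longrightarrow> g \<in> carr H \<Longrightarrow> comul H (amul H h g) = sw h (\<lambda>h1 h2.
    sw g (\<lambda>g1 g2. ptensor H H (amul H h1 g1) (amul H h2 g2)))"
  and comul_one [push]: "comul H (aone H) = ptensor H H (aone H) (aone H)"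
  and counit_mul [push]: "h \<in> carr H \<Longrightarrow> g \<in> carr H \<Longrightarrow>
    counit H (amul H h g) = counit H h * counit H g"
  and counit_one [push]: "counit H (aone H) = 1"
  using hopf by (simp_all add: hopf_algebra_def cop_def)

lemma antipode_left: "h \<in> carr H \<Longrightarrow>
    sw h (\<lambda>h1 h2. amul H (antipode H h1) h2) = scl H (counit H h) (aone H)"
  and antipode_right: "h \<in> carr H \<Longrightarrow>
    sw h (\<lambda>h1 h2. amul H h1 (antipode H h2)) = scl H (counit H h) (aone H)"
  using hopf by (simp_all add: hopf_algebra_def cop_def)

lemma coassoc:
  assumes "vect U" "h \<in> carr H"
   "\<And>u v. u \<in> carr H \<Longrightarrow> v \<in> carr H \<Longrightarrow> linear_on H U (\<lambda>x. f x u v)"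
   "\<And>u v. u \<in> carr H \<Longrightarrow> v \<in> carr H \<Longrightarrow> linear_on H U (\<lambda>x. f u x v)"
   "\<And>u v. u \<in> carr H \<Longrightarrow> v \<in> carr H \<Longrightarrow> linear_on H U (\<lambda>x. f u v x)"
  shows "sw h (\<lambda>x y. sw x (\<lambda>u v. f u v y)) =
    sw h (\<lambda>u r. sw r (\<lambda>v y. f u v y))"
  by (rule bracketing[where U=U]) (use hopf assms tw in \<open>simp_all add: hopf_algebra_def cop_def\<close>)

lemma counit_left [push]:
  assumes f: "vect U" "linear_on H U f" "h \<in> carr H"
  shows "sw h (\<lambda>h1 h2. scl U (counit H h1) (f h2)) = f h"
proof -
  note [simp] = tw push linear_rules[OF f(2) vectH f(1)] linear_push[OF f(2) vectH f(1)] f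
  note [cong] = sw_cong
  have "f h = f (sw h (\<lambda>h1 h2. scl H (counit H h1) h2))"
    using hopf f by (simp add: hopf_algebra_def cop_def)
  also have "\<dots> = sw h (\<lambda>h1 h2. scl U (counit H h1) (f h2))" by simp
  finally show ?thesis by simp
qed

lemma counit_right [push]:
  assumes f: "vect U" "linear_on H U f" "h \<in> carr H"
  shows "sw h (\<lambda>h1 h2. scl U (counit H h2) (f h1)) = f h"
proof -
  note [simp] = tw push linear_rules[OF f(2) vectH f(1)] linear_push[OF f(2) vectH f(1)] f
  note [cong] = sw_cong
  have "f h = f (sw h (\<lambda>h1 h2. scl H (counit H h2) h1))"
    using hopf f by (simp add: hopf_algebra_def cop_def)
  also have "\<dots> = sw h (\<lambda>h1 h2. scl U (counit H h2) (f h1))" by simp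
  finally show ?thesis by simp
qed

lemmas srt = ordl_commute ordl_ordr tsum_swap0 tsum_swap1[where V=H and W=H]
  tsum_swap2[where V=H and W=H] tsum_swap3[where V=H and W=H]

lemmas hopf_sw = tsum_rules coassoc

text \<open>
  Both sides are convolution inverse to the comultiplication in \<open>Hom(H, H \<otimes> H)\<close>; the chain of equations
  multiplies one by the comultiplication and then by the other.
\<close>

lemma comul_antipode:
  assumes h: "h \<in> carr H"
  shows "comul H (antipode H h) = sw h (\<lambda>h1 h2. ptensor H H (antipode H h2) (antipode H h1))"
proof -
  let ?U = "tensor H H"
  note [simp] = tw push h hopf_sw[where U="?U"] srt tsum_id
  note [cong] = sw_cong
  let ?S = "antipode H"
  have "comul H (?S h) = sw h (\<lambda>h1 r. sw (?S h1) (\<lambda>a b.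
      ptensor H H (amul H a (sw r (\<lambda>h2 q. amul H h2 (?S q)))) b))"
    by (simp add: antipode_right)
  also have "\<dots> = sw h (\<lambda>h1 r. sw r (\<lambda>h2 q.
      sw (?S h1) (\<lambda>a b. ptensor H H (amul H a (amul H h2 (?S q))) b)))"
    by simp
  also have "\<dots> = sw h (\<lambda>h1 r. sw r (\<lambda>h2 u. sw u (\<lambda>s q.
      sw (?S h1) (\<lambda>a b. ptensor H H (amul H a (amul H h2 (?S q)))
        (amul H b (sw s (\<lambda>h3 h4. amul H h3 (?S h4))))))))"
    by (simp add: antipode_right)
  also have "\<dots> = sw h (\<lambda>p q.
      sw (tsum H H (comul H p) (\<lambda>h1 h2. amul H (?S h1) h2))
        (\<lambda>a b. sw q (\<lambda>q1 q2. ptensor H H (amul H a (?S q2)) (amul H b (?S q1)))))"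
    by simp
  also have "\<dots> = sw h (\<lambda>h1 h2. ptensor H H (?S h2) (?S h1))"
    by (simp add: antipode_left)
  finally show ?thesis .
qed

text \<open>
  The same argument for convolution inverses of the multiplication in \<open>Hom(H \<otimes> H, H)\<close>.
\<close>

lemma antipode_mul:
  assumes h: "h \<in> carr H" "g \<in> carr H"
  shows "antipode H (amul H h g) = amul H (antipode H g) (antipode H h)"
proof -
  note [simp] = tw push h hopf_sw[where U=H] srt
  note [cong] = sw_cong
  let ?S = "antipode H"
  have br: "sw p (\<lambda>h1 h2. sw q (\<lambda>g1 g2.
      amul H (?S (amul H h1 g1)) (amul H h2 g2))) = scl H (counit H p) (scl H (counit H q) (aone H))"
    if "p \<in> carr H" "q \<in> carr H" for p q
    using antipode_left[of "amul H p q"] that by simp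
  have "?S (amul H h g) = sw h (\<lambda>h1 r.
      amul H (?S (amul H h1 g)) (sw r (\<lambda>h2 h3. amul H h2 (?S h3))))"
    by (simp add: antipode_right)
  also have "\<dots> = sw h (\<lambda>h1 r. sw r (\<lambda>h2 h3.
      amul H (?S (amul H h1 g)) (amul H h2 (?S h3))))"
    by simp
  also have "\<dots> = sw h (\<lambda>h1 r. sw r (\<lambda>h2 h3. sw g (\<lambda>g1 s.
      amul H (?S (amul H h1 g1)) (amul H h2 (amul H (sw s (\<lambda>g2 g3. amul H g2 (?S g3))) (?S h3))))))"
    by (simp add: antipode_right)
  also have "\<dots> = sw h (\<lambda>p h3. sw g (\<lambda>q g3.
      amul H (sw p (\<lambda>h1 h2. sw q (\<lambda>g1 g2.
      amul H (?S (amul H h1 g1)) (amul H h2 g2)))) (amul H (?S g3) (?S h3))))"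
    by simp
  also have "\<dots> = amul H (?S g) (?S h)"
    by (simp add: br)
  finally show ?thesis .
qed

lemma antipode_one: "antipode H (aone H) = aone H"
proof -
  note [simp] = tw push tsum_rules[where U=H]
  show ?thesis using antipode_left[OF oneH] by (simp add: scl_one)
qed

lemma counit_lin [tw]: "vect U \<Longrightarrow> u \<in> carr U \<Longrightarrow> linear_on H U (\<lambda>h. scl U (counit H h) u)"
  using bilinear_on_left[OF counit_smult] by blast

text \<open>
  Apply \<open>\<epsilon>\<close> to \<open>S(h\<^sub>1) h\<^sub>2 = \<epsilon>(h) 1\<close>.  The scalars are carried along as multiples of the unit so that the
  rules for sums apply.
\<close>

lemma counit_antipode [push]:
  assumes h [simp]: "h \<in> carr H" shows "counit H (antipode H h) = counit H h"
proof -
  note [simp] = tw push hopf_sw[where U=H] srt linear_push[OF counit_lin vectH, of H]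
  note [cong] = sw_cong
  let ?F = "\<lambda>h. scl H (counit H h) (aone H)"
  have l: "linear_on H H ?F" by simp
  have "?F (antipode H h) = sw h (\<lambda>h1 h2. scl H (counit H h2) (?F (antipode H h1)))"
    by simp
  also have "\<dots> = sw h (\<lambda>h1 h2. ?F (amul H (antipode H h1) h2))"
    by (intro tsum_cong refl vectH linear_on_in[OF comulH] h) (simp del: scl_mult add: scl_scl mult.commute)
  also have "\<dots> = ?F (sw h (\<lambda>h1 h2. amul H (antipode H h1) h2))"
    by (rule tsum_push[OF l vectH vectH, symmetric]) simp_all
  also have "\<dots> = ?F h" by (simp add: antipode_left)
  finally have "counit H (?F (antipode H h)) = counit H (?F h)" by (rule arg_cong)
  then show ?thesis by (simp add: oneH)
qed

text \<open>
  Each property of \<open>S\<^sup>-\<^sup>1\<close> is obtained by applying \<open>S\<close>, which reverses products and coproducts.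
\<close>

lemma antipode_inverse:
  assumes bij: "bij_betw (antipode H) (carr H) (carr H)"
  obtains Si where "linear_on H H Si" "\<And>h. h \<in> carr H \<Longrightarrow> counit H (Si h) = counit H h"
    "\<And>h. h \<in> carr H \<Longrightarrow> comul H (Si h) = sw h (\<lambda>h1 h2. ptensor H H (Si h2) (Si h1))"
    "\<And>h. h \<in> carr H \<Longrightarrow> sw h (\<lambda>h1 h2. amul H (Si h2) h1) = scl H (counit H h) (aone H)"
proof -
  let ?S = "antipode H"
  define Si where "Si = inv_into (carr H) ?S"
  have in_H: "Si h \<in> carr H" and S_Si: "?S (Si h) = h" if "h \<in> carr H" for h
    using bij_betwE[OF bij_betw_inv_into[OF bij]] bij_betw_inv_into_right[OF bij] that by (auto simp: Si_def)
  have Si_S: "Si (?S h) = h" if "h \<in> carr H" for h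
    using bij_betw_inv_into_left[OF bij that] by (simp add: Si_def)
  have lin: "linear_on H H Si"
  proof (rule linear_onI)
    show "Si (v + v') = Si v + Si v'" if "v \<in> carr H" "v' \<in> carr H" for v v'
      using Si_S[of "Si v + Si v'"] that linear_on_add[OF antipodeH, of "Si v" "Si v'"]
      by (simp add: in_H S_Si vect_add[OF vectH])
    show "Si (scl H c v) = scl H c (Si v)" if "v \<in> carr H" for c v
      using Si_S[of "scl H c (Si v)"] that linear_on_scl[OF antipodeH, of "Si v"]
      by (simp add: in_H S_Si vect_scl[OF vectH])
  qed (rule in_H)
  note [simp] = tw push linear_rules[OF lin vectH vectH] linear_push[OF lin vectH vectH] S_Si Si_S
    hopf_sw[where U="tensor H H"]
  note [cong] = sw_cong
  have co: "comul H (Si h) = sw h (\<lambda>h1 h2. ptensor H H (Si h2) (Si h1))" if h: "h \<in> carr H" for h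
  proof -
    have "comul H h = sw (Si h) (\<lambda>x y. ptensor H H (?S y) (?S x))"
      using comul_antipode[of "Si h"] h by simp
    then show ?thesis using h by (simp add: tsum_id)
  qed
  have cou: "counit H (Si h) = counit H h" if "h \<in> carr H" for h
    using counit_antipode[of "Si h"] that by simp
  have an: "sw h (\<lambda>h1 h2. amul H (Si h2) h1) = scl H (counit H h) (aone H)" (is "?l = ?r") if h: "h \<in> carr H" for h
  proof -
    have "?S ?l = ?S ?r" using h by (simp add: antipode_mul antipode_left antipode_one)
    then have "Si (?S ?l) = Si (?S ?r)" by (rule arg_cong)
    moreover have "?l \<in> carr H" "?r \<in> carr H" using h by simp_all
    ultimately show ?thesis using Si_S by (simp only:)
  qed
  show ?thesis using that[OF lin cou co an] .
qed

end

section \<open>Hopf modules\<close>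

locale hopf_module = hopf H for H :: "('h::ab_group_add, 'k::field, 'z) hopf_scheme" +
  fixes N :: "('n::ab_group_add, 'k, 'w) vs_scheme" and lN :: "'h \<Rightarrow> 'n \<Rightarrow> 'n" and \<delta> :: "'n \<Rightarrow> ('h, 'n, 'k) tens"
  assumes N_left: "left_module H N lN" and N_lcom: "left_comodule H N \<delta>"
    and lco_lN [push]: "\<And>h n. h \<in> carr H \<Longrightarrow> n \<in> carr N \<Longrightarrow> \<delta> (lN h n) =
      sw h (\<lambda>h1 h2. tsum H N (\<delta> n) (\<lambda>k n0. ptensor H N (amul H h1 k) (lN h2 n0)))"
begin

lemma vectN [tw]: "vect N" and lN_bil: "bilinear_on H N N lN" and lco_lin: "linear_on N (tensor H N) \<delta>"
  using N_left N_lcom by (simp_all add: left_module_def left_comodule_def)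

lemmas [tw] = bilinear_rules[OF lN_bil vectH vectN vectN] linear_rules[OF lco_lin vectN vect_tensor]
lemmas [push] = bilinear_push[OF lN_bil vectH vectN vectN] linear_push[OF lco_lin vectN vect_tensor]

lemma lN_assoc [push]: "h \<in> carr H \<Longrightarrow> g \<in> carr H \<Longrightarrow> n \<in> carr N \<Longrightarrow> lN (amul H h g) n = lN h (lN g n)"
  and lN_one [push]: "n \<in> carr N \<Longrightarrow> lN (aone H) n = n"
  using N_left by (simp_all add: left_module_def)

lemma N_coassoc:
  assumes "vect U" "n \<in> carr N"
   "\<And>u v. u \<in> carr H \<Longrightarrow> v \<in> carr N \<Longrightarrow> linear_on H U (\<lambda>x. f x u v)"
   "\<And>u v. u \<in> carr H \<Longrightarrow> v \<in> carr N \<Longrightarrow> linear_on H U (\<lambda>x. f u x v)"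
   "\<And>u v. u \<in> carr H \<Longrightarrow> v \<in> carr H \<Longrightarrow> linear_on N U (\<lambda>x. f u v x)"
  shows "tsum H N (\<delta> n) (\<lambda>x y. sw x (\<lambda>u v. f u v y)) =
    tsum H N (\<delta> n) (\<lambda>u r. tsum H N (\<delta> r) (\<lambda>v y. f u v y))"
  by (rule bracketing[where U=U]) (use N_lcom assms tw in \<open>simp_all add: left_comodule_def cop_def\<close>)

lemma N_counit [push]:
  assumes f: "vect U" "linear_on N U f" "n \<in> carr N"
  shows "tsum H N (\<delta> n) (\<lambda>k n0. scl U (counit H k) (f n0)) = f n"
proof -
  note [simp] = tw push linear_rules[OF f(2) vectN f(1)] linear_push[OF f(2) vectN f(1)] f
  note [cong] = sw_cong
  have "f n = f (tsum H N (\<delta> n) (\<lambda>k n0. scl N (counit H k) n0))"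
    using N_lcom f by (simp add: left_comodule_def)
  also have "\<dots> = tsum H N (\<delta> n) (\<lambda>k n0. scl U (counit H k) (f n0))" by simp
  finally show ?thesis by simp
qed

lemmas srtN = srt tsum_swap[of H N _ H H]
lemmas N_sw = hopf_sw N_coassoc

definition coinv where
  "coinv = \<lparr> carr = {n \<in> carr N. \<delta> n = ptensor H N (aone H) n}, scl = scl N \<rparr>"

text \<open>
  The projection \<open>n \<mapsto> S(n\<^sub>-\<^sub>1) n\<^sub>0\<close> of the fundamental theorem of Hopf modules.
\<close>

definition proj where
  "proj n = tsum H N (\<delta> n) (\<lambda>k n0. lN (antipode H k) n0)"

lemma coinvD: "x \<in> carr coinv \<Longrightarrow> x \<in> carr N" "x \<in> carr coinv \<Longrightarrow> \<delta> x = ptensor H N (aone H) x"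
  by (simp_all add: coinv_def)

lemma coinvI: "x \<in> carr N \<Longrightarrow> \<delta> x = ptensor H N (aone H) x \<Longrightarrow> x \<in> carr coinv"
  by (simp add: coinv_def)

lemma vect_coinv [tw]: "vect coinv"
proof (rule vectI)
  note [simp] = tw
  have b: "bilinear_on H N (tensor H N) (ptensor H N)" by (rule ptensor_bilinear[OF vectH vectN])
  show "vector_space (scl coinv)" using vect_vs[OF vectN] by (simp add: coinv_def)
  show "0 \<in> carr coinv"
    using linear_on_zero[OF lco_lin vectN] linear_on_zero[OF bilinear_on_right[OF b oneH] vectN]
    by (simp add: coinv_def)
  show "x + y \<in> carr coinv" if "x \<in> carr coinv" "y \<in> carr coinv" for x y
    using that linear_on_add[OF lco_lin] linear_on_add[OF bilinear_on_right[OF b oneH]]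
    by (simp add: coinv_def)
  show "scl coinv c x \<in> carr coinv" if "x \<in> carr coinv" for c x
    using that linear_on_scl[OF lco_lin] linear_on_scl[OF bilinear_on_right[OF b oneH]]
    by (simp add: coinv_def)
qed

lemma proj_coinv: assumes n: "n \<in> carr N" shows "proj n \<in> carr coinv"
proof -
  let ?U = "tensor H N" and ?S = "antipode H"
  note [simp] = tw push n N_sw[where U="?U"] srtN comul_antipode
  note [cong] = sw_cong
  have "\<delta> (proj n) = tsum H N (\<delta> n) (\<lambda>k1 r. tsum H N (\<delta> r) (\<lambda>q n0.
      ptensor H N (sw q (\<lambda>q1 q2. amul H (?S q1) q2)) (lN (?S k1) n0)))"
    by (simp add: proj_def)
  also have "\<dots> = ptensor H N (aone H) (proj n)"
    by (simp add: antipode_left proj_def)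
  finally show ?thesis by (rule coinvI[rotated]) (unfold proj_def, simp)
qed

lemma proj_linear: "linear_on N coinv proj"
proof (rule linear_onI)
  note [simp] = tw push N_sw[where U=N]
  have l: "linear_on N N proj" unfolding proj_def by simp
  show "proj v \<in> carr coinv" if "v \<in> carr N" for v using that by (rule proj_coinv)
  show "proj (v + v') = proj v + proj v'" if "v \<in> carr N" "v' \<in> carr N" for v v'
    by (rule linear_on_add[OF l that])
  show "proj (scl N c v) = scl coinv c (proj v)" if "v \<in> carr N" for c v
    using linear_on_scl[OF l that] by (simp add: coinv_def)
qed

lemma proj_linear': "linear_on N N proj"
  using proj_linear by (auto simp: linear_on_def coinv_def)

lemmas [tw] = linear_rules[OF proj_linear vectN vect_coinv] linear_rules[OF proj_linear' vectN vectN]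
lemmas [push] = linear_push(1)[OF proj_linear' vectN vectN] linear_push(2)[OF proj_linear' vectN vectN]

text \<open>
  Together with \<open>proj_mult_coinv\<close> this is the isomorphism \<open>N \<cong> H \<otimes> coinv\<close>: the two lemmas say that
  \<open>n \<mapsto> n\<^sub>-\<^sub>1 \<otimes> proj(n\<^sub>0)\<close> and multiplication are inverse to each other.
\<close>

lemma proj_reconstruct:
  assumes n: "n \<in> carr N" shows "tsum H N (\<delta> n) (\<lambda>k n0. lN k (proj n0)) = n"
proof -
  let ?S = "antipode H"
  note [simp] = tw push n N_sw[where U="N"] srtN
  note [cong] = sw_cong
  have "tsum H N (\<delta> n) (\<lambda>k n0. lN k (proj n0)) = tsum H N (\<delta> n) (\<lambda>q n0. lN (sw q (\<lambda>q1 q2. amul H q1 (?S q2))) n0)"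
    by (simp add: proj_def)
  also have "\<dots> = n" by (simp add: antipode_right)
  finally show ?thesis .
qed

lemma proj_mult_coinv:
  assumes h: "h \<in> carr H" and x: "x \<in> carr coinv" shows "proj (lN h x) = scl N (counit H h) x"
proof -
  let ?S = "antipode H"
  note [simp] = tw push h coinvD[OF x] N_sw[where U="N"] srtN
  note [cong] = sw_cong
  have "proj (lN h x) = lN (sw h (\<lambda>q1 q2. amul H (?S q1) q2)) x"
    by (simp add: proj_def)
  also have "\<dots> = scl N (counit H h) x" by (simp add: antipode_left)
  finally show ?thesis .
qed

lemma proj_mult:
  assumes h: "h \<in> carr H" and n: "n \<in> carr N" shows "proj (lN h n) = scl N (counit H h) (proj n)"
proof -
  note [simp] = tw push h n N_sw[where U="N"] srtN
  note [cong] = sw_cong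
  have "lN h n = tsum H N (\<delta> n) (\<lambda>k n0. lN (amul H h k) (proj n0))"
    using proj_reconstruct[OF n, THEN arg_cong, of "lN h"] by simp
  then have "proj (lN h n) = tsum H N (\<delta> n) (\<lambda>k n0. proj (lN (amul H h k) (proj n0)))" by simp
  also have "\<dots> = scl N (counit H h) (proj n)" by (simp add: proj_mult_coinv del: lN_assoc)
  finally show ?thesis .
qed

end

section \<open>Bicovariant bimodules\<close>

locale hopf_bimodule = hopf_module H N lN \<delta>
  for H :: "('h::ab_group_add, 'k::field, 'z) hopf_scheme"
    and N :: "('n::ab_group_add, 'k, 'w) vs_scheme" and lN :: "'h \<Rightarrow> 'n \<Rightarrow> 'n"
    and \<delta> :: "'n \<Rightarrow> ('h, 'n, 'k) tens" +
  fixes rN :: "'n \<Rightarrow> 'h \<Rightarrow> 'n" and \<rho> :: "'n \<Rightarrow> ('n, 'h, 'k) tens"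
  assumes N_right: "right_module H N rN" and N_rcom: "right_comodule H N \<rho>"
    and N_bimod [push]: "\<And>h n g. h \<in> carr H \<Longrightarrow> n \<in> carr N \<Longrightarrow> g \<in> carr H \<Longrightarrow> rN (lN h n) g = lN h (rN n g)"
    and lco_rN [push]: "\<And>h n. h \<in> carr H \<Longrightarrow> n \<in> carr N \<Longrightarrow> \<delta> (rN n h) =
      tsum H N (\<delta> n) (\<lambda>k n0. sw h (\<lambda>h1 h2. ptensor H N (amul H k h1) (rN n0 h2)))"
    and rco_lN [push]: "\<And>h n. h \<in> carr H \<Longrightarrow> n \<in> carr N \<Longrightarrow> \<rho> (lN h n) =
      sw h (\<lambda>h1 h2. tsum N H (\<rho> n) (\<lambda>n0 n1. ptensor N H (lN h1 n0) (amul H h2 n1)))"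
    and N_bicom: "\<And>n. n \<in> carr N \<Longrightarrow>
      tsum N H (\<rho> n) (\<lambda>g h. tsum H N (\<delta> g) (\<lambda>x y. ptensor H (tensor N H) x (ptensor N H y h))) =
      tsum H N (\<delta> n) (\<lambda>x g. tsum N H (\<rho> g) (\<lambda>y h. ptensor H (tensor N H) x (ptensor N H y h)))"
begin

lemma rN_bil: "bilinear_on N H N rN" and rco_lin: "linear_on N (tensor N H) \<rho>"
  using N_right N_rcom by (simp_all add: right_module_def right_comodule_def)

lemmas [tw] = bilinear_rules[OF rN_bil vectN vectH vectN] linear_rules[OF rco_lin vectN vect_tensor]
lemmas [push] = bilinear_push[OF rN_bil vectN vectH vectN] linear_push[OF rco_lin vectN vect_tensor]

lemma rN_assoc [push]: "h \<in> carr H \<Longrightarrow> g \<in> carr H \<Longrightarrow> n \<in> carr N \<Longrightarrow> rN (rN n h) g = rN n (amul H h g)"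
  and rN_one [push]: "n \<in> carr N \<Longrightarrow> rN n (aone H) = n"
  using N_right by (simp_all add: right_module_def)

lemma R_coassoc:
  assumes "vect U" "n \<in> carr N"
   "\<And>u v. u \<in> carr H \<Longrightarrow> v \<in> carr H \<Longrightarrow> linear_on N U (\<lambda>x. f x u v)"
   "\<And>u v. u \<in> carr N \<Longrightarrow> v \<in> carr H \<Longrightarrow> linear_on H U (\<lambda>x. f u x v)"
   "\<And>u v. u \<in> carr N \<Longrightarrow> v \<in> carr H \<Longrightarrow> linear_on H U (\<lambda>x. f u v x)"
  shows "tsum N H (\<rho> n) (\<lambda>x y. tsum N H (\<rho> x) (\<lambda>u v. f u v y)) =
    tsum N H (\<rho> n) (\<lambda>u r. sw r (\<lambda>v y. f u v y))"
  by (rule bracketing[where U=U]) (use N_rcom assms tw in \<open>simp_all add: right_comodule_def cop_def\<close>)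

lemma R_bicom:
  assumes "vect U" "n \<in> carr N"
   "\<And>u v. u \<in> carr N \<Longrightarrow> v \<in> carr H \<Longrightarrow> linear_on H U (\<lambda>x. f x u v)"
   "\<And>u v. u \<in> carr H \<Longrightarrow> v \<in> carr H \<Longrightarrow> linear_on N U (\<lambda>x. f u x v)"
   "\<And>u v. u \<in> carr H \<Longrightarrow> v \<in> carr N \<Longrightarrow> linear_on H U (\<lambda>x. f u v x)"
  shows "tsum N H (\<rho> n) (\<lambda>x y. tsum H N (\<delta> x) (\<lambda>u v. f u v y)) =
    tsum H N (\<delta> n) (\<lambda>u r. tsum N H (\<rho> r) (\<lambda>v y. f u v y))"
  by (rule bracketing[where U=U]) (use N_bicom assms tw in \<open>simp_all\<close>)

lemma R_counit [push]:
  assumes f: "vect U" "linear_on N U f" "n \<in> carr N"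
  shows "tsum N H (\<rho> n) (\<lambda>n0 k. scl U (counit H k) (f n0)) = f n"
proof -
  note [simp] = tw push linear_rules[OF f(2) vectN f(1)] linear_push[OF f(2) vectN f(1)] f
  note [cong] = sw_cong
  have "f n = f (tsum N H (\<rho> n) (\<lambda>n0 k. scl N (counit H k) n0))"
    using N_rcom f by (simp add: right_comodule_def)
  also have "\<dots> = tsum N H (\<rho> n) (\<lambda>n0 k. scl U (counit H k) (f n0))" by simp
  finally show ?thesis by simp
qed

lemmas srtR = srtN tsum_swap[of N H _ H H] tsum_swap[of N H _ H N]
lemmas R_sw = N_sw R_coassoc R_bicom

end

section \<open>Twisted module algebras\<close>

locale twisted = hopf H for H :: "('h::ab_group_add, 'k::field, 'z) hopf_scheme" +
  fixes B :: "('b::ab_group_add, 'k, 'y) alg_scheme"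
    and act :: "'h \<Rightarrow> 'b \<Rightarrow> 'b" and \<sigma> \<sigma>i :: "'h \<Rightarrow> 'h \<Rightarrow> 'b"
  assumes twisted: "twisted_module_algebra H B act \<sigma> \<sigma>i"
begin

lemma algB: "algebra B"
  using twisted by (simp add: twisted_module_algebra_def)

lemma vectB [tw]: "vect B" and mulB: "bilinear_on B B B (amul B)" and oneB [tw]: "aone B \<in> carr B"
  and actB: "bilinear_on H B B act" and sigB: "bilinear_on H H B \<sigma>" and sigiB: "bilinear_on H H B \<sigma>i"
  using twisted by (simp_all add: twisted_module_algebra_def algebra_def)

lemmas [tw] = bilinear_rules[OF mulB vectB vectB vectB] bilinear_rules[OF actB vectH vectB vectB]
   bilinear_rules[OF sigB vectH vectH vectB] bilinear_rules[OF sigiB vectH vectH vectB]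
lemmas [push] = bilinear_push[OF mulB vectB vectB vectB] bilinear_push[OF actB vectH vectB vectB]
   bilinear_push[OF sigB vectH vectH vectB] bilinear_push[OF sigiB vectH vectH vectB]

lemma mulB_assoc [push]: "a \<in> carr B \<Longrightarrow> b \<in> carr B \<Longrightarrow> c \<in> carr B \<Longrightarrow>
    amul B (amul B a b) c = amul B a (amul B b c)"
  and oneB_left [push]: "a \<in> carr B \<Longrightarrow> amul B (aone B) a = a"
  and oneB_right [push]: "a \<in> carr B \<Longrightarrow> amul B a (aone B) = a"
  using algB by (simp_all add: algebra_def)

lemma act_mul [push]: "h \<in> carr H \<Longrightarrow> b \<in> carr B \<Longrightarrow> b' \<in> carr B \<Longrightarrow>
    act h (amul B b b') = sw h (\<lambda>h1 h2. amul B (act h1 b) (act h2 b'))"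
  and act_one [push]: "h \<in> carr H \<Longrightarrow> act h (aone B) = scl B (counit H h) (aone B)"
  and act_unit [push]: "b \<in> carr B \<Longrightarrow> act (aone H) b = b"
  and sig_right [push]: "h \<in> carr H \<Longrightarrow> \<sigma> h (aone H) = scl B (counit H h) (aone B)"
  and sig_left [push]: "h \<in> carr H \<Longrightarrow> \<sigma> (aone H) h = scl B (counit H h) (aone B)"
  using twisted by (simp_all add: twisted_module_algebra_def cop_def)

lemma sig_sigi: "h \<in> carr H \<Longrightarrow> g \<in> carr H \<Longrightarrow>
    sw h (\<lambda>h1 h2. sw g (\<lambda>g1 g2. amul B (\<sigma> h1 g1) (\<sigma>i h2 g2))) =
    scl B (counit H h) (scl B (counit H g) (aone B))"
  and sigi_sig: "h \<in> carr H \<Longrightarrow> g \<in> carr H \<Longrightarrow>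
    sw h (\<lambda>h1 h2. sw g (\<lambda>g1 g2. amul B (\<sigma>i h1 g1) (\<sigma> h2 g2))) =
    scl B (counit H h) (scl B (counit H g) (aone B))"
  using twisted vectB by (simp_all add: twisted_module_algebra_def cop_def scl_mult)

lemma cocycle: "h \<in> carr H \<Longrightarrow> g \<in> carr H \<Longrightarrow> k \<in> carr H \<Longrightarrow>
  sw h (\<lambda>h1 h2. sw g (\<lambda>g1 g2. sw k (\<lambda>k1 k2.
     amul B (act h1 (\<sigma> g1 k1)) (\<sigma> h2 (amul H g2 k2))))) =
  sw h (\<lambda>h1 h2. sw g (\<lambda>g1 g2.
     amul B (\<sigma> h1 g1) (\<sigma> (amul H h2 g2) k)))"
  using twisted by (simp add: twisted_module_algebra_def cop_def)

lemma act_act: "h \<in> carr H \<Longrightarrow> g \<in> carr H \<Longrightarrow> b \<in> carr B \<Longrightarrow> act h (act g b) =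
  sw h (\<lambda>u h3. sw u (\<lambda>h1 h2. sw g (\<lambda>v g3. sw v (\<lambda>g1 g2.
     amul B (amul B (\<sigma> h1 g1) (act (amul H h2 g2) b)) (\<sigma>i h3 g3)))))"
  using twisted by (simp add: twisted_module_algebra_def cop_def cop3_def)

text \<open>
  The twisted module condition after multiplying by \<open>\<sigma>\<close> on the right.  In this form it no longer contains
  \<open>\<sigma>\<^sup>-\<^sup>1\<close>, and it makes sense verbatim for the action on a \<open>B\<close>-bimodule.
\<close>

lemma act_twist:
  assumes h: "h \<in> carr H" "g \<in> carr H" "b \<in> carr B"
  shows "sw h (\<lambda>h1 h2. sw g (\<lambda>g1 g2. amul B (act h1 (act g1 b)) (\<sigma> h2 g2))) =
    sw h (\<lambda>h1 h2. sw g (\<lambda>g1 g2. amul B (\<sigma> h1 g1) (act (amul H h2 g2) b)))"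
    (is "?l = ?r")
proof -
  note [simp] = tw push h hopf_sw[where U=B] srt
  note [cong] = sw_cong
  have "?l = sw h (\<lambda>h1 r. sw g (\<lambda>g1 s. sw r (\<lambda>h2 u. sw s (\<lambda>g2 v.
    amul B (\<sigma> h1 g1) (amul B (act (amul H h2 g2) b)
      (sw u (\<lambda>h1 h2. sw v (\<lambda>g1 g2. amul B (\<sigma>i h1 g1) (\<sigma> h2 g2)))))))))"
    by (simp add: act_act)
  also have "\<dots> = ?r" by (simp add: sigi_sig)
  finally show ?thesis .
qed

abbreviation "BH \<equiv> tensor B H"

definition mulA where
  "mulA x y = tsum B H x (\<lambda>b h. tsum B H y (\<lambda>c g.
     sw h (\<lambda>a h3. sw a (\<lambda>h1 h2. sw g (\<lambda>g1 g2.
       ptensor B H (amul B (amul B b (act h1 c)) (\<sigma> h2 g1)) (amul H h3 g2))))))"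

lemma mulA_bil: "bilinear_on BH BH BH mulA"
proof -
  note [simp] = tw push hopf_sw[where U=BH]
  note [cong] = sw_cong
  show ?thesis unfolding mulA_def by (intro bilinear_onI) simp_all
qed

lemmas [tw] = bilinear_rules[OF mulA_bil vect_tensor vect_tensor vect_tensor]
lemmas [push] = bilinear_push[OF mulA_bil vect_tensor vect_tensor vect_tensor]

definition coA where
  "coA x = tsum B H x (\<lambda>b h. sw h (\<lambda>h1 h2. ptensor BH H (ptensor B H b h1) h2))"

lemma coA_lin: "linear_on BH (tensor BH H) coA"
proof -
  note [simp] = tw push
  show ?thesis unfolding coA_def by simp
qed
lemmas [tw] = linear_rules[OF coA_lin vect_tensor vect_tensor]
lemmas [push] = linear_push[OF coA_lin vect_tensor vect_tensor]

end

section \<open>Bimodules over the crossed product\<close>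

text \<open>
  A \<open>B\<close>-bimodule \<open>M\<close> with a twisted \<open>H\<close>-action and a bicovariant \<open>H\<close>-bimodule \<open>N\<close>.  The coaction on \<open>N\<close>
  supplies the second argument of \<open>\<sigma>\<close>, so that \<open>M \<otimes> N\<close> behaves like \<open>B #\<^sub>\<sigma> H\<close> with \<open>B\<close> replaced by \<open>M\<close> and
  \<open>H\<close> by \<open>N\<close>.  The assumption \<open>aM_twist\<close> is \<open>act_twist\<close> with \<open>b\<close> replaced by an element of \<open>M\<close>.
\<close>

locale crossed = twisted H B act \<sigma> \<sigma>i + hopf_bimodule H N lN \<delta> rN \<rho>
  for H :: "('h::ab_group_add, 'k::field, 'z) hopf_scheme" and B :: "('b::ab_group_add, 'k, 'y) alg_scheme"
    and act :: "'h \<Rightarrow> 'b \<Rightarrow> 'b" and \<sigma> \<sigma>i :: "'h \<Rightarrow> 'h \<Rightarrow> 'b"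
    and N :: "('n::ab_group_add, 'k, 'w) vs_scheme" and lN :: "'h \<Rightarrow> 'n \<Rightarrow> 'n"
    and \<delta> :: "'n \<Rightarrow> ('h, 'n, 'k) tens" and rN :: "'n \<Rightarrow> 'h \<Rightarrow> 'n" and \<rho> :: "'n \<Rightarrow> ('n, 'h, 'k) tens" +
  fixes M :: "('m::ab_group_add, 'k, 'x) vs_scheme" and lM :: "'b \<Rightarrow> 'm \<Rightarrow> 'm"
    and rM :: "'m \<Rightarrow> 'b \<Rightarrow> 'm" and aM :: "'h \<Rightarrow> 'm \<Rightarrow> 'm"
  assumes M_left: "left_module B M lM" and M_right: "right_module B M rM"
    and M_bimod [push]: "\<And>b m c. b \<in> carr B \<Longrightarrow> m \<in> carr M \<Longrightarrow> c \<in> carr B \<Longrightarrow> rM (lM b m) c = lM b (rM m c)"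
    and aM_bil: "bilinear_on H M M aM"
    and aM_unit [push]: "\<And>m. m \<in> carr M \<Longrightarrow> aM (aone H) m = m"
    and aM_lM [push]: "\<And>h m b. h \<in> carr H \<Longrightarrow> m \<in> carr M \<Longrightarrow> b \<in> carr B \<Longrightarrow>
      aM h (lM b m) = sw h (\<lambda>h1 h2. lM (act h1 b) (aM h2 m))"
    and aM_rM [push]: "\<And>h m b. h \<in> carr H \<Longrightarrow> m \<in> carr M \<Longrightarrow> b \<in> carr B \<Longrightarrow>
      aM h (rM m b) = sw h (\<lambda>h1 h2. rM (aM h1 m) (act h2 b))"
    and aM_twist: "\<And>h g m. h \<in> carr H \<Longrightarrow> g \<in> carr H \<Longrightarrow> m \<in> carr M \<Longrightarrow>
      sw h (\<lambda>h1 h2. sw g (\<lambda>g1 g2. rM (aM h1 (aM g1 m)) (\<sigma> h2 g2))) =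
      sw h (\<lambda>h1 h2. sw g (\<lambda>g1 g2. lM (\<sigma> h1 g1) (aM (amul H h2 g2) m)))"
begin

lemma vectM [tw]: "vect M" and lM_bil: "bilinear_on B M M lM" and rM_bil: "bilinear_on M B M rM"
  using M_left M_right by (simp_all add: left_module_def right_module_def)

lemmas [tw] = bilinear_rules[OF lM_bil vectB vectM vectM] bilinear_rules[OF rM_bil vectM vectB vectM]
  bilinear_rules[OF aM_bil vectH vectM vectM]
lemmas [push] = bilinear_push[OF lM_bil vectB vectM vectM] bilinear_push[OF rM_bil vectM vectB vectM]
  bilinear_push[OF aM_bil vectH vectM vectM]

lemma lM_assoc [push]: "b \<in> carr B \<Longrightarrow> c \<in> carr B \<Longrightarrow> m \<in> carr M \<Longrightarrow> lM (amul B b c) m = lM b (lM c m)"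
  and rM_assoc [push]: "b \<in> carr B \<Longrightarrow> c \<in> carr B \<Longrightarrow> m \<in> carr M \<Longrightarrow> rM (rM m b) c = rM m (amul B b c)"
  and lM_one [push]: "m \<in> carr M \<Longrightarrow> lM (aone B) m = m"
  and rM_one [push]: "m \<in> carr M \<Longrightarrow> rM m (aone B) = m"
  using M_left M_right by (simp_all add: left_module_def right_module_def)

abbreviation "MN \<equiv> tensor M N"

definition gl where
  "gl x w = tsum B H x (\<lambda>b h. tsum M N w (\<lambda>m n.
     sw h (\<lambda>a h3. sw a (\<lambda>h1 h2. tsum H N (\<delta> n) (\<lambda>k n0.
       ptensor M N (rM (lM b (aM h1 m)) (\<sigma> h2 k)) (lN h3 n0))))))"

definition gr where
  "gr w x = tsum M N w (\<lambda>m n. tsum B H x (\<lambda>b h.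
     tsum H N (\<delta> n) (\<lambda>k n0. sw k (\<lambda>k1 k2. sw h (\<lambda>g1 g2.
       ptensor M N (rM (rM m (act k1 b)) (\<sigma> k2 g1)) (rN n0 g2))))))"

definition co where
  "co w = tsum M N w (\<lambda>m n. tsum N H (\<rho> n) (\<lambda>n0 n1. ptensor MN H (ptensor M N m n0) n1))"

lemma gl_bil: "bilinear_on BH MN MN gl" and gr_bil: "bilinear_on MN BH MN gr"
  and co_lin: "linear_on MN (tensor MN H) co"
proof -
  note [simp] = tw push R_sw[where U=MN]
  note [cong] = sw_cong
  show "bilinear_on BH MN MN gl" unfolding gl_def by (intro bilinear_onI) simp_all
  show "bilinear_on MN BH MN gr" unfolding gr_def by (intro bilinear_onI) simp_all
  show "linear_on MN (tensor MN H) co" unfolding co_def by simp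
qed

lemmas [tw] = bilinear_rules[OF gl_bil vect_tensor vect_tensor vect_tensor]
  bilinear_rules[OF gr_bil vect_tensor vect_tensor vect_tensor] linear_rules[OF co_lin vect_tensor vect_tensor]
lemmas [push] = bilinear_push[OF gl_bil vect_tensor vect_tensor vect_tensor]
  bilinear_push[OF gr_bil vect_tensor vect_tensor vect_tensor] linear_push[OF co_lin vect_tensor vect_tensor]

lemma gl_one: assumes "w \<in> carr MN" shows "gl (ptensor B H (aone B) (aone H)) w = w"
proof (rule tensor_eqI[OF _ _ _ _ assms, where U=MN])
  note [simp] = tw push R_sw[where U=MN] srtR
  note [cong] = sw_cong
  show "gl (ptensor B H (aone B) (aone H)) (ptensor M N m n) = ptensor M N m n" if [simp]: "m \<in> carr M" "n \<in> carr N" for m n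
    by (simp add: gl_def)
qed (simp_all add: tw)

lemma gr_one: assumes "w \<in> carr MN" shows "gr w (ptensor B H (aone B) (aone H)) = w"
proof (rule tensor_eqI[OF _ _ _ _ assms, where U=MN])
  note [simp] = tw push R_sw[where U=MN] srtR
  note [cong] = sw_cong
  show "gr (ptensor M N m n) (ptensor B H (aone B) (aone H)) = ptensor M N m n" if [simp]: "m \<in> carr M" "n \<in> carr N" for m n
    by (simp add: gr_def)
qed (simp_all add: tw)

end

context crossed begin

text \<open>
  Both sides involve one \<open>\<sigma>\<close> for each of the two multiplications.  The cocycle identity moves
  \<open>act h (\<sigma> g k)\<close> out of the way; after that the twisted module identity exchanges the two actions on \<open>m\<close>
  with the remaining \<open>\<sigma>\<close>.
\<close>

lemma gl_mul:
  assumes xyw: "x \<in> carr BH" "y \<in> carr BH" "w \<in> carr MN"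
  shows "gl (mulA x y) w = gl x (gl y w)"
proof -
  note [simp] = tw push R_sw[where U=MN] hopf_sw[where U=BH] srtR
  note [cong] = sw_cong
  have gen: "gl (mulA (ptensor B H b h) (ptensor B H c g)) (ptensor M N m n) =
      gl (ptensor B H b h) (gl (ptensor B H c g) (ptensor M N m n))"
    if [simp]: "b \<in> carr B" "h \<in> carr H" "c \<in> carr B" "g \<in> carr H" "m \<in> carr M" "n \<in> carr N" for b h c g m n
  proof -
    let ?Co = "\<lambda>h g k. sw h (\<lambda>h1 h2. sw g (\<lambda>g1 g2. sw k (\<lambda>k1 k2.
       amul B (act h1 (\<sigma> g1 k1)) (\<sigma> h2 (amul H g2 k2)))))"
    let ?Tw = "\<lambda>h g m. sw h (\<lambda>h1 h2. sw g (\<lambda>g1 g2. rM (aM h1 (aM g1 m)) (\<sigma> h2 g2)))"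
    have "gl (ptensor B H b h) (gl (ptensor B H c g) (ptensor M N m n)) =
      sw h (\<lambda>h1 r. sw r (\<lambda>h2 s. sw s (\<lambda>p h5.
      sw g (\<lambda>g1 t. sw t (\<lambda>q g4. tsum H N (\<delta> n) (\<lambda>k n0.
        ptensor M N (lM b (lM (act h1 c) (rM (aM h2 (aM g1 m)) (?Co p q k)))) (lN h5 (lN g4 n0))))))))"
      by (simp add: gl_def)
    also have "\<dots> = sw h (\<lambda>h1 r. sw r (\<lambda>p s. sw s (\<lambda>h4 h5.
      sw g (\<lambda>q t. sw t (\<lambda>g3 g4. tsum H N (\<delta> n) (\<lambda>k n0.
        ptensor M N (lM b (lM (act h1 c) (rM (?Tw p q m) (\<sigma> (amul H h4 g3) k)))) (lN h5 (lN g4 n0))))))))"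
      by (simp add: cocycle)
    also have "\<dots> = gl (mulA (ptensor B H b h) (ptensor B H c g)) (ptensor M N m n)"
      by (simp add: aM_twist gl_def mulA_def)
    finally show ?thesis by simp
  qed
  show ?thesis
    by (rule tensor_eqI3[where U=MN and F="\<lambda>x y w. gl (mulA x y) w" and G="\<lambda>x y w. gl x (gl y w)", OF _ _ _ _ _
        _ _ _ _ _ _ gen xyw])
      simp_all
qed

lemma gr_mul:
  assumes xyw: "x \<in> carr BH" "y \<in> carr BH" "w \<in> carr MN"
  shows "gr w (mulA x y) = gr (gr w x) y"
proof -
  note [simp] = tw push R_sw[where U=MN] hopf_sw[where U=BH] srtR
  note [cong] = sw_cong
  have gen: "gr (ptensor M N m n) (mulA (ptensor B H b h) (ptensor B H c g)) =
      gr (gr (ptensor M N m n) (ptensor B H b h)) (ptensor B H c g)"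
    if [simp]: "b \<in> carr B" "h \<in> carr H" "c \<in> carr B" "g \<in> carr H" "m \<in> carr M" "n \<in> carr N" for b h c g m n
  proof -
    let ?Co = "\<lambda>h g k. sw h (\<lambda>h1 h2. sw g (\<lambda>g1 g2. sw k (\<lambda>k1 k2.
       amul B (act h1 (\<sigma> g1 k1)) (\<sigma> h2 (amul H g2 k2)))))"
    let ?Tw = "\<lambda>h g m. sw h (\<lambda>h1 h2. sw g (\<lambda>g1 g2. amul B (act h1 (act g1 m)) (\<sigma> h2 g2)))"
    have "gr (ptensor M N m n) (mulA (ptensor B H b h) (ptensor B H c g)) =
      tsum H N (\<delta> n) (\<lambda>k1 r. tsum H N (\<delta> r) (\<lambda>k2 s. tsum H N (\<delta> s) (\<lambda>p n0.
      sw h (\<lambda>h1 t. sw t (\<lambda>q h4. sw g (\<lambda>u g3.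
        ptensor M N (rM m (amul B (act k1 b) (amul B (act k2 (act h1 c)) (?Co p q u)))) (rN n0 (amul H h4 g3))))))))"
      by (simp add: gr_def mulA_def)
    also have "\<dots> = tsum H N (\<delta> n) (\<lambda>k1 r. tsum H N (\<delta> r) (\<lambda>p s. tsum H N (\<delta> s) (\<lambda>k4 n0.
      sw h (\<lambda>q t. sw t (\<lambda>h3 h4. sw g (\<lambda>u g3.
        ptensor M N (rM m (amul B (act k1 b) (amul B (?Tw p q c) (\<sigma> (amul H k4 h3) u)))) (rN n0 (amul H h4 g3))))))))"
      by (simp add: cocycle)
    also have "\<dots> = gr (gr (ptensor M N m n) (ptensor B H b h)) (ptensor B H c g)"
      by (simp add: act_twist gr_def)
    finally show ?thesis by simp
  qed
  show ?thesis
    by (rule tensor_eqI3[where U=MN and F="\<lambda>x y w. gr w (mulA x y)" and G="\<lambda>x y w. gr (gr w x) y", OF _ _ _ _ _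
        _ _ _ _ _ _ gen xyw])
      simp_all
qed

lemma gl_gr:
  assumes xyw: "x \<in> carr BH" "y \<in> carr BH" "w \<in> carr MN"
  shows "gr (gl x w) y = gl x (gr w y)"
proof -
  note [simp] = tw push R_sw[where U=MN] hopf_sw[where U=BH] srtR
  note [cong] = sw_cong
  have gen: "gr (gl (ptensor B H b h) (ptensor M N m n)) (ptensor B H c g) =
      gl (ptensor B H b h) (gr (ptensor M N m n) (ptensor B H c g))"
    if [simp]: "b \<in> carr B" "h \<in> carr H" "c \<in> carr B" "g \<in> carr H" "m \<in> carr M" "n \<in> carr N" for b h c g m n
  proof -
    let ?Co = "\<lambda>h g k. sw h (\<lambda>h1 h2. sw g (\<lambda>g1 g2. sw k (\<lambda>k1 k2.
       amul B (act h1 (\<sigma> g1 k1)) (\<sigma> h2 (amul H g2 k2)))))"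
    let ?Tw = "\<lambda>h g m. sw h (\<lambda>h1 h2. sw g (\<lambda>g1 g2. amul B (act h1 (act g1 m)) (\<sigma> h2 g2)))"
    have "gl (ptensor B H b h) (gr (ptensor M N m n) (ptensor B H c g)) =
      sw h (\<lambda>h1 t. sw t (\<lambda>h2 q. sw q (\<lambda>h3 h4.
      tsum H N (\<delta> n) (\<lambda>k1 r. tsum H N (\<delta> r) (\<lambda>p n0. sw g (\<lambda>u g3.
        ptensor M N (lM b (rM (aM h1 m) (amul B (act h2 (act k1 c)) (?Co h3 p u)))) (lN h4 (rN n0 g3))))))))"
      by (simp add: gl_def gr_def)
    also have "\<dots> = sw h (\<lambda>h1 t. sw t (\<lambda>p q. sw q (\<lambda>h3 h4.
      tsum H N (\<delta> n) (\<lambda>k1 r. tsum H N (\<delta> r) (\<lambda>k2 n0. sw g (\<lambda>u g3.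
        ptensor M N (lM b (rM (aM h1 m) (amul B (?Tw p k1 c) (\<sigma> (amul H h3 k2) u)))) (lN h4 (rN n0 g3))))))))"
      by (simp add: cocycle)
    also have "\<dots> = gr (gl (ptensor B H b h) (ptensor M N m n)) (ptensor B H c g)"
      by (simp add: act_twist gr_def gl_def)
    finally show ?thesis by simp
  qed
  show ?thesis
    by (rule tensor_eqI3[where U=MN and F="\<lambda>x y w. gr (gl x w) y" and G="\<lambda>x y w. gl x (gr w y)", OF _ _ _ _ _ _
        _ _ _ _ _ gen xyw])
      simp_all
qed

lemma co_gl:
  assumes xw: "x \<in> carr BH" "w \<in> carr MN"
  shows "co (gl x w) = tsum BH H (coA x) (\<lambda>x0 x1. tsum MN H (co w) (\<lambda>w0 w1. ptensor MN H (gl x0 w0) (amul H x1 w1)))"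
proof -
  let ?U = "tensor MN H"
  note [simp] = tw push R_sw[where U="?U"] srtR
  note [cong] = sw_cong
  show ?thesis
  proof (rule tensor_eqI[OF _ _ _ _ xw(1), where U="?U"])
    fix b h assume 1 [simp]: "b \<in> carr B" "h \<in> carr H"
    show "co (gl (ptensor B H b h) w) = tsum BH H (coA (ptensor B H b h)) (\<lambda>x0 x1. tsum MN H (co w) (\<lambda>w0 w1.
        ptensor MN H (gl x0 w0) (amul H x1 w1)))"
    proof (rule tensor_eqI[OF _ _ _ _ xw(2), where U="?U"])
      fix m n assume 2 [simp]: "m \<in> carr M" "n \<in> carr N"
      show "co (gl (ptensor B H b h) (ptensor M N m n)) =
        tsum BH H (coA (ptensor B H b h)) (\<lambda>x0 x1. tsum MN H (co (ptensor M N m n)) (\<lambda>w0 w1. ptensor MN H (gl x0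
            w0) (amul H x1 w1)))"
        by (simp add: gl_def co_def coA_def R_sw[where U=MN] hopf_sw[where U="tensor BH H"])
    qed (use xw in simp_all)
  qed (use xw in simp_all)
qed

lemma co_comodule: "right_comodule H MN co"
  unfolding right_comodule_def cop_def
proof (intro conjI ballI)
  fix w assume w: "w \<in> carr MN"
  let ?U = "tensor MN (tensor H H)"
  note [simp] = tw push srtR w
  note [cong] = sw_cong
  let ?F = "\<lambda>w. tsum MN H (co w) (\<lambda>v0 h. tsum MN H (co v0) (\<lambda>x y. ptensor MN (tensor H H) x (ptensor H H y h)))"
  let ?G = "\<lambda>w. tsum MN H (co w) (\<lambda>v0 h. sw h (\<lambda>h1 h2. ptensor MN (tensor H H) v0 (ptensor H H h1 h2)))"
  show "?F w = ?G w"
  proof (rule tensor_eqI[where F="?F" and G="?G" and U="?U"])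
    show "linear_on MN ?U ?F" "linear_on MN ?U ?G" by simp_all
    fix m n assume [simp]: "m \<in> carr M" "n \<in> carr N"
    show "?F (ptensor M N m n) = ?G (ptensor M N m n)"
      by (simp add: co_def R_sw[where U="?U"] R_sw[where U="tensor MN H"])
  qed (simp_all add: w)
  show "tsum MN H (co w) (\<lambda>v0 h. scl MN (counit H h) v0) = w"
    by (rule tensor_eqI[OF _ _ _ _ w, where U="MN"])
      (simp_all add: co_def R_sw[where U="MN"] R_sw[where U="tensor MN H"])
qed (rule vect_tensor co_lin)+

end

section \<open>First order differential calculi\<close>

text \<open>
  Additivity is kept apart from \<open>push\<close>; it matters only where sums or differences are written out, as in the
  Leibniz rule.  Tensors are functions, so the rules
  for pointwise arithmetic are disabled along with its use; they would expand a sum of tensors.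
\<close>

named_theorems additive

text \<open>
  An element of the tensor product is a Sweedler sum of pure tensors; a linear map therefore
  lands in a subspace as soon as it does so on pure tensors.
\<close>

lemma tensor_into:
  assumes t: "t \<in> carr (tensor V W)" and V: "vect V" "vect W" and f: "linear_on (tensor V W) U f" and K: "vect K"
    and gen: "\<And>v w. v \<in> carr V \<Longrightarrow> w \<in> carr W \<Longrightarrow> f (ptensor V W v w) \<in> carr K"
  shows "f t \<in> carr K"
proof -
  have "f (tsum V W t (ptensor V W)) = tsum V W t (\<lambda>v w. f (ptensor V W v w))"
    using bilinear_rules(1)[OF ptensor_bilinear] V by (intro tsum_push[OF f vect_tensor V(1) t]) (simp add: vect_tensor)
  then have "f t = tsum V W t (\<lambda>v w. f (ptensor V W v w))" by (simp only: tsum_id[OF V(1) t])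
  then show ?thesis using tsum_in[OF V(1) t K gen] by simp
qed

lemma bilinear_additive:
  assumes f: "bilinear_on V W U f" and v: "vect V" "vect W" "vect U"
  shows "a \<in> carr V \<Longrightarrow> a' \<in> carr V \<Longrightarrow> b \<in> carr W \<Longrightarrow> f (a + a') b = f a b + f a' b"
    and "a \<in> carr V \<Longrightarrow> b \<in> carr W \<Longrightarrow> b' \<in> carr W \<Longrightarrow> f a (b + b') = f a b + f a b'"
    and "a \<in> carr V \<Longrightarrow> a' \<in> carr V \<Longrightarrow> b \<in> carr W \<Longrightarrow> f (a - a') b = f a b - f a' b"
    and "a \<in> carr V \<Longrightarrow> b \<in> carr W \<Longrightarrow> b' \<in> carr W \<Longrightarrow> f a (b - b') = f a b - f a b'"
    and "b \<in> carr W \<Longrightarrow> f 0 b = 0" and "a \<in> carr V \<Longrightarrow> f a 0 = 0"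
  using linear_on_add[OF bilinear_on_left[OF f]] linear_on_add[OF bilinear_on_right[OF f]]
    linear_on_diff[OF bilinear_on_left[OF f] v(1)] linear_on_diff[OF bilinear_on_right[OF f] v(2)]
    linear_on_zero[OF bilinear_on_left[OF f] v(1)] linear_on_zero[OF bilinear_on_right[OF f] v(2)]
  by auto

lemma linear_additive:
  assumes f: "linear_on V U f" and v: "vect V" "vect U"
  shows "a \<in> carr V \<Longrightarrow> a' \<in> carr V \<Longrightarrow> f (a + a') = f a + f a'"
    and "a \<in> carr V \<Longrightarrow> a' \<in> carr V \<Longrightarrow> f (a - a') = f a - f a'"
    and "f 0 = 0"
  using linear_on_add[OF f] linear_on_diff[OF f v(1)] linear_on_zero[OF f v(1)] by auto

lemmas [additive] = tsum_plus tsum_minus tsum_zero scl_add scl_diff scl_zero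
  bilinear_additive[OF ptensor_bilinear _ _ vect_tensor]

lemma span_induct_vect:
  assumes V: "vect V" and S: "S \<subseteq> carr V" and t: "t \<in> vspan V S" and z: "P 0"
    and step: "\<And>c x y. x \<in> S \<Longrightarrow> y \<in> carr V \<Longrightarrow> P y \<Longrightarrow> P (scl V c x + y)"
  shows "t \<in> carr V \<and> P t"
proof -
  interpret vector_space "scl V" using V by (rule vect_vs)
  from t show ?thesis
  proof (induction rule: span_induct_alt)
    case base show ?case using z vect_zero[OF V] by simp
  next
    case (step c x y)
    then have "x \<in> carr V" "y \<in> carr V" "P y" using S by auto
    with step(1) show ?case by (intro conjI vect_add vect_scl V assms(5))
  qed
qed

lemma span_carr: "vect V \<Longrightarrow> S \<subseteq> carr V \<Longrightarrow> vspan V S \<subseteq> carr V"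
  using span_induct_vect[where P="\<lambda>_. True"] by blast

lemma span_eqI:
  assumes V: "vect V" and S: "S \<subseteq> carr V" and t: "t \<in> vspan V S"
    and F: "linear_on V U F" "linear_on V U G" and eq: "\<And>x. x \<in> S \<Longrightarrow> F x = G x"
  shows "F t = G t"
proof -
  have "t \<in> carr V \<and> F t = G t"
  proof (rule span_induct_vect[OF V S t])
    fix c x y assume "x \<in> S" "y \<in> carr V" "F y = G y"
    then show "F (scl V c x + y) = G (scl V c x + y)"
      using F eq[of x] S V by (auto simp: linear_on_add linear_on_scl vect_scl subset_iff)
  qed (simp add: linear_on_zero[OF F(1) V] linear_on_zero[OF F(2) V])
  then show ?thesis ..
qed

lemma fodc_gens: "fodc A \<Omega> \<Longrightarrow> {lmul \<Omega> a (dif \<Omega> b) | a b. a \<in> carr A \<and> b \<in> carr A} \<subseteq> carr \<Omega>"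
  by (auto simp: fodc_def left_module_def bilinear_on_def linear_on_def)

lemma fodc_eqI:
  assumes "fodc A \<Omega>" "linear_on \<Omega> U F" "linear_on \<Omega> U G"
    and "\<And>a b. a \<in> carr A \<Longrightarrow> b \<in> carr A \<Longrightarrow> F (lmul \<Omega> a (dif \<Omega> b)) = G (lmul \<Omega> a (dif \<Omega> b))"
    and "\<omega> \<in> carr \<Omega>"
  shows "F \<omega> = G \<omega>"
proof (rule span_eqI[OF _ fodc_gens[OF assms(1)] _ assms(2,3)])
  show "vect \<Omega>" using assms(1) by (simp add: fodc_def left_module_def)
  show "\<omega> \<in> vspan \<Omega> {lmul \<Omega> a (dif \<Omega> b) |a b. a \<in> carr A \<and> b \<in> carr A}"
    using assms(1,5) by (simp add: fodc_def)
qed (use assms(4) in auto)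

text \<open>
  Forms are spanned by the \<open>a db\<close>; no scalar multiples need to be treated since \<open>c (a db) = (c a) db\<close>.
\<close>

lemma fodc_induct [consumes 3, case_names zero add gen]:
  assumes w: "\<omega> \<in> carr \<Omega>" and f: "fodc A \<Omega>" and VA: "vect A"
    and z: "P 0" and a: "\<And>s t. s \<in> carr \<Omega> \<Longrightarrow> t \<in> carr \<Omega> \<Longrightarrow> P s \<Longrightarrow> P t \<Longrightarrow> P (s + t)"
    and g: "\<And>a b. a \<in> carr A \<Longrightarrow> b \<in> carr A \<Longrightarrow> P (lmul \<Omega> a (dif \<Omega> b))"
  shows "P \<omega>"
proof -
  have V: "vect A" "vect \<Omega>" and l: "bilinear_on A \<Omega> \<Omega> (lmul \<Omega>)" and d: "linear_on A \<Omega> (dif \<Omega>)"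
    and fv: "carr \<Omega> = vspan \<Omega> {lmul \<Omega> a (dif \<Omega> b) | a b. a \<in> carr A \<and> b \<in> carr A}"
    using f VA by (simp_all add: fodc_def left_module_def)
  have "\<omega> \<in> carr \<Omega> \<and> P \<omega>"
  proof (rule span_induct_vect[where P=P, OF V(2) fodc_gens[OF f] _ z])
    show "\<omega> \<in> vspan \<Omega> {lmul \<Omega> a (dif \<Omega> b) | a b. a \<in> carr A \<and> b \<in> carr A}" using w fv by simp
    fix c x y assume "x \<in> {lmul \<Omega> a (dif \<Omega> b) | a b. a \<in> carr A \<and> b \<in> carr A}" and y: "y \<in> carr \<Omega>" "P y"
    then obtain a b where ab: "x = lmul \<Omega> a (dif \<Omega> b)" "a \<in> carr A" "b \<in> carr A" by blast
    have "scl \<Omega> c x = lmul \<Omega> (scl A c a) (dif \<Omega> b)"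
      using ab bilinear_push(3)[OF l V V(2)] linear_on_in[OF d] by simp
    moreover have "lmul \<Omega> (scl A c a) (dif \<Omega> b) \<in> carr \<Omega>"
      using ab V by (intro bilinear_rules(1)[OF l V(1,2,2)] vect_scl linear_on_in[OF d])
    ultimately show "P (scl \<Omega> c x + y)" using ab V y by (simp add: a g vect_scl)
  qed
  then show ?thesis ..
qed

lemma fodc_one: assumes "fodc A' \<Omega>'" "algebra A'" shows "dif \<Omega>' (aone A') = 0"
proof -
  have "dif \<Omega>' (amul A' (aone A') (aone A')) = rmul \<Omega>' (dif \<Omega>' (aone A')) (aone A') + lmul \<Omega>' (aone A') (dif \<Omega>' (aone A'))"
    "dif \<Omega>' (aone A') \<in> carr \<Omega>'"
    using assms by (auto simp: fodc_def algebra_def linear_on_def)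
  then show ?thesis using assms by (simp add: fodc_def algebra_def left_module_def right_module_def)
qed

lemma fodc_into:
  assumes w: "\<omega> \<in> carr \<Omega>" and \<Omega>: "fodc A \<Omega>" "vect A" and f: "linear_on \<Omega> U f" and K: "vect K"
    and gen: "\<And>a b. a \<in> carr A \<Longrightarrow> b \<in> carr A \<Longrightarrow> f (lmul \<Omega> a (dif \<Omega> b)) \<in> carr K"
  shows "f \<omega> \<in> carr K"
  using w \<Omega>
proof (induction rule: fodc_induct)
  case zero
  have "vect \<Omega>" using \<Omega> by (simp add: fodc_def left_module_def)
  with linear_on_zero[OF f] vect_zero[OF K] show ?case by simp
next
  case (add s t)
  with linear_on_add[OF f] vect_add[OF K] show ?case by simp
qed (rule gen)

lemma tsum_into_subspace:
  assumes "vect K" "vect V" "t \<in> carr (tensor V W)" "\<And>v w. v \<in> carr V \<Longrightarrow> w \<in> carr W \<Longrightarrow> f v w \<in> carr K"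
  shows "tsum V W t f \<in> carr K"
  by (rule tsum_in[OF assms(2,3,1)]) (rule assms(4))

lemma vect_span: "vect V \<Longrightarrow> vect \<lparr> carr = vspan V S, scl = scl V \<rparr>"
proof -
  assume "vect V"
  then interpret vector_space "scl V" by (rule vect_vs)
  show ?thesis by (simp add: vect_def vector_space_axioms subspace_span)
qed

lemma span_sub: "vect W \<Longrightarrow> scl W = scl V \<Longrightarrow> S \<subseteq> carr W \<Longrightarrow> vspan V S \<subseteq> carr W"
  using span_carr[of W S] by simp

lemma span_base': "vect V \<Longrightarrow> x \<in> S \<Longrightarrow> x \<in> vspan V S"
proof -
  assume "vect V" "x \<in> S"
  then interpret vector_space "scl V" by (simp add: vect_vs)
  show ?thesis using \<open>x \<in> S\<close> by (rule span_base)
qed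

lemma bilinear_on_subspace:
  assumes "bilinear_on V W W f" "carr W' \<subseteq> carr W" "scl W' = scl W"
    and "\<And>v w. v \<in> carr V \<Longrightarrow> w \<in> carr W' \<Longrightarrow> f v w \<in> carr W'"
  shows "bilinear_on V W' W' f"
  using assms by (simp add: bilinear_on_def linear_on_def subset_iff)

lemma bilinear_on_subspace_left:
  assumes "bilinear_on W V W f" "carr W' \<subseteq> carr W" "scl W' = scl W"
    and "\<And>v w. v \<in> carr V \<Longrightarrow> w \<in> carr W' \<Longrightarrow> f w v \<in> carr W'"
  shows "bilinear_on W' V W' f"
  using assms by (simp add: bilinear_on_def linear_on_def subset_iff)

text \<open>
  The submodule structure on the horizontal forms and exactness in the middle come for free once these forms
  are known to be the kernel of the vertical map.
\<close>

lemma quantum_principal_bundleI: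
  fixes H :: "('h::ab_group_add, 'k::field, 'w) hopf_scheme" and A :: "('a::ab_group_add, 'k, 'h, 'x) comodalg_scheme"
    and \<Omega> :: "('o::ab_group_add, 'k, 'a, 'h, 'y) rcalc_scheme" and \<Gamma> :: "('g::ab_group_add, 'k, 'h, 'h, 'z) bicalc_scheme"
  defines "AX \<equiv> tensor A (left_coinv_forms H \<Gamma>)" and "l \<equiv> left_act_tensor A (left_coinv_forms H \<Gamma>)"
  assumes A: "right_comodule_algebra H A" and cov: "right_covariant_fodc H A \<Omega>" "bicovariant_fodc H \<Gamma>"
    and ver: "vertical_map H A \<Omega> \<Gamma> ver" and AX: "left_module A AX l"
    and hom: "left_module_hom A \<Omega> (lmul \<Omega>) AX l ver" and surj: "ver ` carr \<Omega> = carr AX"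
    and kernel: "carr (horizontal_forms H A \<Omega>) = {w \<in> carr \<Omega>. ver w = 0}"
  shows "quantum_principal_bundle H A \<Omega> \<Gamma>"
  unfolding quantum_principal_bundle_def
proof (intro conjI exI)
  let ?h = "horizontal_forms H A \<Omega>"
  have m: "left_module A \<Omega> (lmul \<Omega>)" using cov by (simp add: right_covariant_fodc_def fodc_def)
  then have V: "vect A" "vect \<Omega>" and b: "bilinear_on A \<Omega> \<Omega> (lmul \<Omega>)"
    using A by (simp_all add: left_module_def right_comodule_algebra_def algebra_def)
  have lin: "linear_on \<Omega> AX ver" and ver_l: "ver (lmul \<Omega> a w) = l a (ver w)" if "a \<in> carr A" "w \<in> carr \<Omega>" for a w
    using hom that by (simp_all add: left_module_hom_def)
  have lin: "linear_on \<Omega> AX ver" using hom by (simp add: left_module_hom_def)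
  have l0: "l a 0 = 0" if "a \<in> carr A" for a
    using AX that linear_on_zero[OF bilinear_on_right, of A AX AX l a] by (simp add: left_module_def)
  have s: "scl ?h = scl \<Omega>" by (simp add: horizontal_forms_def)
  have vAX: "vect AX" using AX by (simp add: left_module_def)
  have v: "vect ?h"
  proof (rule vectI)
    show "vector_space (scl ?h)" using vect_vs[OF V(2)] by (simp only: s)
  qed (auto simp: kernel s vect_zero[OF V(2)] vect_add[OF V(2)] vect_scl[OF V(2)]
      linear_on_zero[OF lin V(2)] linear_on_add[OF lin] linear_on_scl[OF lin] scl_zero[OF vAX])
  have cl: "lmul \<Omega> a w \<in> carr ?h" if "a \<in> carr A" "w \<in> carr ?h" for a w
    using that ver_l[of a w] l0 bilinear_rules(1)[OF b V(1,2,2), of a w] by (simp add: kernel)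
  have b': "bilinear_on A ?h ?h (lmul \<Omega>)"
    by (rule bilinear_on_subspace[OF b _ s cl]) (auto simp: kernel)
  have lm: "left_module A ?h (lmul \<Omega>)"
    using m v b' unfolding left_module_def by (simp add: kernel)
  have incl: "left_module_hom A ?h (lmul \<Omega>) \<Omega> (lmul \<Omega>) (\<lambda>\<omega>. \<omega>)"
    by (auto simp: left_module_hom_def linear_on_def kernel s)
  show "short_exact A ?h (lmul \<Omega>) \<Omega> (lmul \<Omega>) (tensor A (left_coinv_forms H \<Gamma>))
      (left_act_tensor A (left_coinv_forms H \<Gamma>)) (\<lambda>\<omega>. \<omega>) ver"
    unfolding AX_def[symmetric] l_def[symmetric] short_exact_def
    using lm m AX incl hom surj by (simp add: kernel)
qed (rule A cov ver)+

section \<open>Comodule algebras\<close>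

locale comodule_algebra = hopf H for H :: "('h::ab_group_add, 'k::field, 'z) hopf_scheme" +
  fixes A :: "('a::ab_group_add, 'k, 'h, 'y) comodalg_scheme"
  assumes comod_alg: "right_comodule_algebra H A"
begin

lemma algA: "algebra A" using comod_alg by (simp add: right_comodule_algebra_def)

lemma vectA [tw]: "vect A" and mulA_bil: "bilinear_on A A A (amul A)" and oneA [tw]: "aone A \<in> carr A"
  and coact_lin: "linear_on A (tensor A H) (coact A)"
  using comod_alg by (simp_all add: right_comodule_algebra_def algebra_def right_comodule_def)

lemmas [tw] = bilinear_rules[OF mulA_bil vectA vectA vectA] linear_rules[OF coact_lin vectA vect_tensor]
lemmas [push] = bilinear_push[OF mulA_bil vectA vectA vectA] linear_push[OF coact_lin vectA vect_tensor]
lemmas [additive] = bilinear_additive[OF mulA_bil vectA vectA vectA] linear_additive[OF coact_lin vectA vect_tensor]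

lemma mulA_assoc [push]: "a \<in> carr A \<Longrightarrow> b \<in> carr A \<Longrightarrow> c \<in> carr A \<Longrightarrow>
    amul A (amul A a b) c = amul A a (amul A b c)"
  and oneA_left [push]: "a \<in> carr A \<Longrightarrow> amul A (aone A) a = a"
  and oneA_right [push]: "a \<in> carr A \<Longrightarrow> amul A a (aone A) = a"
  using algA by (simp_all add: algebra_def)

lemma coact_mul [push]: "a \<in> carr A \<Longrightarrow> b \<in> carr A \<Longrightarrow> coact A (amul A a b) =
    tsum A H (coact A a) (\<lambda>a0 a1. tsum A H (coact A b) (\<lambda>b0 b1. ptensor A H (amul A a0 b0) (amul H a1 b1)))"
  and coact_one [push]: "coact A (aone A) = ptensor A H (aone A) (aone H)"
  using comod_alg by (simp_all add: right_comodule_algebra_def)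

lemma A_coassoc:
  assumes "vect U" "n \<in> carr A"
   "\<And>u v. u \<in> carr H \<Longrightarrow> v \<in> carr H \<Longrightarrow> linear_on A U (\<lambda>x. f x u v)"
   "\<And>u v. u \<in> carr A \<Longrightarrow> v \<in> carr H \<Longrightarrow> linear_on H U (\<lambda>x. f u x v)"
   "\<And>u v. u \<in> carr A \<Longrightarrow> v \<in> carr H \<Longrightarrow> linear_on H U (\<lambda>x. f u v x)"
  shows "tsum A H (coact A n) (\<lambda>x y. tsum A H (coact A x) (\<lambda>u v. f u v y)) =
    tsum A H (coact A n) (\<lambda>u r. sw r (\<lambda>v y. f u v y))"
  by (rule bracketing[where U=U])
    (use comod_alg assms tw in \<open>simp_all add: right_comodule_algebra_def right_comodule_def cop_def\<close>)

lemma A_counit [push]: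
  assumes f: "vect U" "linear_on A U f" "n \<in> carr A"
  shows "tsum A H (coact A n) (\<lambda>n0 k. scl U (counit H k) (f n0)) = f n"
proof -
  note [simp] = tw push linear_rules[OF f(2) vectA f(1)] linear_push[OF f(2) vectA f(1)] f
  note [cong] = sw_cong
  have "f n = f (tsum A H (coact A n) (\<lambda>n0 k. scl A (counit H k) n0))"
    using comod_alg f by (simp add: right_comodule_algebra_def right_comodule_def)
  also have "\<dots> = tsum A H (coact A n) (\<lambda>n0 k. scl U (counit H k) (f n0))" by simp
  finally show ?thesis by simp
qed

lemmas srtA = srt tsum_swap[of A H _ H H]
lemmas A_sw = hopf_sw A_coassoc

end

text \<open>
  For a right covariant calculus the coaction is determined by its values on the forms \<open>x dy\<close>.
  Conversely, a linear map with these values satisfies all conditions of covariance, because these are linear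
  in the form and can be checked on \<open>x dy\<close>.
\<close>

locale comodule_fodc = comodule_algebra H A for H :: "('h::ab_group_add, 'k::field, 'z) hopf_scheme"
  and A :: "('a::ab_group_add, 'k, 'h, 'y) comodalg_scheme" +
  fixes \<Omega> :: "('o::ab_group_add, 'k, 'a, 'h, 'x) rcalc_scheme"
  assumes fodcA: "fodc A \<Omega>" and rco_lin: "linear_on \<Omega> (tensor \<Omega> H) (rcoact \<Omega>)"
    and rco_gen [push]: "\<And>x y. x \<in> carr A \<Longrightarrow> y \<in> carr A \<Longrightarrow> rcoact \<Omega> (lmul \<Omega> x (dif \<Omega> y)) =
      tsum A H (coact A x) (\<lambda>x0 x1. tsum A H (coact A y) (\<lambda>y0 y1.
        ptensor \<Omega> H (lmul \<Omega> x0 (dif \<Omega> y0)) (amul H x1 y1)))"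
begin

lemma vectO [tw]: "vect \<Omega>" and lmul_bil: "bilinear_on A \<Omega> \<Omega> (lmul \<Omega>)" and rmul_bil: "bilinear_on \<Omega> A \<Omega> (rmul \<Omega>)"
  and dif_lin: "linear_on A \<Omega> (dif \<Omega>)"
  using fodcA by (simp_all add: fodc_def left_module_def right_module_def)

lemmas [tw] = bilinear_rules[OF lmul_bil vectA vectO vectO] bilinear_rules[OF rmul_bil vectO vectA vectO]
   linear_rules[OF dif_lin vectA vectO] linear_rules[OF rco_lin vectO vect_tensor]
lemmas [push] = bilinear_push[OF lmul_bil vectA vectO vectO] bilinear_push[OF rmul_bil vectO vectA vectO]
   linear_push[OF dif_lin vectA vectO] linear_push[OF rco_lin vectO vect_tensor]
lemmas [additive] = bilinear_additive[OF lmul_bil vectA vectO vectO] bilinear_additive[OF rmul_bil vectO vectA vectO]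
   linear_additive[OF dif_lin vectA vectO] linear_additive[OF rco_lin vectO vect_tensor]

lemma lmul_assoc [push]: "a \<in> carr A \<Longrightarrow> b \<in> carr A \<Longrightarrow> w \<in> carr \<Omega> \<Longrightarrow> lmul \<Omega> a (lmul \<Omega> b w) = lmul \<Omega> (amul A a b) w"
  and lmul_one [push]: "w \<in> carr \<Omega> \<Longrightarrow> lmul \<Omega> (aone A) w = w"
  and rmul_dif: "a \<in> carr A \<Longrightarrow> b \<in> carr A \<Longrightarrow> rmul \<Omega> (dif \<Omega> a) b = dif \<Omega> (amul A a b) - lmul \<Omega> a (dif \<Omega> b)"
  and lmul_rmul: "a \<in> carr A \<Longrightarrow> b \<in> carr A \<Longrightarrow> w \<in> carr \<Omega> \<Longrightarrow> rmul \<Omega> (lmul \<Omega> a w) b = lmul \<Omega> a (rmul \<Omega> w b)"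
  using fodcA by (simp_all add: fodc_def left_module_def)

lemma rco_dif: "a \<in> carr A \<Longrightarrow> rcoact \<Omega> (dif \<Omega> a) = tsum A H (coact A a) (\<lambda>a0 a1. ptensor \<Omega> H (dif \<Omega> a0) a1)"
proof -
  assume a [simp]: "a \<in> carr A"
  note [simp] = tw push A_sw[where U="tensor \<Omega> H"]
  note [cong] = sw_cong
  have "rcoact \<Omega> (lmul \<Omega> (aone A) (dif \<Omega> a)) = tsum A H (coact A a) (\<lambda>a0 a1. ptensor \<Omega> H (dif \<Omega> a0) a1)"
    by (simp del: lmul_one, simp)
  then show ?thesis by simp
qed

lemma covariant: "right_covariant_fodc H A \<Omega>"
proof -
  note [simp del] = minus_apply plus_fun_apply zero_fun_apply
  let ?U = "tensor \<Omega> H"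
  note [simp] = tw push
  note [cong] = sw_cong
  have com: "right_comodule H \<Omega> (rcoact \<Omega>)"
    unfolding right_comodule_def cop_def
  proof (intro conjI ballI vectO rco_lin)
    fix w assume w [simp]: "w \<in> carr \<Omega>"
    let ?V = "tensor \<Omega> (tensor H H)"
    let ?F = "\<lambda>w. tsum \<Omega> H (rcoact \<Omega> w) (\<lambda>v0 h. tsum \<Omega> H (rcoact \<Omega> v0) (\<lambda>x y. ptensor \<Omega> (tensor H H) x (ptensor H H y h)))"
    let ?G = "\<lambda>w. tsum \<Omega> H (rcoact \<Omega> w) (\<lambda>v0 h. sw h (\<lambda>h1 h2. ptensor \<Omega> (tensor H H) v0 (ptensor H H h1 h2)))"
    show "?F w = ?G w"
    proof (rule fodc_eqI[OF fodcA, where F="?F" and G="?G" and U="?V"])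
      show "linear_on \<Omega> ?V ?F" "linear_on \<Omega> ?V ?G" by simp_all
      fix x y assume [simp]: "x \<in> carr A" "y \<in> carr A"
      show "?F (lmul \<Omega> x (dif \<Omega> y)) = ?G (lmul \<Omega> x (dif \<Omega> y))"
        by (simp add: A_sw[where U="?V"] srtA)
    qed (rule w)
    show "tsum \<Omega> H (rcoact \<Omega> w) (\<lambda>v0 h. scl \<Omega> (counit H h) v0) = w"
      by (rule fodc_eqI[OF fodcA _ _ _ w, where U=\<Omega>]) (simp_all add: A_sw[where U="\<Omega>"] srtA)
  qed
  have lm: "rcoact \<Omega> (lmul \<Omega> a w) = tsum A H (coact A a) (\<lambda>a0 a1. tsum \<Omega> H (rcoact \<Omega> w)
            (\<lambda>w0 w1. ptensor \<Omega> H (lmul \<Omega> a0 w0) (amul H a1 w1)))"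
    if [simp]: "a \<in> carr A" "w \<in> carr \<Omega>" for a w
    by (rule fodc_eqI[OF fodcA _ _ _ that(2), where U="?U"]) (simp_all add: A_sw[where U="?U"] srtA)
  have rm: "rcoact \<Omega> (rmul \<Omega> w a) = tsum \<Omega> H (rcoact \<Omega> w) (\<lambda>w0 w1. tsum A H (coact A a)
            (\<lambda>a0 a1. ptensor \<Omega> H (rmul \<Omega> w0 a0) (amul H w1 a1)))"
    if [simp]: "a \<in> carr A" "w \<in> carr \<Omega>" for a w
    by (rule fodc_eqI[OF fodcA _ _ _ that(2), where U="?U"])
      (simp_all add: A_sw[where U="?U"] srtA lmul_rmul rmul_dif additive)
  show ?thesis
    unfolding right_covariant_fodc_def using fodcA com lm rm rco_dif by blast
qed

end

section \<open>The crossed product algebra\<close>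

context twisted begin

text \<open>
  The regular instance \<open>M = B\<close>, \<open>N = H\<close>, for which both actions on \<open>M \<otimes> N\<close> are the product of \<open>B #\<^sub>\<sigma> H\<close>.
\<close>

lemma crossed_regular:
  "crossed H B act \<sigma> \<sigma>i H (amul H) (comul H) (amul H) (comul H) B (amul B) (amul B) act"
proof (unfold_locales)
  note [simp] = tw push
  note [cong] = sw_cong
  show "left_module H H (amul H)" "right_module H H (amul H)"
    unfolding left_module_def right_module_def using mulH vectH by simp_all
  show "left_module B B (amul B)" "right_module B B (amul B)"
    unfolding left_module_def right_module_def using mulB vectB by simp_all
  show "left_comodule H H (comul H)" "right_comodule H H (comul H)"
    unfolding left_comodule_def right_comodule_def cop_def
    using comulH vectH by (simp_all add: hopf_sw[where U="tensor H (tensor H H)"] hopf_sw[where U=H])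
  show "sw n (\<lambda>g h. sw g (\<lambda>x y. ptensor H (tensor H H) x (ptensor H H y h))) =
    sw n (\<lambda>x g. sw g (\<lambda>y h. ptensor H (tensor H H) x (ptensor H H y h)))"
    if "n \<in> carr H" for n using that by (simp add: hopf_sw[where U="tensor H (tensor H H)"])
  show "comul H (amul H n h) = sw n (\<lambda>k n0. sw h (\<lambda>h1 h2. ptensor H H (amul H k h1) (amul H n0 h2)))"
    if "h \<in> carr H" "n \<in> carr H" for h n using that by simp
qed (use tw push actB act_twist in simp_all)

abbreviation "A \<equiv> crossed_product H B act \<sigma>"

lemma A_simps [simp]: "carr A = carr BH" "scl A = scl BH" "amul A = mulA" "aone A = ptensor B H (aone B) (aone
    H)" "coact A = coA"
  by (simp_all add: crossed_product_def mulA_def coA_def cop3_def cop_def fun_eq_iff)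

lemma A_tensor [simp]: "tensor A X = tensor BH X" "tensor X A = tensor X BH" "ptensor A X = ptensor BH X"
  "ptensor X A = ptensor X BH" "tsum A X = tsum BH X" "tsum X A = tsum X BH" "tsum A A = tsum BH BH"
  by (rule tensor_cong; simp)+

lemma A_linear [simp]: "linear_on A U f = linear_on BH U f" "linear_on U A f' = linear_on U BH f'"
  by (simp_all add: linear_on_def)

lemma A_bilinear [simp]: "bilinear_on A U V f = bilinear_on BH U V f" "bilinear_on U A V f' = bilinear_on U BH V f'"
  "bilinear_on U V A f'' = bilinear_on U V BH f''"
  by (simp_all add: bilinear_on_def)

lemma vect_A: "vect A"
  using vect_tensor[of B H] by (simp add: vect_def)

lemma A_comodule_algebra: "right_comodule_algebra H A"
proof -
  interpret BB: crossed H B act \<sigma> \<sigma>i H "amul H" "comul H" "amul H" "comul H" B "amul B" "amul B" act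
    by (rule crossed_regular)
  have g: "BB.gl = mulA" "BB.gr = mulA" "BB.co = coA"
    by (simp_all add: BB.gl_def BB.gr_def BB.co_def mulA_def coA_def fun_eq_iff)
  have "ptensor B H (aone B) (aone H) \<in> carr BH" by (simp add: tw)
  then have "algebra A"
    using BB.gl_mul BB.gl_one BB.gr_one mulA_bil vect_A by (simp add: algebra_def g)
  moreover have "right_comodule H A coA"
    using BB.co_comodule vect_A by (simp add: right_comodule_def g)
  moreover have "coA (ptensor B H (aone B) (aone H)) = ptensor BH H (ptensor B H (aone B) (aone H)) (aone H)"
    by (simp add: coA_def tw push hopf_sw[where U="tensor BH H"] cong: sw_cong)
  ultimately show ?thesis
    using BB.co_gl by (simp add: right_comodule_algebra_def g)
qed

end

section \<open>The crossed product calculus\<close>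

lemma tsum_pair: "tsum V W t (\<lambda>v w. (f v w, g v w)) = (tsum V W t f, tsum V W t g)"
proof -
  have "(\<Sum>(v, w)\<leftarrow>xs. (f v w, g v w)) = ((\<Sum>(v, w)\<leftarrow>xs. f v w), (\<Sum>(v, w)\<leftarrow>xs. g v w))" for xs
    by (induction xs) (auto simp: zero_prod_def)
  then show ?thesis by (simp add: tsum_trep)
qed

lemma vect_direct_sum [tw]: "vect V \<Longrightarrow> vect W \<Longrightarrow> vect (direct_sum V W)"
proof (rule vectI)
  assume v: "vect V" "vect W"
  interpret V: vector_space "scl V" using v by (simp add: vect_vs)
  interpret W: vector_space "scl W" using v by (simp add: vect_vs)
  show "vector_space (scl (direct_sum V W))"
    by unfold_locales (auto simp: direct_sum_def V.scale_right_distrib V.scale_left_distrib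
      W.scale_right_distrib W.scale_left_distrib)
qed (auto simp: direct_sum_def vect_zero vect_add vect_scl zero_prod_def)

lemma direct_sum_simps: "carr (direct_sum V W) = carr V \<times> carr W" "scl (direct_sum V W) c (v, w) = (scl V c v, scl W c w)"
  by (simp_all add: direct_sum_def)

lemma linear_on_pair [tw]:
  "linear_on Z V f \<Longrightarrow> linear_on Z W g \<Longrightarrow> linear_on Z (direct_sum V W) (\<lambda>z. (f z, g z))"
  by (auto simp: linear_on_def direct_sum_simps)

lemma pair_in [tw]: "v \<in> carr V \<Longrightarrow> w \<in> carr W \<Longrightarrow> (v, w) \<in> carr (direct_sum V W)"
  by (simp add: direct_sum_simps)

lemma self_comodalg_simps [simp]:
  "carr (self_comodalg H) = carr H" "scl (self_comodalg H) = scl H" "amul (self_comodalg H) = amul H"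
  "aone (self_comodalg H) = aone H" "coact (self_comodalg H) = comul H"
  by (simp_all add: self_comodalg_def)

lemma self_comodalg_tensor [simp]: "tensor (self_comodalg H) X = tensor H X" "ptensor (self_comodalg H) X = ptensor H X"
  "tsum (self_comodalg H) X = tsum H X"
  by (rule tensor_cong; simp)+

lemma self_comodalg_linear [simp]: "linear_on (self_comodalg H) U f = linear_on H U f"
  "bilinear_on (self_comodalg H) U V g = bilinear_on H U V g" "bilinear_on U (self_comodalg H) V g' = bilinear_on U H V g'"
  by (simp_all add: linear_on_def bilinear_on_def)

locale twisted_fodc = twisted H B act \<sigma> \<sigma>i
  for H :: "('h::ab_group_add, 'k::field, 'z) hopf_scheme" and B :: "('b::ab_group_add, 'k, 'y) alg_scheme"
    and act :: "'h \<Rightarrow> 'b \<Rightarrow> 'b" and \<sigma> \<sigma>i :: "'h \<Rightarrow> 'h \<Rightarrow> 'b" +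
  fixes \<Omega> :: "('o::ab_group_add, 'k, 'b, 'x) calc_scheme" and wact :: "'h \<Rightarrow> 'o \<Rightarrow> 'o"
  assumes tw_fodc: "twisted_module_fodc H B act \<sigma> \<Omega> wact"
begin

lemma fodcB: "fodc B \<Omega>" and wact_bil: "bilinear_on H \<Omega> \<Omega> wact"
  using tw_fodc by (simp_all add: twisted_module_fodc_def)

lemma vectO [tw]: "vect \<Omega>" and lO_bil: "bilinear_on B \<Omega> \<Omega> (lmul \<Omega>)" and rO_bil: "bilinear_on \<Omega> B \<Omega> (rmul \<Omega>)"
  and difB_lin: "linear_on B \<Omega> (dif \<Omega>)"
  using fodcB by (simp_all add: fodc_def left_module_def right_module_def)

lemmas [tw] = bilinear_rules[OF lO_bil vectB vectO vectO] bilinear_rules[OF rO_bil vectO vectB vectO]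
   bilinear_rules[OF wact_bil vectH vectO vectO] linear_rules[OF difB_lin vectB vectO]
lemmas [push] = bilinear_push[OF lO_bil vectB vectO vectO] bilinear_push[OF rO_bil vectO vectB vectO]
   bilinear_push[OF wact_bil vectH vectO vectO] linear_push[OF difB_lin vectB vectO]
lemmas [additive] = bilinear_additive[OF lO_bil vectB vectO vectO] bilinear_additive[OF rO_bil vectO vectB vectO]
   bilinear_additive[OF wact_bil vectH vectO vectO] linear_additive[OF difB_lin vectB vectO]

lemma lO_assoc: "a \<in> carr B \<Longrightarrow> b \<in> carr B \<Longrightarrow> w \<in> carr \<Omega> \<Longrightarrow> lmul \<Omega> a (lmul \<Omega> b w) = lmul \<Omega> (amul B a b) w"
  and lO_one: "w \<in> carr \<Omega> \<Longrightarrow> lmul \<Omega> (aone B) w = w"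
  and difB_mul: "a \<in> carr B \<Longrightarrow> b \<in> carr B \<Longrightarrow> dif \<Omega> (amul B a b) = rmul \<Omega> (dif \<Omega> a) b + lmul \<Omega> a (dif \<Omega> b)"
  and rO_dif: "a \<in> carr B \<Longrightarrow> b \<in> carr B \<Longrightarrow> rmul \<Omega> (dif \<Omega> a) b = dif \<Omega> (amul B a b) - lmul \<Omega> a (dif \<Omega> b)"
  and lO_rO: "a \<in> carr B \<Longrightarrow> b \<in> carr B \<Longrightarrow> w \<in> carr \<Omega> \<Longrightarrow> rmul \<Omega> (lmul \<Omega> a w) b = lmul \<Omega> a (rmul \<Omega> w b)"
  using fodcB by (simp_all add: fodc_def left_module_def right_module_def)

lemma wact_dif: "h \<in> carr H \<Longrightarrow> b \<in> carr B \<Longrightarrow> wact h (dif \<Omega> b) = dif \<Omega> (act h b)"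
  and dif_sigma: "h \<in> carr H \<Longrightarrow> g \<in> carr H \<Longrightarrow> dif \<Omega> (\<sigma> h g) = 0"
  and wact_gen0: "h \<in> carr H \<Longrightarrow> b \<in> carr B \<Longrightarrow> c \<in> carr B \<Longrightarrow> wact h (lmul \<Omega> b (dif \<Omega> c)) =
     sw h (\<lambda>h1 h2. lmul \<Omega> (act h1 b) (wact h2 (dif \<Omega> c)))"
  using tw_fodc by (simp_all add: twisted_module_fodc_def cop_def)

lemma wact_gen: "h \<in> carr H \<Longrightarrow> b \<in> carr B \<Longrightarrow> c \<in> carr B \<Longrightarrow> wact h (lmul \<Omega> b (dif \<Omega> c)) =
     sw h (\<lambda>h1 h2. lmul \<Omega> (act h1 b) (dif \<Omega> (act h2 c)))"
  by (simp add: wact_gen0 wact_dif tw cong: sw_cong)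

text \<open>
  The conditions on the action of \<open>H\<close> on \<open>\<Omega>\<close> are only required on generators, and in one-sided form.
  The right-handed versions follow from the Leibniz rule, and the twisted module identity
  follows by differentiating the one of \<open>B\<close>.
\<close>

lemma crossed_hor:
  "crossed H B act \<sigma> \<sigma>i H (amul H) (comul H) (amul H) (comul H) \<Omega> (lmul \<Omega>) (rmul \<Omega>) wact"
proof -
  interpret BB: crossed H B act \<sigma> \<sigma>i H "amul H" "comul H" "amul H" "comul H" B "amul B" "amul B" act
    by (rule crossed_regular)
  note [simp] = tw push wact_gen wact_dif lO_assoc lO_one dif_sigma hopf_sw[where U=\<Omega>] srt
  note [simp del] = minus_apply plus_fun_apply zero_fun_apply
  note [cong] = sw_cong
  show ?thesis
  proof unfold_locales
    show "left_module B \<Omega> (lmul \<Omega>)" "right_module B \<Omega> (rmul \<Omega>)" using fodcB by (simp_all add: fodc_def)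
    show "bilinear_on H \<Omega> \<Omega> wact" by (rule wact_bil)
    show "wact (aone H) m = m" if "m \<in> carr \<Omega>" for m
      by (rule fodc_eqI[OF fodcB _ _ _ that, where U=\<Omega>]) simp_all
    show "wact h (lmul \<Omega> b m) = sw h (\<lambda>h1 h2. lmul \<Omega> (act h1 b) (wact h2 m))"
      if [simp]: "h \<in> carr H" "m \<in> carr \<Omega>" "b \<in> carr B" for h m b
      by (rule fodc_eqI[OF fodcB _ _ _ that(2), where U=\<Omega>]) simp_all
    show "wact h (rmul \<Omega> m b) = sw h (\<lambda>h1 h2. rmul \<Omega> (wact h1 m) (act h2 b))"
      if [simp]: "h \<in> carr H" "m \<in> carr \<Omega>" "b \<in> carr B" for h m b
      by (rule fodc_eqI[OF fodcB _ _ _ that(2), where U=\<Omega>]) (simp_all add: lO_rO rO_dif additive)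
    show "sw h (\<lambda>h1 h2. sw g (\<lambda>g1 g2. rmul \<Omega> (wact h1 (wact g1 m)) (\<sigma> h2 g2))) =
      sw h (\<lambda>h1 h2. sw g (\<lambda>g1 g2. lmul \<Omega> (\<sigma> h1 g1) (wact (amul H h2 g2) m)))"
      if [simp]: "h \<in> carr H" "g \<in> carr H" "m \<in> carr \<Omega>" for h g m
    proof (rule fodc_eqI[OF fodcB _ _ _ that(3), where U=\<Omega>])
      \<comment> \<open>Differentiate the identity for elements of B: the terms with d of sigma vanish.\<close>
      have dtw: "sw h (\<lambda>h1 h2. sw g (\<lambda>g1 g2. rmul \<Omega> (dif \<Omega> (act h1 (act g1 c))) (\<sigma> h2 g2))) =
        sw h (\<lambda>h1 h2. sw g (\<lambda>g1 g2. lmul \<Omega> (\<sigma> h1 g1) (dif \<Omega> (act (amul H h2 g2) c))))"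
        if [simp]: "h \<in> carr H" "g \<in> carr H" "c \<in> carr B" for h g c
        using act_twist[OF that, THEN arg_cong, of "dif \<Omega>"] by (simp del: srt add: difB_mul additive)
      let ?D = "\<lambda>h g c. sw h (\<lambda>h1 h2. sw g (\<lambda>g1 g2. rmul \<Omega> (dif \<Omega> (act h1 (act g1 c))) (\<sigma> h2 g2)))"
      let ?T = "\<lambda>h g b. sw h (\<lambda>h1 h2. sw g (\<lambda>g1 g2. amul B (act h1 (act g1 b)) (\<sigma> h2 g2)))"
      fix b c assume [simp]: "b \<in> carr B" "c \<in> carr B"
      have "sw h (\<lambda>h1 h2. sw g (\<lambda>g1 g2. rmul \<Omega> (wact h1 (wact g1 (lmul \<Omega> b (dif \<Omega> c)))) (\<sigma> h2 g2))) =
        sw h (\<lambda>h1 p. sw g (\<lambda>g1 q. lmul \<Omega> (act h1 (act g1 b)) (?D p q c)))"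
        by (simp add: lO_rO)
      also have "\<dots> = sw h (\<lambda>p h3. sw g (\<lambda>q g3. lmul \<Omega> (?T p q b) (dif \<Omega> (act (amul H h3 g3) c))))"
        by (simp add: dtw)
      also have "\<dots> = sw h (\<lambda>h1 h2. sw g (\<lambda>g1 g2. lmul \<Omega> (\<sigma> h1 g1) (wact (amul H h2 g2) (lmul \<Omega> b (dif \<Omega> c)))))"
        by (simp add: act_twist)
      finally show "sw h (\<lambda>h1 h2. sw g (\<lambda>g1 g2. rmul \<Omega> (wact h1 (wact g1 (lmul \<Omega> b (dif \<Omega> c)))) (\<sigma> h2 g2))) =
       sw h (\<lambda>h1 h2. sw g (\<lambda>g1 g2. lmul \<Omega> (\<sigma> h1 g1) (wact (amul H h2 g2) (lmul \<Omega> b (dif \<Omega> c)))))" .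
    qed simp_all
  qed (use lO_rO in simp_all)
qed

end

locale crossed_calculus = twisted_fodc H B act \<sigma> \<sigma>i \<Omega> wact
  for H :: "('h::ab_group_add, 'k::field, 'z) hopf_scheme" and B :: "('b::ab_group_add, 'k, 'y) alg_scheme"
    and act :: "'h \<Rightarrow> 'b \<Rightarrow> 'b" and \<sigma> \<sigma>i :: "'h \<Rightarrow> 'h \<Rightarrow> 'b"
    and \<Omega> :: "('o::ab_group_add, 'k, 'b, 'x) calc_scheme" and wact :: "'h \<Rightarrow> 'o \<Rightarrow> 'o" +
  fixes \<Gamma> :: "('g::ab_group_add, 'k, 'h, 'h, 'w) bicalc_scheme"
  assumes bicov: "bicovariant_fodc H \<Gamma>"
begin

lemma fodcH: "fodc H \<Gamma>"
  using bicov by (simp add: bicovariant_fodc_def right_covariant_fodc_def fodc_def left_module_def right_module_def)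

lemma crossed_ver:
  "crossed H B act \<sigma> \<sigma>i \<Gamma> (lmul \<Gamma>) (lcoact \<Gamma>) (rmul \<Gamma>) (rcoact \<Gamma>) B (amul B) (amul B) act"
proof -
  interpret BB: crossed H B act \<sigma> \<sigma>i H "amul H" "comul H" "amul H" "comul H" B "amul B" "amul B" act
    by (rule crossed_regular)
  show ?thesis
  proof unfold_locales
    show "left_module H \<Gamma> (lmul \<Gamma>)" "right_module H \<Gamma> (rmul \<Gamma>)"
      using fodcH by (simp_all add: fodc_def)
  qed (use fodcH bicov BB.M_left BB.M_right BB.aM_bil BB.aM_twist act_unit act_mul mulB_assoc
    in \<open>simp_all add: bicovariant_fodc_def right_covariant_fodc_def cop_def fodc_def\<close>)
qed

sublocale hor: crossed H B act \<sigma> \<sigma>i H "amul H" "comul H" "amul H" "comul H" \<Omega> "lmul \<Omega>" "rmul \<Omega>" wact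
  by (rule crossed_hor)

sublocale ver: crossed H B act \<sigma> \<sigma>i \<Gamma> "lmul \<Gamma>" "lcoact \<Gamma>" "rmul \<Gamma>" "rcoact \<Gamma>" B "amul B" "amul B" act
  by (rule crossed_ver)

sublocale A: comodule_algebra H A
  by unfold_locales (rule A_comodule_algebra)

lemma difH_lin: "linear_on H \<Gamma> (dif \<Gamma>)"
  using fodcH by (simp_all add: fodc_def left_module_def right_module_def)
lemmas [tw] = linear_rules[OF difH_lin vectH ver.vectN]
lemmas [push] = linear_push[OF difH_lin vectH ver.vectN]
lemmas [additive] = linear_additive[OF difH_lin vectH ver.vectN]

lemma difH_mul: "a \<in> carr H \<Longrightarrow> b \<in> carr H \<Longrightarrow> dif \<Gamma> (amul H a b) = rmul \<Gamma> (dif \<Gamma> a) b + lmul \<Gamma> a (dif \<Gamma> b)"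
  using fodcH by (simp_all add: fodc_def)

lemma lco_dif [push]: "h \<in> carr H \<Longrightarrow> lcoact \<Gamma> (dif \<Gamma> h) = sw h (\<lambda>h1 h2. ptensor H \<Gamma> h1 (dif \<Gamma> h2))"
  and rco_dif [push]: "h \<in> carr H \<Longrightarrow> rcoact \<Gamma> (dif \<Gamma> h) = sw h (\<lambda>h1 h2. ptensor \<Gamma> H (dif \<Gamma> h1) h2)"
  using bicov by (simp_all add: bicovariant_fodc_def right_covariant_fodc_def cop_def)

lemma difH_one [push]: "dif \<Gamma> (aone H) = 0" and difB_one [push]: "dif \<Omega> (aone B) = 0"
  using fodc_one[OF fodcH algH] fodc_one[OF fodcB algB] by auto

abbreviation "T1 \<equiv> tensor \<Omega> H"
abbreviation "T2 \<equiv> tensor B \<Gamma>"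
abbreviation "\<Omega>A \<equiv> crossed_calc H B act \<sigma> \<Omega> wact \<Gamma>"
abbreviation "D \<equiv> direct_sum T1 T2"

definition dH where "dH x = tsum B H x (\<lambda>b h. ptensor \<Omega> H (dif \<Omega> b) h)"
definition dV where "dV x = tsum B H x (\<lambda>b h. ptensor B \<Gamma> b (dif \<Gamma> h))"
text \<open>
  The inclusions of the two summands, tensored with \<open>H\<close>; the coaction of the calculus is assembled from them.
\<close>

definition injH where "injH u = tsum T1 H u (\<lambda>s h. ptensor D H (s, 0) h)"
definition injV where "injV u = tsum T2 H u (\<lambda>t h. ptensor D H (0, t) h)"

lemma dH_lin: "linear_on BH T1 dH" and dV_lin: "linear_on BH T2 dV"
  and injH_lin: "linear_on (tensor T1 H) (tensor D H) injH" and injV_lin: "linear_on (tensor T2 H) (tensor D H) injV"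
proof -
  note [simp] = tw push
  show "linear_on BH T1 dH" unfolding dH_def by simp
  show "linear_on BH T2 dV" unfolding dV_def by simp
  show "linear_on (tensor T1 H) (tensor D H) injH" unfolding injH_def by simp
  show "linear_on (tensor T2 H) (tensor D H) injV" unfolding injV_def by simp
qed

lemmas [tw] = linear_rules[OF dH_lin vect_tensor vect_tensor] linear_rules[OF dV_lin vect_tensor vect_tensor]
  linear_rules[OF injH_lin vect_tensor vect_tensor] linear_rules[OF injV_lin vect_tensor vect_tensor]
lemmas [push] = linear_push[OF dH_lin vect_tensor vect_tensor] linear_push[OF dV_lin vect_tensor vect_tensor]
  linear_push[OF injH_lin vect_tensor vect_tensor] linear_push[OF injV_lin vect_tensor vect_tensor]
lemmas [additive] = linear_additive[OF dH_lin vect_tensor vect_tensor] linear_additive[OF dV_lin vect_tensor vect_tensor]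
  linear_additive[OF injH_lin vect_tensor vect_tensor] linear_additive[OF injV_lin vect_tensor vect_tensor]
  bilinear_additive[OF hor.gl_bil vect_tensor vect_tensor vect_tensor] bilinear_additive[OF hor.gr_bil
      vect_tensor vect_tensor vect_tensor]
  bilinear_additive[OF ver.gl_bil vect_tensor vect_tensor vect_tensor] bilinear_additive[OF ver.gr_bil
      vect_tensor vect_tensor vect_tensor]
  bilinear_additive[OF ver.lN_bil vectH ver.vectN ver.vectN] bilinear_additive[OF ver.rN_bil ver.vectN vectH ver.vectN]

lemma calc_simps [simp]: "carr \<Omega>A = carr D" "scl \<Omega>A = scl D"
  "lmul \<Omega>A x (s, t) = (hor.gl x s, ver.gl x t)" "rmul \<Omega>A (s, t) x = (hor.gr s x, ver.gr t x)"
  "dif \<Omega>A x = (dH x, dV x)"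
  by (simp_all add: crossed_calc_def Let_def hor.gl_def ver.gl_def crossed_lmul_hor_def crossed_lmul_ver_def
    cop3_def cop_def hor.gr_def ver.gr_def dH_def dV_def tsum_pair)

lemma calc_rcoact: assumes "s \<in> carr T1" "t \<in> carr T2"
  shows "rcoact \<Omega>A (s, t) = injH (hor.co s) + injV (ver.co t)"
proof -
  have "tsum \<Omega> H s (\<lambda>\<beta> h. cop H h (\<lambda>h1 h2. ptensor D H (ptensor \<Omega> H \<beta> h1, 0) h2)) = injH (hor.co s)"
    using assms by (simp add: injH_def hor.co_def tw cop_def tsum_rules[where U="tensor D H"] cong: sw_cong)
  moreover have "tsum B \<Gamma> t (\<lambda>b \<gamma>. tsum \<Gamma> H (rcoact \<Gamma> \<gamma>) (\<lambda>\<gamma>0 \<gamma>1. ptensor D H (0, ptensor B \<Gamma> b \<gamma>0) \<gamma>1)) = injV (ver.co t)"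
    using assms by (simp add: injV_def ver.co_def tw tsum_rules[where U="tensor D H"] cong: sw_cong)
  ultimately show ?thesis by (simp add: crossed_calc_def Let_def)
qed

text \<open>
  The Leibniz rule of \<open>\<Omega>\<close> expands \<open>d(b (h\<^sub>1 \<cdot> c) \<sigma>(h\<^sub>2, g\<^sub>1))\<close> into three terms.  The third vanishes
  because \<open>d \<circ> \<sigma> = 0\<close>, the first belongs to \<open>d(x) y\<close> and the second to \<open>x d(y)\<close>.
\<close>

lemma leibniz_hor:
  assumes xy: "x \<in> carr BH" "y \<in> carr BH"
  shows "dH (mulA x y) = hor.gr (dH x) y + hor.gl x (dH y)"
proof -
  note [simp] = tw push hopf_sw[where U=T1] hopf_sw[where U=BH] srt
  note [cong] = sw_cong
  note [simp del] = minus_apply plus_fun_apply zero_fun_apply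
  show ?thesis
  proof (rule tensor_eqI[OF _ _ _ _ xy(1), where U=T1])
    fix b h assume 1 [simp]: "b \<in> carr B" "h \<in> carr H"
    show "dH (mulA (ptensor B H b h) y) = hor.gr (dH (ptensor B H b h)) y + hor.gl (ptensor B H b h) (dH y)"
    proof (rule tensor_eqI[OF _ _ _ _ xy(2), where U=T1])
      fix c g assume 2 [simp]: "c \<in> carr B" "g \<in> carr H"
      show "dH (mulA (ptensor B H b h) (ptensor B H c g)) = hor.gr (dH (ptensor B H b h)) (ptensor B H c g) +
          hor.gl (ptensor B H b h) (dH (ptensor B H c g))"
        by (simp add: dH_def mulA_def hor.gr_def hor.gl_def additive difB_mul dif_sigma wact_dif)
    qed (use xy in simp_all)
  qed (use xy in simp_all)
qed

lemma leibniz_ver: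
  assumes xy: "x \<in> carr BH" "y \<in> carr BH"
  shows "dV (mulA x y) = ver.gr (dV x) y + ver.gl x (dV y)"
proof -
  note [simp] = tw push hopf_sw[where U=T2] ver.N_coassoc[where U=T2] ver.R_coassoc[where U=T2]
      ver.R_bicom[where U=T2] hopf_sw[where U=BH] ver.srtR
  note [cong] = sw_cong
  note [simp del] = minus_apply plus_fun_apply zero_fun_apply
  show ?thesis
  proof (rule tensor_eqI[OF _ _ _ _ xy(1), where U=T2])
    fix b h assume 1 [simp]: "b \<in> carr B" "h \<in> carr H"
    show "dV (mulA (ptensor B H b h) y) = ver.gr (dV (ptensor B H b h)) y + ver.gl (ptensor B H b h) (dV y)"
    proof (rule tensor_eqI[OF _ _ _ _ xy(2), where U=T2])
      fix c g assume 2 [simp]: "c \<in> carr B" "g \<in> carr H"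
      show "dV (mulA (ptensor B H b h) (ptensor B H c g)) = ver.gr (dV (ptensor B H b h)) (ptensor B H c g) +
          ver.gl (ptensor B H b h) (dV (ptensor B H c g))"
        by (simp add: dV_def mulA_def ver.gr_def ver.gl_def additive difH_mul)
    qed (use xy in simp_all)
  qed (use xy in simp_all)
qed

end

context twisted begin

lemma mulA_assoc': "x \<in> carr BH \<Longrightarrow> y \<in> carr BH \<Longrightarrow> z \<in> carr BH \<Longrightarrow> mulA (mulA x y) z = mulA x (mulA y z)"
  and mulA_one': "x \<in> carr BH \<Longrightarrow> mulA (ptensor B H (aone B) (aone H)) x = x"
    "x \<in> carr BH \<Longrightarrow> mulA x (ptensor B H (aone B) (aone H)) = x"
  using A_comodule_algebra by (simp_all add: right_comodule_algebra_def algebra_def)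

end

context crossed_calculus begin

lemma calc_tensor [simp]: "tensor \<Omega>A X = tensor D X" "tensor X \<Omega>A = tensor X D" "ptensor \<Omega>A X = ptensor D X"
  "ptensor X \<Omega>A = ptensor X D" "tsum \<Omega>A X = tsum D X" "tsum X \<Omega>A = tsum X D"
  by (rule tensor_cong; simp)+

lemma calc_linear [simp]: "linear_on \<Omega>A U f = linear_on D U f" "linear_on U \<Omega>A f' = linear_on U D f'"
  by (simp_all add: linear_on_def)

lemma calc_bilinear [simp]: "bilinear_on \<Omega>A U V f = bilinear_on D U V f" "bilinear_on U \<Omega>A V f' = bilinear_on U D V f'"
  "bilinear_on U V \<Omega>A f'' = bilinear_on U V D f''"
  by (simp_all add: bilinear_on_def)

lemma vect_calc: "vect \<Omega>A"
  using vect_direct_sum[OF vect_tensor vect_tensor, of \<Omega> H B \<Gamma>] by (simp add: vect_def)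

lemma lmul_calc_bil: "bilinear_on BH D D (lmul \<Omega>A)" and rmul_calc_bil: "bilinear_on D BH D (rmul \<Omega>A)"
  and dif_calc_lin: "linear_on BH D (dif \<Omega>A)"
proof -
  note [simp] = tw push additive direct_sum_simps
  note [simp del] = minus_apply plus_fun_apply zero_fun_apply
  show "bilinear_on BH D D (lmul \<Omega>A)"
    by (intro bilinear_onI linear_onI; clarsimp)
  show "bilinear_on D BH D (rmul \<Omega>A)"
    by (intro bilinear_onI linear_onI; clarsimp)
  show "linear_on BH D (dif \<Omega>A)"
    by (rule linear_on_cong[THEN iffD1, OF refl refl calc_simps(5)[symmetric] vect_tensor]) simp
qed

text \<open>
  The subtracted term removes the vertical component \<open>b c \<otimes> dh\<close> of the first term.
\<close>

lemma calc_gen_hor: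
  assumes [simp]: "b \<in> carr B" "c \<in> carr B" "h \<in> carr H"
  shows "(ptensor \<Omega> H (lmul \<Omega> b (dif \<Omega> c)) h, 0) =
    lmul \<Omega>A (ptensor B H b (aone H)) (dif \<Omega>A (ptensor B H c h)) -
    lmul \<Omega>A (ptensor B H (amul B b c) (aone H)) (dif \<Omega>A (ptensor B H (aone B) h))"
proof -
  note [simp] = tw push additive hopf_sw[where U=T1] hopf_sw[where U=T2] ver.N_coassoc[where U=T2] lO_rO
    tsum_zero_arg[where U=T1]
  note [simp del] = minus_apply plus_fun_apply zero_fun_apply
  note [cong] = sw_cong
  show ?thesis by (simp add: dH_def dV_def hor.gl_def ver.gl_def zero_prod_def)
qed

text \<open>
  The left action of \<open>b # g\<close> on \<open>1 \<otimes> dh\<close> produces a factor \<open>\<sigma>(g\<^sub>1, h\<^sub>1)\<close>, which is cancelled in advance.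
\<close>

lemma calc_gen_ver:
  assumes [simp]: "b \<in> carr B" "g \<in> carr H" "h \<in> carr H"
  shows "(0, ptensor B \<Gamma> b (lmul \<Gamma> g (dif \<Gamma> h))) =
    sw g (\<lambda>g1 g2. sw h (\<lambda>h1 h2.
      lmul \<Omega>A (ptensor B H (amul B b (\<sigma>i g1 h1)) g2) (dif \<Omega>A (ptensor B H (aone B) h2))))"
proof -
  note [simp] = tw push additive hopf_sw[where U=T1] hopf_sw[where U=T2] ver.N_coassoc[where U=T2] ver.srtR
  note [simp del] = minus_apply plus_fun_apply zero_fun_apply
  note [cong] = sw_cong
  have "sw g (\<lambda>g1 g2. sw h (\<lambda>h1 h2.
      ver.gl (ptensor B H (amul B b (\<sigma>i g1 h1)) g2) (dV (ptensor B H (aone B) h2)))) =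
    sw g (\<lambda>p g3. sw h (\<lambda>q h3. ptensor B \<Gamma> (amul B b
      (sw p (\<lambda>g1 g2. sw q (\<lambda>h1 h2. amul B (\<sigma>i g1 h1) (\<sigma> g2 h2)))))
      (lmul \<Gamma> g3 (dif \<Gamma> h3))))"
    by (simp add: dV_def ver.gl_def)
  also have "\<dots> = ptensor B \<Gamma> b (lmul \<Gamma> g (dif \<Gamma> h))"
    by (simp add: sigi_sig)
  finally show ?thesis by (simp add: tsum_pair dH_def)
qed

lemma calc_fodc: "fodc A \<Omega>A"
  unfolding fodc_def
proof (intro conjI ballI)
  note [simp] = tw direct_sum_simps
  show "left_module A \<Omega>A (lmul \<Omega>A)"
    unfolding left_module_def using vect_calc lmul_calc_bil
    by (auto simp: hor.gl_one ver.gl_one hor.gl_mul ver.gl_mul)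
  show "right_module A \<Omega>A (rmul \<Omega>A)"
    unfolding right_module_def using vect_calc rmul_calc_bil
    by (auto simp: hor.gr_one ver.gr_one hor.gr_mul ver.gr_mul)
  show "rmul \<Omega>A (lmul \<Omega>A a w) b = lmul \<Omega>A a (rmul \<Omega>A w b)"
    if "a \<in> carr A" "w \<in> carr \<Omega>A" "b \<in> carr A" for a w b
    using that by (cases w) (simp add: hor.gl_gr ver.gl_gr)
  show "linear_on A \<Omega>A (dif \<Omega>A)" using dif_calc_lin by simp
  show "dif \<Omega>A (amul A a b) = rmul \<Omega>A (dif \<Omega>A a) b + lmul \<Omega>A a (dif \<Omega>A b)"
    if "a \<in> carr A" "b \<in> carr A" for a b
    using that by (simp add: leibniz_hor leibniz_ver)
  let ?S = "{lmul \<Omega>A a (dif \<Omega>A b) |a b. a \<in> carr A \<and> b \<in> carr A}"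
  let ?K = "\<lparr> carr = vspan \<Omega>A ?S, scl = scl \<Omega>A \<rparr>"
  have K: "vect ?K" by (rule vect_span[OF vect_calc])
  have in_K: "lmul \<Omega>A a (dif \<Omega>A b) \<in> carr ?K" if "a \<in> carr BH" "b \<in> carr BH" for a b
  proof -
    have "lmul \<Omega>A a (dif \<Omega>A b) \<in> ?S" using that by (simp only: A_simps mem_Collect_eq) blast
    from span_base'[OF vect_calc this] show ?thesis by (simp only: vs.select_convs)
  qed
  show "carr \<Omega>A = vspan \<Omega>A ?S"
  proof
    show "vspan \<Omega>A ?S \<subseteq> carr \<Omega>A" by (rule span_carr[OF vect_calc]) auto
    note [simp] = linear_on_const_zero
    have hor: "(ptensor \<Omega> H w h, 0) \<in> carr ?K" if h: "h \<in> carr H" and w: "w \<in> carr \<Omega>" for w h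
    proof (rule fodc_into[OF w fodcB vectB, where U=D and f="\<lambda>w. (ptensor \<Omega> H w h, 0)", OF _ K])
      show "linear_on \<Omega> D (\<lambda>w. (ptensor \<Omega> H w h, 0))" using h by (intro linear_on_pair) simp_all
      show "(ptensor \<Omega> H (lmul \<Omega> b (dif \<Omega> c)) h, 0) \<in> carr ?K" if "b \<in> carr B" "c \<in> carr B" for b c
        unfolding calc_gen_hor[OF that h] by (intro vect_diff[OF K] in_K) (use that h in simp_all)
    qed
    have ver: "(0, ptensor B \<Gamma> b w) \<in> carr ?K" if b: "b \<in> carr B" and w: "w \<in> carr \<Gamma>" for w b
    proof (rule fodc_into[OF w fodcH vectH, where U=D and f="\<lambda>w. (0, ptensor B \<Gamma> b w)", OF _ K])
      show "linear_on \<Gamma> D (\<lambda>w. (0, ptensor B \<Gamma> b w))" using b by (intro linear_on_pair) simp_all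
      show "(0, ptensor B \<Gamma> b (lmul \<Gamma> g (dif \<Gamma> h))) \<in> carr ?K" if "g \<in> carr H" "h \<in> carr H" for g h
        unfolding calc_gen_ver[OF b that] by (intro tsum_into_subspace[OF K] in_K) (use that b in simp_all)
    qed
    have "(s, 0) \<in> carr ?K" if "s \<in> carr T1" for s
      by (rule tensor_into[OF that vectO vectH, where U=D and f="\<lambda>s. (s, 0)", OF _ K hor]) (intro linear_on_pair
          linear_on_id, simp_all)
    moreover have "(0, t) \<in> carr ?K" if "t \<in> carr T2" for t
      by (rule tensor_into[OF that vectB ver.vectN, where U=D and f="\<lambda>t. (0, t)", OF _ K ver]) (intro
          linear_on_pair linear_on_id, simp_all)
    ultimately have "(s, 0) + (0, t) \<in> carr ?K" if "s \<in> carr T1" "t \<in> carr T2" for s t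
      using that vect_add[OF K] by blast
    then have "(s, t) \<in> vspan \<Omega>A ?S" if "s \<in> carr T1" "t \<in> carr T2" for s t
      using that by (simp only: add_Pair add_0_left add_0_right vs.select_convs)
    then show "carr \<Omega>A \<subseteq> vspan \<Omega>A ?S" by (auto simp only: calc_simps(1) direct_sum_simps)
  qed
qed

lemma calc_rcoact_lin: "linear_on D (tensor D H) (rcoact \<Omega>A)"
proof -
  note [simp] = tw push additive direct_sum_simps
  note [simp del] = minus_apply plus_fun_apply zero_fun_apply
  note [simp] = linear_additive[OF hor.co_lin vect_tensor vect_tensor]
    linear_additive[OF ver.co_lin vect_tensor vect_tensor]
  show ?thesis
    by (rule linear_onI; clarsimp simp: calc_rcoact algebra_simps)
qed

lemma calc_rcoact_gen:
  assumes xy [simp]: "x \<in> carr BH" "y \<in> carr BH"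
  shows "rcoact \<Omega>A (lmul \<Omega>A x (dif \<Omega>A y)) = tsum BH H (coA x) (\<lambda>x0 x1. tsum BH H (coA y) (\<lambda>y0 y1.
     ptensor D H (lmul \<Omega>A x0 (dif \<Omega>A y0)) (amul H x1 y1)))"
proof -
  note [simp] = tw push
  note [simp del] = minus_apply plus_fun_apply zero_fun_apply
  note [cong] = sw_cong
  have H: "hor.co (dH y) = tsum BH H (coA y) (\<lambda>y0 y1. ptensor T1 H (dH y0) y1)"
    by (rule tensor_eqI[OF _ _ _ _ xy(2), where U="tensor T1 H"])
      (simp_all add: hor.co_def dH_def coA_def hopf_sw[where U="tensor T1 H"])
  have V: "ver.co (dV y) = tsum BH H (coA y) (\<lambda>y0 y1. ptensor T2 H (dV y0) y1)"
    by (rule tensor_eqI[OF _ _ _ _ xy(2), where U="tensor T2 H"])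
      (simp_all add: ver.co_def dV_def coA_def hopf_sw[where U="tensor T2 H"])
  have split: "ptensor D H (hor.gl z s, ver.gl z t) h = ptensor D H (hor.gl z s, 0) h + ptensor D H (0, ver.gl z t) h"
    if "z \<in> carr BH" "s \<in> carr T1" "t \<in> carr T2" "h \<in> carr H" for s t h z
    using bilinear_additive(1)[OF ptensor_bilinear[of D H], of "(hor.gl z s, 0)" "(0, ver.gl z t)" h] that
    by (simp add: direct_sum_simps)
  have iH: "injH (ptensor T1 H s h) = ptensor D H (s, 0) h" if [simp]: "s \<in> carr T1" "h \<in> carr H" for s h
    by (simp add: injH_def tsum_rules[where U="tensor D H"])
  have iV: "injV (ptensor T2 H s h) = ptensor D H (0, s) h" if [simp]: "s \<in> carr T2" "h \<in> carr H" for s h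
    by (simp add: injV_def tsum_rules[where U="tensor D H"])
  show ?thesis
    by (simp add: calc_rcoact hor.co_gl ver.co_gl H V iH iV split tsum_plus
      tsum_rules[where U="tensor T1 H"] tsum_rules[where U="tensor T2 H"])
qed

lemma calc_covariant: "right_covariant_fodc H A \<Omega>A"
proof -
  interpret C: comodule_fodc H A \<Omega>A
  proof unfold_locales
    show "fodc A \<Omega>A" by (rule calc_fodc)
    show "linear_on \<Omega>A (tensor \<Omega>A H) (rcoact \<Omega>A)" using calc_rcoact_lin by simp
    show "rcoact \<Omega>A (lmul \<Omega>A x (dif \<Omega>A y)) = tsum A H (coact A x) (\<lambda>x0 x1. tsum A H (coact A y)
      (\<lambda>y0 y1. ptensor \<Omega>A H (lmul \<Omega>A x0 (dif \<Omega>A y0)) (amul H x1 y1)))" if "x \<in> carr A" "y \<in> carr A" for x y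
      using calc_rcoact_gen that by (simp only: A_simps A_tensor calc_tensor)
  qed
  show ?thesis by (rule C.covariant)
qed

end

section \<open>The vertical map of the crossed product calculus\<close>

context hopf_module begin

lemma coinv_incl [tw]: "linear_on coinv N (\<lambda>x. x)"
  by (auto simp: linear_on_def coinv_def)

lemma coinv_scl [push]: "scl coinv = scl N"
  by (simp add: coinv_def)

end

context crossed_calculus begin

abbreviation "X \<equiv> left_coinv_forms H \<Gamma>"

lemma X_eq: "X = ver.coinv"
  by (simp add: left_coinv_forms_def ver.coinv_def)

text \<open>
  The isomorphism \<open>B \<otimes> \<Gamma> \<cong> B \<otimes> H \<otimes> X\<close> induced by the fundamental theorem for \<open>\<Gamma>\<close>, and its inverse.
  It is easier to see that \<open>phi\<close> is left \<open>A\<close>-linear, since coinvariant forms carry no coaction;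
  linearity of \<open>psi\<close> is then formal.
\<close>

definition psi where
  "psi t = tsum B \<Gamma> t (\<lambda>b \<gamma>. tsum H \<Gamma> (lcoact \<Gamma> \<gamma>) (\<lambda>k g. ptensor BH ver.coinv (ptensor B H b k) (ver.proj g)))"

definition phi where
  "phi u = tsum BH ver.coinv u (\<lambda>a x. tsum B H a (\<lambda>b h. ptensor B \<Gamma> b (lmul \<Gamma> h x)))"

definition lact where
  "lact a u = tsum BH ver.coinv u (\<lambda>a' x. ptensor BH ver.coinv (mulA a a') x)"

abbreviation "AX \<equiv> tensor BH ver.coinv"

lemma lact_eq: "left_act_tensor A X = lact"
  by (simp add: fun_eq_iff left_act_tensor_def lact_def X_eq)

lemma psi_lin: "linear_on T2 AX psi" and phi_lin: "linear_on AX T2 phi" and lact_bil: "bilinear_on BH AX AX lact"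
proof -
  note [simp] = tw push linear_rules[OF ver.coinv_incl ver.vect_coinv ver.vectN]
  show "linear_on T2 AX psi" unfolding psi_def by simp
  show "linear_on AX T2 phi" unfolding phi_def by simp
  show "bilinear_on BH AX AX lact" unfolding lact_def by (intro bilinear_onI) simp_all
qed

lemmas [tw] = linear_rules[OF psi_lin vect_tensor vect_tensor] linear_rules[OF phi_lin vect_tensor vect_tensor]
  bilinear_rules[OF lact_bil vect_tensor vect_tensor vect_tensor]
lemmas [push] = linear_push[OF psi_lin vect_tensor vect_tensor] linear_push[OF phi_lin vect_tensor vect_tensor]
  bilinear_push[OF lact_bil vect_tensor vect_tensor vect_tensor]

lemma phi_psi: assumes t: "t \<in> carr T2" shows "phi (psi t) = t"
proof -
  note [simp] = tw push linear_rules[OF ver.coinv_incl ver.vect_coinv ver.vectN] ver.proj_reconstruct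
  note [cong] = sw_cong
  show ?thesis
  proof (rule tensor_eqI[OF _ _ _ _ t, where U=T2])
    fix b g assume [simp]: "b \<in> carr B" "g \<in> carr \<Gamma>"
    have "phi (psi (ptensor B \<Gamma> b g)) = ptensor B \<Gamma> b (tsum H \<Gamma> (lcoact \<Gamma> g) (\<lambda>k n0. lmul \<Gamma> k (ver.proj n0)))"
      by (simp del: ver.proj_reconstruct add: psi_def phi_def tsum_rules[where U=T2] tsum_rules[where U=AX])
    then show "phi (psi (ptensor B \<Gamma> b g)) = ptensor B \<Gamma> b g" by simp
  qed simp_all
qed

lemma psi_phi: assumes u: "u \<in> carr AX" shows "psi (phi u) = u"
proof -
  note [simp] = tw push linear_rules[OF ver.coinv_incl ver.vect_coinv ver.vectN] ver.coinvD ver.proj_mult_coinv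
  note [cong] = sw_cong
  show ?thesis
  proof (rule tensor_eqI[OF _ _ _ _ u, where U=AX])
    fix a x assume a: "a \<in> carr BH" and x [simp]: "x \<in> carr ver.coinv"
    show "psi (phi (ptensor BH ver.coinv a x)) = ptensor BH ver.coinv a x"
    proof (rule tensor_eqI[OF _ _ _ _ a, where U=AX])
      fix b h assume [simp]: "b \<in> carr B" "h \<in> carr H"
      have "psi (phi (ptensor BH ver.coinv (ptensor B H b h) x)) =
        sw h (\<lambda>h1 h2. ptensor BH ver.coinv (ptensor B H b h1) (scl ver.coinv (counit H h2) x))"
        by (simp del: ver.coinv_scl add: psi_def phi_def hopf_sw[where U=AX] hopf_sw[where U=T2] ver.coinv_scl[symmetric])
      then show "psi (phi (ptensor BH ver.coinv (ptensor B H b h) x)) = ptensor BH ver.coinv (ptensor B H b h) x"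
        by (simp del: ver.coinv_scl)
    qed simp_all
  qed simp_all
qed

lemma phi_lact: assumes a: "a \<in> carr BH" and u: "u \<in> carr AX" shows "phi (lact a u) = ver.gl a (phi u)"
proof -
  note [simp] = tw push linear_rules[OF ver.coinv_incl ver.vect_coinv ver.vectN] ver.coinvD(1)
    hopf_sw[where U=T2] hopf_sw[where U=AX] ver.N_coassoc[where U=T2] ver.srtR
  note [cong] = sw_cong
  show ?thesis
  proof (rule tensor_eqI[OF _ _ _ _ a, where U=T2])
    fix b h assume 1 [simp]: "b \<in> carr B" "h \<in> carr H"
    show "phi (lact (ptensor B H b h) u) = ver.gl (ptensor B H b h) (phi u)"
    proof (rule tensor_eqI[OF _ _ _ _ u, where U=T2])
      fix a x assume a: "a \<in> carr BH" and x [simp]: "x \<in> carr ver.coinv"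
      show "phi (lact (ptensor B H b h) (ptensor BH ver.coinv a x)) = ver.gl (ptensor B H b h) (phi (ptensor BH
          ver.coinv a x))"
      proof (rule tensor_eqI[OF _ _ _ _ a, where U=T2])
        fix c g assume 1 [simp]: "c \<in> carr B" "g \<in> carr H"
        show "phi (lact (ptensor B H b h) (ptensor BH ver.coinv (ptensor B H c g) x)) =
          ver.gl (ptensor B H b h) (phi (ptensor BH ver.coinv (ptensor B H c g) x))"
          by (simp add: lact_def phi_def ver.gl_def mulA_def ver.coinvD(2)[OF x] hopf_sw[where U=BH])
      qed (use x in simp_all)
    qed simp_all
  qed (use u in simp_all)
qed

lemma psi_gl: assumes a: "a \<in> carr BH" and t: "t \<in> carr T2" shows "psi (ver.gl a t) = lact a (psi t)"
proof -
  have p: "psi t \<in> carr AX" "lact a (psi t) \<in> carr AX" using a t by (simp_all add: tw)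
  have "psi (ver.gl a t) = psi (ver.gl a (phi (psi t)))" by (simp add: phi_psi t)
  also have "\<dots> = psi (phi (lact a (psi t)))" by (simp add: phi_lact a p)
  also have "\<dots> = lact a (psi t)" by (rule psi_phi[OF p(2)])
  finally show ?thesis .
qed

definition vmap where "vmap = (\<lambda>(s, t). psi t)"

lemma vmap_lin: "linear_on D AX vmap"
  using psi_lin by (auto simp: linear_on_def vmap_def direct_sum_simps)

text \<open>
  The coaction of \<open>dh\<close> is \<open>h\<^sub>1 \<otimes> dh\<^sub>2\<close>, so \<open>psi\<close> only has to project \<open>dh\<^sub>2\<close>.
\<close>

lemma psi_dV:
  assumes a: "a \<in> carr BH"
  shows "psi (dV a) = tsum BH H (coA a) (\<lambda>a0 h. ptensor BH ver.coinv a0 (ver.proj (dif \<Gamma> h)))"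
proof -
  note [simp] = tw push
  note [cong] = sw_cong
  show ?thesis
    by (rule tensor_eqI[OF _ _ _ _ a, where U=AX])
      (simp_all add: psi_def dV_def coA_def hopf_sw[where U=AX])
qed

lemma proj_dif: "h \<in> carr H \<Longrightarrow> ver.proj (dif \<Gamma> h) = cop H h (\<lambda>h1 h2. lmul \<Gamma> (antipode H h1) (dif \<Gamma> h2))"
  by (simp add: ver.proj_def cop_def tw push hopf_sw[where U=\<Gamma>] cong: sw_cong)

lemma X_tensor: "tensor A X = AX" "ptensor A X = ptensor BH ver.coinv"
  by (simp_all add: X_eq)

lemma vmap_vertical: "vertical_map H A \<Omega>A \<Gamma> vmap"
  unfolding vertical_map_def X_tensor
proof (intro conjI ballI)
  show "linear_on \<Omega>A AX vmap" using vmap_lin by simp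
  fix a a' assume "a \<in> carr A" "a' \<in> carr A"
  then have a: "a \<in> carr BH" "a' \<in> carr BH" by simp_all
  note [simp] = tw push
  note [cong] = sw_cong
  have "vmap (lmul \<Omega>A a (dif \<Omega>A a')) = lact a (psi (dV a'))"
    using a by (simp add: vmap_def psi_gl)
  also have "\<dots> = tsum BH H (coA a') (\<lambda>a0 h. ptensor BH ver.coinv (mulA a a0) (ver.proj (dif \<Gamma> h)))"
    using a by (simp add: psi_dV) (simp add: lact_def tsum_rules[where U=AX])
  also have "\<dots> = tsum BH H (coA a') (\<lambda>a0 h. ptensor BH ver.coinv (mulA a a0) (cop H h (\<lambda>h1 h2. lmul \<Gamma> (antipode
      H h1) (dif \<Gamma> h2))))"
    using a by (intro tsum_cong) (simp_all add: proj_dif)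
  finally show "vmap (lmul \<Omega>A a (dif \<Omega>A a')) = tsum A H (coact A a') (\<lambda>a0 h. ptensor BH ver.coinv (amul A a a0)
     (cop H h (\<lambda>h1 h2. lmul \<Gamma> (antipode H h1) (dif \<Gamma> h2))))" by (simp only: A_simps A_tensor)
qed

lemma psi_zero_iff: "t \<in> carr T2 \<Longrightarrow> psi t = 0 \<longleftrightarrow> t = 0"
  using phi_psi linear_on_zero[OF phi_lin vect_tensor] linear_on_zero[OF psi_lin vect_tensor] by metis

lemma vmap_module: "left_module A AX lact" "left_module_hom A \<Omega>A (lmul \<Omega>A) AX lact vmap"
  "left_module A \<Omega>A (lmul \<Omega>A)"
proof -
  note [simp] = tw push
  note [cong] = sw_cong
  have 1: "lact (ptensor B H (aone B) (aone H)) u = u" if "u \<in> carr AX" for u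
    by (rule tensor_eqI[OF _ _ _ _ that, where U=AX]) (simp_all add: lact_def tsum_rules[where U=AX] mulA_one')
  have 2: "lact (mulA a b) u = lact a (lact b u)" if [simp]: "a \<in> carr BH" "b \<in> carr BH" and u: "u \<in> carr AX" for a b u
    by (rule tensor_eqI[OF _ _ _ _ u, where U=AX]) (simp_all add: lact_def tsum_rules[where U=AX] mulA_assoc')
  show "left_module A AX lact"
    unfolding left_module_def using lact_bil vect_tensor 1 2 by simp
  show "left_module A \<Omega>A (lmul \<Omega>A)" using calc_fodc by (simp add: fodc_def)
  show "left_module_hom A \<Omega>A (lmul \<Omega>A) AX lact vmap"
    unfolding left_module_hom_def using vmap_lin by (auto simp: vmap_def psi_gl direct_sum_simps)
qed

lemma vmap_kernel: "{n \<in> carr \<Omega>A. vmap n = 0} = carr T1 \<times> {0}"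
  using psi_zero_iff vect_zero[OF vect_tensor[of B \<Gamma>]] by (auto simp: vmap_def direct_sum_simps)

lemma vmap_surj: "vmap ` carr \<Omega>A = carr AX"
proof
  show "vmap ` carr \<Omega>A \<subseteq> carr AX" using linear_on_in[OF vmap_lin] by auto
  show "carr AX \<subseteq> vmap ` carr \<Omega>A"
  proof
    fix u assume u: "u \<in> carr AX"
    have "(0, phi u) \<in> carr \<Omega>A" using u vect_zero[OF vect_tensor[of \<Omega> H]] by (simp add: direct_sum_simps tw)
    moreover have "vmap (0, phi u) = u" by (simp add: vmap_def psi_phi u)
    ultimately show "u \<in> vmap ` carr \<Omega>A" by (intro image_eqI[OF sym])
  qed
qed

lemma crossed_exact:
  "short_exact A T1 (crossed_lmul_hor H B \<sigma> \<Omega> wact) \<Omega>A (lmul \<Omega>A)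
     (tensor A X) (left_act_tensor A X) (\<lambda>s. (s, 0)) vmap"
proof -
  have l: "crossed_lmul_hor H B \<sigma> \<Omega> wact = hor.gl"
    by (simp add: fun_eq_iff hor.gl_def crossed_lmul_hor_def cop3_def cop_def)
  have lm: "left_module A T1 hor.gl"
    unfolding left_module_def using hor.gl_bil vect_tensor hor.gl_one hor.gl_mul by simp
  have z: "ver.gl a 0 = 0" if "a \<in> carr BH" for a
    using linear_on_zero[OF bilinear_on_right[OF ver.gl_bil that] vect_tensor] .
  have hom: "left_module_hom A T1 hor.gl \<Omega>A (lmul \<Omega>A) (\<lambda>s. (s, 0))"
    unfolding left_module_hom_def using z
    by (auto simp: linear_on_def direct_sum_simps vect_zero[OF vect_tensor] scl_zero[OF vect_tensor])
  show ?thesis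
    unfolding short_exact_def l X_tensor lact_eq vmap_kernel vmap_surj
    using lm hom vmap_module by (auto simp: inj_on_def)
qed

end

section \<open>The cleaving map of a crossed product\<close>

context twisted begin

abbreviation "oneA \<equiv> ptensor B H (aone B) (aone H)"

text \<open>
  The section \<open>\<gamma>\<close> and its convolution inverse
  \<open>\<delta>(h) = \<sigma>\<^sup>-\<^sup>1(S(h\<^sub>2), h\<^sub>3) # S(h\<^sub>1)\<close>; the coproduct of \<open>S h\<close> is written without using that \<open>S\<close> reverses it.

  That \<open>\<delta>\<close> is a left inverse is a direct computation.  A direct computation of \<open>\<gamma>(h\<^sub>1) \<delta>(h\<^sub>2)\<close> would need an
  identity for \<open>h \<cdot> \<sigma>\<^sup>-\<^sup>1(g, k)\<close>.  Instead, a closed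
  formula \<open>delT a h\<close> is shown to satisfy \<open>delT (a \<gamma>(h\<^sub>1)) h\<^sub>2 = \<epsilon>(h) a\<close>.  Inserting \<open>\<delta>(h\<^sub>1) \<gamma>(h\<^sub>2) = \<epsilon>(h) 1\<close>
      into its first argument
  gives \<open>delT a h = a \<delta>(h)\<close>, so that \<open>\<delta>\<close> is a right inverse as well.
\<close>

definition gam where "gam h = ptensor B H (aone B) h"

definition del where
  "del h = sw h (\<lambda>h1 h2. sw (antipode H h1) (\<lambda>u v. ptensor B H (\<sigma>i u h2) v))"

definition delT where
  "delT a h = tsum B H a (\<lambda>b g. sw h (\<lambda>h1 h2.
     sw (amul H g (antipode H h1)) (\<lambda>u v. ptensor B H (amul B b (\<sigma>i u h2)) v)))"

lemma gam_lin: "linear_on H BH gam" and del_lin: "linear_on H BH del" and delT_bil: "bilinear_on BH H BH delT"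
proof -
  note [simp] = tw push hopf_sw[where U=BH]
  show "linear_on H BH gam" unfolding gam_def by simp
  show "linear_on H BH del" unfolding del_def by simp
  show "bilinear_on BH H BH delT" unfolding delT_def by (intro bilinear_onI) simp_all
qed

lemmas [tw] = linear_rules[OF gam_lin vectH vect_tensor] linear_rules[OF del_lin vectH vect_tensor]
  bilinear_rules[OF delT_bil vect_tensor vectH vect_tensor]
lemmas [push] = linear_push[OF gam_lin vectH vect_tensor] linear_push[OF del_lin vectH vect_tensor]
  bilinear_push[OF delT_bil vect_tensor vectH vect_tensor]

lemma del_gam:
  assumes h [simp]: "h \<in> carr H"
  shows "sw h (\<lambda>h1 h2. mulA (del h1) (gam h2)) = scl BH (counit H h) oneA"
proof -
  note [simp] = tw push hopf_sw[where U=BH] srt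
  note [cong] = sw_cong
  have "sw h (\<lambda>h1 h2. mulA (del h1) (gam h2)) =
    sw h (\<lambda>h1 r. sw (antipode H h1) (\<lambda>p v. sw r (\<lambda>q h4.
      ptensor B H (sw p (\<lambda>u1 u2. sw q (\<lambda>h2 h3. amul B (\<sigma>i u1 h2) (\<sigma> u2 h3))))
        (amul H v h4))))"
    by (simp add: del_def gam_def mulA_def)
  also have "\<dots> = ptensor B H (aone B) (sw h (\<lambda>h1 h2. amul H (antipode H h1) h2))"
    by (simp add: sigi_sig)
  also have "\<dots> = scl BH (counit H h) oneA" by (simp add: antipode_left)
  finally show ?thesis .
qed

lemma delT_gam:
  assumes a: "a \<in> carr BH" and h [simp]: "h \<in> carr H"
  shows "sw h (\<lambda>h1 h2. delT (mulA a (gam h1)) h2) = scl BH (counit H h) a"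
proof -
  note [simp] = tw push hopf_sw[where U=BH] srt
  note [cong] = sw_cong
  show ?thesis
  proof (rule tensor_eqI[OF _ _ _ _ a, where U=BH])
    fix b g assume [simp]: "b \<in> carr B" "g \<in> carr H"
    have "sw h (\<lambda>h1 h2. delT (mulA (ptensor B H b g) (gam h1)) h2) =
      sw g (\<lambda>g1 s. sw h (\<lambda>h1 r. sw r (\<lambda>q h4.
        sw (amul H s (tsum H H (comul H q) (\<lambda>h2 h3. amul H h2 (antipode H h3)))) (\<lambda>u v.
          ptensor B H (amul B b (amul B (\<sigma> g1 h1) (\<sigma>i u h4))) v))))"
      by (simp add: delT_def gam_def mulA_def)
    also have "\<dots> = sw g (\<lambda>p g3. ptensor B H (amul B b
        (sw p (\<lambda>g1 g2. sw h (\<lambda>h1 h2. amul B (\<sigma> g1 h1) (\<sigma>i g2 h2))))) g3)"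
      by (simp add: antipode_right)
    also have "\<dots> = scl BH (counit H h) (ptensor B H b g)" by (simp add: sig_sigi)
    finally show "sw h (\<lambda>h1 h2. delT (mulA (ptensor B H b g) (gam h1)) h2) =
      scl BH (counit H h) (ptensor B H b g)" .
  qed simp_all
qed

lemma delT_eq:
  assumes a [simp]: "a \<in> carr BH" and h [simp]: "h \<in> carr H"
  shows "delT a h = mulA a (del h)"
proof -
  note [simp] = tw push hopf_sw[where U=BH] srt
  note [cong] = sw_cong
  have "delT a h = sw h (\<lambda>p h3. delT (mulA a (sw p (\<lambda>h1 h2. mulA (del h1) (gam h2)))) h3)"
    by (simp add: del_gam mulA_one')
  also have "\<dots> = sw h (\<lambda>h1 q. sw q (\<lambda>h2 h3. delT (mulA (mulA a (del h1)) (gam h2)) h3))"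
    by (simp add: mulA_assoc')
  also have "\<dots> = mulA a (del h)" by (simp add: delT_gam)
  finally show ?thesis .
qed

lemma gam_del:
  assumes h [simp]: "h \<in> carr H"
  shows "sw h (\<lambda>h1 h2. mulA (gam h1) (del h2)) = scl BH (counit H h) oneA"
proof -
  note [simp] = tw
  note [cong] = sw_cong
  show ?thesis using delT_gam[of oneA h] by (simp add: mulA_one' delT_eq)
qed

lemma coA_gam: "h \<in> carr H \<Longrightarrow> coA (gam h) = sw h (\<lambda>h1 h2. ptensor BH H (gam h1) h2)"
  by (simp add: coA_def gam_def tw push hopf_sw[where U="tensor BH H"] cong: sw_cong)

lemma coA_del: "h \<in> carr H \<Longrightarrow> coA (del h) = sw h (\<lambda>h1 h2. ptensor BH H (del h2) (antipode H h1))"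
  by (simp add: coA_def del_def tw push hopf_sw[where U="tensor BH H"] hopf_sw[where U=BH] comul_antipode srt cong: sw_cong)

lemma gam_one: "gam (aone H) = oneA"
  by (simp add: gam_def)

text \<open>
  For a coinvariant \<open>a = \<Sum> b # h\<close>, apply \<open>\<epsilon>\<close> to the middle leg of \<open>b \<otimes> h\<^sub>1 \<otimes> h\<^sub>2 = b \<otimes> h \<otimes> 1\<close>.
\<close>

lemma right_coinvA: "right_coinv H A = {ptensor B H b (aone H) | b. b \<in> carr B}"
proof (rule set_eqI, rule iffI)
  note [simp] = tw push hopf_sw[where U="tensor BH H"] hopf_sw[where U=BH] srt
  fix a assume "a \<in> right_coinv H A"
  then have a: "a \<in> carr BH" "coA a = ptensor BH H a (aone H)" by (auto simp: right_coinv_def)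
  let ?G = "\<lambda>u. tsum BH H u (\<lambda>a0 h. tsum B H a0 (\<lambda>b g. scl BH (counit H g) (ptensor B H b h)))"
  let ?e = "tsum B H a (\<lambda>b g. scl B (counit H g) b)"
  have 1: "?G (coA a) = a"
    by (rule tensor_eqI[OF _ _ _ _ a(1), where U=BH]) (simp_all add: coA_def cong: sw_cong)
  have "?G (ptensor BH H a (aone H)) = ptensor B H ?e (aone H)"
    using a by (simp cong: sw_cong)
  moreover have "?e \<in> carr B" using a by simp
  moreover have "?G (ptensor BH H a (aone H)) = a" using 1 unfolding a(2) .
  ultimately have "a = ptensor B H ?e (aone H)" "?e \<in> carr B" by (simp_all only:)
  then show "a \<in> {ptensor B H b (aone H) | b. b \<in> carr B}" by blast
next
  note [simp] = tw push hopf_sw[where U="tensor BH H"]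
  fix a assume "a \<in> {ptensor B H b (aone H) | b. b \<in> carr B}"
  then show "a \<in> right_coinv H A" by (auto simp: right_coinv_def coA_def)
qed

end

section \<open>Horizontal forms of the crossed product calculus\<close>

context crossed_calculus begin

text \<open>
  On elements of the base the vertical component \<open>b \<otimes> d1\<close> of the differential vanishes.
\<close>

lemma pullback_calc: "pullback_forms \<Omega>A (right_coinv H A) = {(ptensor \<Omega> H \<beta> (aone H), 0) | \<beta>. \<beta> \<in> carr \<Omega>}"
proof -
  note [simp] = tw
  let ?W = "\<lparr> carr = {(ptensor \<Omega> H \<beta> (aone H), 0 :: ('b, 'g, 'k) tens) | \<beta>. \<beta> \<in> carr \<Omega>}, scl = scl \<Omega>A \<rparr>"
  let ?S = "{lmul \<Omega>A b (dif \<Omega>A b') |b b'. b \<in> right_coinv H A \<and> b' \<in> right_coinv H A}"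
  have b: "bilinear_on \<Omega> H T1 (ptensor \<Omega> H)" by (rule ptensor_bilinear[OF vectO vectH])
  note lin = bilinear_on_left[OF b oneH]
  have pgen: "lmul \<Omega>A (ptensor B H b (aone H)) (dif \<Omega>A (ptensor B H c (aone H))) = (ptensor \<Omega> H (lmul \<Omega> b (dif \<Omega>
      c)) (aone H), 0)"
    if [simp]: "b \<in> carr B" "c \<in> carr B" for b c
  proof -
    note [simp] = push additive hopf_sw[where U=T1] hopf_sw[where U=T2] ver.N_coassoc[where U=T2] lO_rO
    note [simp del] = minus_apply plus_fun_apply zero_fun_apply
    note [cong] = sw_cong
    show ?thesis
      by (simp add: dH_def dV_def hor.gl_def ver.gl_def tsum_zero_arg[where U=T2])
  qed
  have W: "vect ?W"
  proof (rule vectI)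
    show "vector_space (scl ?W)" using vect_vs[OF vect_calc] by simp
    show "0 \<in> carr ?W" using linear_on_zero[OF lin vectO] vect_zero[OF vectO] by (auto simp: zero_prod_def
        intro!: exI[of _ 0])
    fix x y assume "x \<in> carr ?W" "y \<in> carr ?W"
    then obtain \<beta> \<beta>' where m: "\<beta> \<in> carr \<Omega>" "\<beta>' \<in> carr \<Omega>"
      and xy: "x = (ptensor \<Omega> H \<beta> (aone H), 0)" "y = (ptensor \<Omega> H \<beta>' (aone H), 0)" by auto
    have "x + y = (ptensor \<Omega> H (\<beta> + \<beta>') (aone H), 0)"
      by (simp only: xy linear_on_add[OF lin m] add_Pair add_0_left)
    then show "x + y \<in> carr ?W" using vect_add[OF vectO m] by (simp only: vs.select_convs mem_Collect_eq) blast
  next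
    fix c x assume "x \<in> carr ?W"
    then obtain \<beta> where m: "\<beta> \<in> carr \<Omega>" and x: "x = (ptensor \<Omega> H \<beta> (aone H), 0)" by auto
    have "scl ?W c x = (ptensor \<Omega> H (scl \<Omega> c \<beta>) (aone H), 0)"
      by (simp only: x vs.select_convs calc_simps direct_sum_simps linear_on_scl[OF lin m] scl_zero[OF vect_tensor])
    then show "scl ?W c x \<in> carr ?W" using vect_scl[OF vectO m] by (simp only: vs.select_convs mem_Collect_eq) blast
  qed
  show ?thesis
  proof
    have "?S \<subseteq> carr ?W" by (auto simp del: calc_simps(3-5) simp: right_coinvA pgen)
    then show "pullback_forms \<Omega>A (right_coinv H A) \<subseteq> {(ptensor \<Omega> H \<beta> (aone H), 0) |\<beta>. \<beta> \<in> carr \<Omega>}"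
      unfolding pullback_forms_def using span_sub[OF W, of \<Omega>A ?S] by simp
    have "(ptensor \<Omega> H \<beta> (aone H), 0) \<in> carr \<lparr> carr = vspan \<Omega>A ?S, scl = scl \<Omega>A \<rparr>" (is "_ \<in> carr ?K")
      if "\<beta> \<in> carr \<Omega>" for \<beta>
    proof (rule fodc_into[OF that fodcB vectB, where U=D and f="\<lambda>\<beta>. (ptensor \<Omega> H \<beta> (aone H), 0)", OF _
        vect_span[OF vect_calc]])
      show "linear_on \<Omega> D (\<lambda>\<beta>. (ptensor \<Omega> H \<beta> (aone H), 0))"
        by (intro linear_on_pair linear_on_const_zero vect_tensor lin)
      show "(ptensor \<Omega> H (lmul \<Omega> b (dif \<Omega> c)) (aone H), 0) \<in> carr ?K" if "b \<in> carr B" "c \<in> carr B" for b c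
        unfolding pgen[OF that, symmetric] vs.select_convs
        by (intro span_base'[OF vect_calc]) (use that right_coinvA in blast)
    qed
    then show "{(ptensor \<Omega> H \<beta> (aone H), 0) |\<beta>. \<beta> \<in> carr \<Omega>} \<subseteq> pullback_forms \<Omega>A (right_coinv H A)"
      unfolding pullback_forms_def vs.select_convs by blast
  qed
qed

lemma hor_gr_gen: assumes [simp]: "\<beta> \<in> carr \<Omega>" "h \<in> carr H"
  shows "hor.gr (ptensor \<Omega> H \<beta> (aone H)) (ptensor B H (aone B) h) = ptensor \<Omega> H \<beta> h"
  by (simp add: hor.gr_def tw push hopf_sw[where U=T1] cong: sw_cong)

lemma T1_vect: "vect \<lparr> carr = carr T1 \<times> {0 :: ('b, 'g, 'k) tens}, scl = scl \<Omega>A \<rparr>"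
proof (rule vectI)
  show "vector_space (scl \<lparr> carr = carr T1 \<times> {0 :: ('b, 'g, 'k) tens}, scl = scl \<Omega>A \<rparr>)" using vect_vs[OF vect_calc] by simp
qed (auto simp: zero_prod_def direct_sum_simps scl_zero[OF vect_tensor] tw simp flip: zero_fun_def)

text \<open>
  Both one-sided spans and the horizontal forms are identified through this lemma.
\<close>

lemma hor_span:
  assumes S: "\<And>\<beta> h. \<beta> \<in> carr \<Omega> \<Longrightarrow> h \<in> carr H \<Longrightarrow> (ptensor \<Omega> H \<beta> h, 0) \<in> vspan \<Omega>A S"
    and le: "S \<subseteq> carr T1 \<times> {0}"
  shows "vspan \<Omega>A S = carr T1 \<times> {0}"
proof
  show "vspan \<Omega>A S \<subseteq> carr T1 \<times> {0}" using span_sub[OF T1_vect, of \<Omega>A S] le by simp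
  let ?K = "\<lparr> carr = vspan \<Omega>A S, scl = scl \<Omega>A \<rparr>"
  have "(s, 0) \<in> carr ?K" if "s \<in> carr T1" for s
  proof (rule tensor_into[OF that vectO vectH, where U=D, OF _ vect_span[OF vect_calc]])
    show "linear_on T1 D (\<lambda>s. (s, 0))" by (intro linear_on_pair linear_on_id linear_on_const_zero vect_tensor)
    show "(ptensor \<Omega> H \<beta> h, 0) \<in> carr ?K" if "\<beta> \<in> carr \<Omega>" "h \<in> carr H" for \<beta> h
      using S[OF that] by (simp only: vs.select_convs)
  qed
  then show "carr T1 \<times> {0} \<subseteq> vspan \<Omega>A S" by auto
qed

lemma ver_zero: "x \<in> carr BH \<Longrightarrow> ver.gl x 0 = 0" "x \<in> carr BH \<Longrightarrow> ver.gr 0 x = 0"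
  using linear_on_zero[OF bilinear_on_right[OF ver.gl_bil] vect_tensor] linear_on_zero[OF bilinear_on_left[OF
      ver.gr_bil] vect_tensor] by auto

lemma horizontal_calc: "carr (horizontal_forms H A \<Omega>A) = carr T1 \<times> {0}"
  unfolding horizontal_forms_def vs.select_convs
proof (rule hor_span)
  fix \<beta> h assume m [simp]: "\<beta> \<in> carr \<Omega>" "h \<in> carr H"
  have "(ptensor \<Omega> H \<beta> h, 0) = rmul \<Omega>A (lmul \<Omega>A oneA (ptensor \<Omega> H \<beta> (aone H), 0)) (ptensor B H (aone B) h)"
    by (simp add: hor.gl_one hor_gr_gen ver_zero tw)
  moreover have "(ptensor \<Omega> H \<beta> (aone H), 0) \<in> pullback_forms \<Omega>A (right_coinv H A)"
    using m(1) by (auto simp: pullback_calc)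
  moreover have "oneA \<in> carr A" "ptensor B H (aone B) h \<in> carr A" by (simp_all add: tw)
  ultimately show "(ptensor \<Omega> H \<beta> h, 0) \<in> vspan \<Omega>A {rmul \<Omega>A (lmul \<Omega>A a \<beta>) a' |a \<beta> a'. a \<in> carr A \<and> \<beta> \<in>
      pullback_forms \<Omega>A (right_coinv H A) \<and> a' \<in> carr A}"
    by (intro span_base'[OF vect_calc]) blast
qed (auto simp: pullback_calc tw ver_zero)

lemma strong_right:
  "vspan \<Omega>A {rmul \<Omega>A \<beta> a | a \<beta>. a \<in> carr A \<and> \<beta> \<in> pullback_forms \<Omega>A (right_coinv H A)} = carr T1 \<times> {0}"
proof (rule hor_span)
  fix \<beta> h assume m [simp]: "\<beta> \<in> carr \<Omega>" "h \<in> carr H"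
  have "(ptensor \<Omega> H \<beta> h, 0) = rmul \<Omega>A (ptensor \<Omega> H \<beta> (aone H), 0) (ptensor B H (aone B) h)"
    by (simp add: hor_gr_gen ver_zero tw)
  moreover have "(ptensor \<Omega> H \<beta> (aone H), 0) \<in> pullback_forms \<Omega>A (right_coinv H A)"
    using m(1) by (auto simp: pullback_calc)
  moreover have "ptensor B H (aone B) h \<in> carr A" by (simp add: tw)
  ultimately show "(ptensor \<Omega> H \<beta> h, 0) \<in> vspan \<Omega>A {rmul \<Omega>A \<beta> a | a \<beta>. a \<in> carr A \<and> \<beta> \<in> pullback_forms \<Omega>A (right_coinv H A)}"
    by (intro span_base'[OF vect_calc]) blast
qed (auto simp: pullback_calc tw ver_zero)

text \<open>
  The expression is \<open>\<delta>(S\<^sup>-\<^sup>1 h\<^sub>3) \<cdot> (\<gamma>(S\<^sup>-\<^sup>1 h\<^sub>2) \<cdot> (\<beta> \<otimes> h\<^sub>1))\<close>.  The inner product has second leg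
  \<open>S\<^sup>-\<^sup>1(h\<^sub>3) h\<^sub>2\<close>, which collapses to \<open>1\<close>, so that it is a form on the base.  On the
  other hand \<open>\<delta>\<close> and \<open>\<gamma>\<close> cancel, since \<open>S\<^sup>-\<^sup>1\<close> reverses the coproduct.
\<close>

lemma strong_generator:
  assumes Si: "linear_on H H Si" "\<And>h. h \<in> carr H \<Longrightarrow> counit H (Si h) = counit H h"
    and Sc: "\<And>h. h \<in> carr H \<Longrightarrow> comul H (Si h) = sw h (\<lambda>h1 h2. ptensor H H (Si h2) (Si h1))"
    and Sa: "\<And>h. h \<in> carr H \<Longrightarrow> sw h (\<lambda>h1 h2. amul H (Si h2) h1) = scl H (counit H h) (aone H)"
    and bh [simp]: "\<beta> \<in> carr \<Omega>" "h \<in> carr H"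
  shows "ptensor \<Omega> H \<beta> h = sw h (\<lambda>q s. sw q (\<lambda>h1 r. sw r (\<lambda>h2 h3.
    hor.gl (del (Si s)) (ptensor \<Omega> H (rmul \<Omega> (wact (Si h3) \<beta>) (\<sigma> (Si h2) h1)) (aone H)))))"
proof -
  note [simp] = tw push linear_rules[OF Si(1) vectH vectH] linear_push[OF Si(1) vectH vectH]
    hopf_sw[where U=T1] srt
  note [cong] = sw_cong
  \<comment> \<open>The inner product is a form on the base.\<close>
  have 1: "sw q (\<lambda>h1 r. sw r (\<lambda>h2 h3.
      ptensor \<Omega> H (rmul \<Omega> (wact (Si h3) \<beta>) (\<sigma> (Si h2) h1)) (aone H))) =
    sw q (\<lambda>h1 r. hor.gl (gam (Si r)) (ptensor \<Omega> H \<beta> h1))" (is "?l = ?r") if [simp]: "q \<in> carr H" for q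
  proof -
    have "?r = sw q (\<lambda>h1 r. sw r (\<lambda>p s. sw s (\<lambda>h4 h5.
      ptensor \<Omega> H (rmul \<Omega> (wact (Si h5) \<beta>) (\<sigma> (Si h4) h1)) (sw p (\<lambda>h2 h3. amul H (Si h3) h2)))))"
      by (simp add: hor.gl_def gam_def Sc)
    also have "\<dots> = ?l" by (simp add: Sa)
    finally show ?thesis ..
  qed
  \<comment> \<open>The outer factors cancel.\<close>
  have 2: "sw p (\<lambda>r s. mulA (del (Si s)) (gam (Si r))) = scl BH (counit H p) oneA" if [simp]: "p \<in> carr H" for p
    using del_gam[of "Si p"] by (simp add: Sc Si hopf_sw[where U=BH])
  have "sw h (\<lambda>q s. sw q (\<lambda>h1 r. sw r (\<lambda>h2 h3.
    hor.gl (del (Si s)) (ptensor \<Omega> H (rmul \<Omega> (wact (Si h3) \<beta>) (\<sigma> (Si h2) h1)) (aone H))))) =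
    sw h (\<lambda>q s. hor.gl (del (Si s)) (sw q (\<lambda>h1 r. sw r (\<lambda>h2 h3.
     ptensor \<Omega> H (rmul \<Omega> (wact (Si h3) \<beta>) (\<sigma> (Si h2) h1)) (aone H)))))"
    by (simp del: srt coassoc)
  also have "\<dots> = sw h (\<lambda>q s. hor.gl (del (Si s)) (sw q (\<lambda>h1 r. hor.gl (gam (Si r)) (ptensor \<Omega> H \<beta> h1))))"
    by (intro tsum_cong refl vectH linear_on_in[OF comulH]) (simp_all only: 1 bh)
  also have "\<dots> = sw h (\<lambda>h1 p. hor.gl (sw p (\<lambda>r s. mulA (del (Si s)) (gam (Si r)))) (ptensor \<Omega> H \<beta> h1))"
    by (simp add: hor.gl_mul)
  also have "\<dots> = ptensor \<Omega> H \<beta> h" by (simp add: 2 hor.gl_one)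
  finally show ?thesis ..
qed

lemma strong_left:
  assumes bij: "bij_betw (antipode H) (carr H) (carr H)"
  shows "vspan \<Omega>A {lmul \<Omega>A a \<beta> | a \<beta>. a \<in> carr A \<and> \<beta> \<in> pullback_forms \<Omega>A (right_coinv H A)} = carr T1 \<times> {0}"
    (is "vspan \<Omega>A ?S = _")
proof (rule hor_span)
  obtain Si where Si: "linear_on H H Si" "\<And>h. h \<in> carr H \<Longrightarrow> counit H (Si h) = counit H h"
    "\<And>h. h \<in> carr H \<Longrightarrow> comul H (Si h) = sw h (\<lambda>h1 h2. ptensor H H (Si h2) (Si h1))"
    "\<And>h. h \<in> carr H \<Longrightarrow> sw h (\<lambda>h1 h2. amul H (Si h2) h1) = scl H (counit H h) (aone H)"
    using antipode_inverse[OF bij] by metis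
  fix \<beta> h assume m [simp]: "\<beta> \<in> carr \<Omega>" "h \<in> carr H"
  note [simp] = tw linear_rules[OF Si(1) vectH vectH]
  let ?K = "\<lparr> carr = vspan \<Omega>A ?S, scl = scl \<Omega>A \<rparr>"
  have K: "vect ?K" by (rule vect_span[OF vect_calc])
  have gen: "(hor.gl a (ptensor \<Omega> H \<beta>' (aone H)), 0) \<in> carr ?K" if "a \<in> carr BH" "\<beta>' \<in> carr \<Omega>" for a \<beta>'
  proof -
    have "(hor.gl a (ptensor \<Omega> H \<beta>' (aone H)), 0) = lmul \<Omega>A a (ptensor \<Omega> H \<beta>' (aone H), 0)"
      using that by (simp add: ver_zero)
    moreover have "(ptensor \<Omega> H \<beta>' (aone H), 0) \<in> pullback_forms \<Omega>A (right_coinv H A)"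
      using that by (auto simp: pullback_calc)
    moreover have "a \<in> carr A" using that by simp
    ultimately have "(hor.gl a (ptensor \<Omega> H \<beta>' (aone H)), 0) \<in> ?S" by blast
    from span_base'[OF vect_calc this] show ?thesis by (simp only: vs.select_convs)
  qed
  have "(ptensor \<Omega> H \<beta> h, 0) = sw h (\<lambda>q s. sw q (\<lambda>h1 r. sw r (\<lambda>h2 h3.
    (hor.gl (del (Si s)) (ptensor \<Omega> H (rmul \<Omega> (wact (Si h3) \<beta>) (\<sigma> (Si h2) h1)) (aone H)), 0))))"
    unfolding tsum_pair by (simp only: tsum_zero strong_generator[OF Si m, symmetric])
  also have "\<dots> \<in> carr ?K"
    by (intro tsum_into_subspace[OF K vectH] gen linear_on_in[OF comulH]) simp_all
  finally show "(ptensor \<Omega> H \<beta> h, 0) \<in> vspan \<Omega>A ?S" by (simp only: vs.select_convs)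
qed (auto simp: pullback_calc tw ver_zero)

lemma crossed_strong: "bij_betw (antipode H) (carr H) (carr H) \<Longrightarrow> strong_bundle H A \<Omega>A"
  unfolding strong_bundle_def by (simp only: strong_left strong_right)

lemma crossed_qpb: "quantum_principal_bundle H A \<Omega>A \<Gamma>"
  by (rule quantum_principal_bundleI[OF A_comodule_algebra calc_covariant bicov vmap_vertical])
    (simp_all only: X_tensor lact_eq vmap_module vmap_surj vmap_kernel horizontal_calc)

end

section \<open>The universal calculus\<close>

lemma scl_tensor: "scl (tensor V W) = (\<lambda>c t \<phi>. c * t \<phi>)"
  by (simp add: tensor_def eval_space_def)

context comodule_algebra begin

text \<open>
  The operations of the universal calculus are considered on all of \<open>A \<otimes> A\<close>, where they can be evaluated on pure tensors;
  the calculus itself is the kernel of the multiplication \<open>um\<close>.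
\<close>

abbreviation "AA \<equiv> tensor A A"
abbreviation "UA \<equiv> universal_calc H A"

definition ul where "ul a t = tsum A A t (\<lambda>x y. ptensor A A (amul A a x) y)"
definition ur where "ur t a = tsum A A t (\<lambda>x y. ptensor A A x (amul A y a))"
definition ud where "ud a = ptensor A A (aone A) a - ptensor A A a (aone A)"
definition um where "um t = tsum A A t (amul A)"
definition uco where "uco t = tsum A A t (\<lambda>x y. tsum A H (coact A x) (\<lambda>x0 x1. tsum A H (coact A y)
  (\<lambda>y0 y1. ptensor AA H (ptensor A A x0 y0) (amul H x1 y1))))"

lemma U_simps: "carr UA = {t \<in> carr AA. um t = 0}" "scl UA = scl AA" "lmul UA = ul" "rmul UA = ur" "dif UA = ud"
    "rcoact UA = uco"
  by (simp_all add: fun_eq_iff universal_calc_def ul_def ur_def ud_def um_def uco_def diagonal_coaction_def)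

lemma ul_bil: "bilinear_on A AA AA ul" and ur_bil: "bilinear_on AA A AA ur" and ud_lin: "linear_on A AA ud"
  and um_lin: "linear_on AA A um" and uco_lin: "linear_on AA (tensor AA H) uco"
proof -
  note [simp] = tw
  show "bilinear_on A AA AA ul" unfolding ul_def by (intro bilinear_onI) simp_all
  show "bilinear_on AA A AA ur" unfolding ur_def by (intro bilinear_onI) simp_all
  show "linear_on A AA ud" unfolding ud_def by simp
  show "linear_on AA A um" unfolding um_def by simp
  show "linear_on AA (tensor AA H) uco" unfolding uco_def by simp
qed

lemmas [tw] = bilinear_rules[OF ul_bil vectA vect_tensor vect_tensor] bilinear_rules[OF ur_bil vect_tensor vectA vect_tensor]
  linear_rules[OF ud_lin vectA vect_tensor] linear_rules[OF um_lin vect_tensor vectA] linear_rules[OF uco_lin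
      vect_tensor vect_tensor]
lemmas [push] = bilinear_push[OF ul_bil vectA vect_tensor vect_tensor] bilinear_push[OF ur_bil vect_tensor vectA vect_tensor]
  linear_push[OF um_lin vect_tensor vectA] linear_push[OF uco_lin vect_tensor vect_tensor]
lemmas [additive] = bilinear_additive[OF ul_bil vectA vect_tensor vect_tensor] bilinear_additive[OF ur_bil
    vect_tensor vectA vect_tensor]
  linear_additive[OF um_lin vect_tensor vectA] linear_additive[OF uco_lin vect_tensor vect_tensor]

lemma U_eval [push]:
  assumes [simp]: "x \<in> carr A" "y \<in> carr A"
  shows "a \<in> carr A \<Longrightarrow> ul a (ptensor A A x y) = ptensor A A (amul A a x) y"
    and "a \<in> carr A \<Longrightarrow> ur (ptensor A A x y) a = ptensor A A x (amul A y a)"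
    and "um (ptensor A A x y) = amul A x y"
    and "uco (ptensor A A x y) = tsum A H (coact A x) (\<lambda>x0 x1. tsum A H (coact A y)
      (\<lambda>y0 y1. ptensor AA H (ptensor A A x0 y0) (amul H x1 y1)))"
  by (simp_all add: ul_def ur_def um_def uco_def tw tsum_rules[where U=AA] tsum_rules[where U=A]
    tsum_rules[where U="tensor AA H"] cong: sw_cong)

lemma um_ul: "a \<in> carr A \<Longrightarrow> t \<in> carr AA \<Longrightarrow> um (ul a t) = amul A a (um t)"
  by (rule tensor_eqI[where U=A and F="\<lambda>t. um (ul a t)" and G="\<lambda>t. amul A a (um t)" and V=A and W=A])
    (simp_all add: tw push cong: sw_cong)

lemma um_ur: "a \<in> carr A \<Longrightarrow> t \<in> carr AA \<Longrightarrow> um (ur t a) = amul A (um t) a"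
  by (rule tensor_eqI[where U=A and F="\<lambda>t. um (ur t a)" and G="\<lambda>t. amul A (um t) a" and V=A and W=A])
    (simp_all add: tw push cong: sw_cong)

lemma vect_U [tw]: "vect UA"
proof (rule vectI)
  show "vector_space (scl UA)" using vect_vs[OF vect_tensor[of A A]] by (simp add: U_simps)
qed (auto simp: U_simps additive tw linear_on_scl[OF um_lin] scl_zero[OF vectA] linear_on_zero[OF um_lin vect_tensor])

lemma ul_ud: "x \<in> carr A \<Longrightarrow> y \<in> carr A \<Longrightarrow> ul x (ud y) = ptensor A A x y - ptensor A A (amul A x y) (aone A)"
  by (simp add: ud_def additive tw push)

text \<open>
  Since \<open>x dy = x \<otimes> y - x y \<otimes> 1\<close>, summing over a tensor in the kernel of the multiplication gives back the tensor.
\<close>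

lemma U_generated: assumes t: "t \<in> carr UA" shows "tsum A A t (\<lambda>x y. ul x (ud y)) = t"
proof -
  have t: "t \<in> carr AA" "um t = 0" using t by (auto simp: U_simps)
  note [simp] = tw
  note [cong] = sw_cong
  have "tsum A A t (\<lambda>x y. ul x (ud y)) = tsum A A t (\<lambda>x y. ptensor A A x y - ptensor A A (amul A x y) (aone A))"
    using t by (simp add: ul_ud)
  also have "\<dots> = t - tsum A A t (\<lambda>x y. ptensor A A (amul A x y) (aone A))"
    using t by (simp add: tsum_minus tsum_id)
  also have "tsum A A t (\<lambda>x y. ptensor A A (amul A x y) (aone A)) = ptensor A A (um t) (aone A)"
    unfolding um_def using t by (simp add: push)
  finally show ?thesis using t by (simp add: additive)
qed

lemma ul_ud_in: "x \<in> carr A \<Longrightarrow> y \<in> carr A \<Longrightarrow> ul x (ud y) \<in> carr UA"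
  by (simp add: U_simps tw um_ul) (simp add: ud_def additive tw push)

lemma ud_in: "y \<in> carr A \<Longrightarrow> ud y \<in> carr UA"
  by (simp add: U_simps tw) (simp add: ud_def additive tw push)

lemma U_tensor: "ptensor UA X = ptensor AA X" "ptensor X UA = ptensor X AA"
  by (rule ptensor_cong; simp add: U_simps)+

lemma uco_gen:
  assumes [simp]: "x \<in> carr A" "y \<in> carr A"
  shows "uco (ul x (ud y)) = tsum A H (coact A x) (\<lambda>x0 x1. tsum A H (coact A y) (\<lambda>y0 y1. ptensor AA H (ul x0 (ud
      y0)) (amul H x1 y1)))"
proof -
  note [simp] = tw push additive ul_ud A_sw[where U="tensor AA H"]
  note [simp del] = minus_apply plus_fun_apply zero_fun_apply
  note [cong] = sw_cong
  show ?thesis by simp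
qed

lemma uco_in: assumes t: "t \<in> carr UA" shows "uco t \<in> carr (tensor UA H)"
proof -
  note [simp] = tw
  have t': "t \<in> carr AA" using t by (simp add: U_simps)
  have e: "uco t = tsum A A t (\<lambda>x y. uco (ul x (ud y)))"
    using U_generated[OF t, THEN arg_cong, of uco] t' by (simp add: push)
  have "tsum A A t (\<lambda>x y. uco (ul x (ud y))) \<in> carr (tensor UA H)"
    using t' by (intro tsum_in) (simp_all add: uco_gen ul_ud_in flip: U_tensor)
  then show ?thesis using e by simp
qed

lemma universal_fodc: "fodc A UA"
  unfolding fodc_def left_module_def right_module_def
proof (intro conjI ballI)
  note [simp] = tw
  show "vect UA" "vect UA" by simp_all
  have sub: "carr UA \<subseteq> carr AA" "scl UA = scl AA" by (auto simp: U_simps)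
  have l: "ul a t \<in> carr UA" if "a \<in> carr A" "t \<in> carr UA" for a t
    using that bilinear_additive(6)[OF mulA_bil vectA vectA vectA] by (simp add: U_simps um_ul)
  have r: "ur t a \<in> carr UA" if "a \<in> carr A" "t \<in> carr UA" for a t
    using that bilinear_additive(5)[OF mulA_bil vectA vectA vectA] by (simp add: U_simps um_ur)
  show "bilinear_on A UA UA (lmul UA)" unfolding U_simps(3) by (rule bilinear_on_subspace[OF ul_bil sub l])
  show "bilinear_on UA A UA (rmul UA)" unfolding U_simps(4) by (rule bilinear_on_subspace_left[OF ur_bil sub r])
  note [simp] = push U_simps(3-5)
  fix t assume "t \<in> carr UA"
  then have t: "t \<in> carr AA" by (simp add: U_simps)
  show "lmul UA (aone A) t = t" by (rule tensor_eqI[OF _ _ _ _ t, where U=AA]) simp_all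
  show "rmul UA t (aone A) = t" by (rule tensor_eqI[OF _ _ _ _ t, where U=AA]) simp_all
  fix a b assume [simp]: "a \<in> carr A" "b \<in> carr A"
  show "lmul UA (amul A a b) t = lmul UA a (lmul UA b t)" by (rule tensor_eqI[OF _ _ _ _ t, where U=AA]) simp_all
  show "rmul UA t (amul A a b) = rmul UA (rmul UA t a) b" by (rule tensor_eqI[OF _ _ _ _ t, where U=AA]) simp_all
  show "rmul UA (lmul UA a t) b = lmul UA a (rmul UA t b)" by (rule tensor_eqI[OF _ _ _ _ t, where U=AA]) simp_all
next
  show "linear_on A UA (dif UA)" using ud_lin ud_in by (simp add: linear_on_def U_simps)
next
  fix a b assume [simp]: "a \<in> carr A" "b \<in> carr A"
  note [simp] = tw push additive U_simps(3-5)
  note [simp del] = minus_apply plus_fun_apply zero_fun_apply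
  show "dif UA (amul A a b) = rmul UA (dif UA a) b + lmul UA a (dif UA b)" by (simp add: ud_def)
next
  let ?S = "{lmul UA a (dif UA b) |a b. a \<in> carr A \<and> b \<in> carr A}"
  have S: "?S \<subseteq> carr UA" using ul_ud_in by (auto simp: U_simps(3,5))
  show "carr UA = vspan UA ?S"
  proof
    show "vspan UA ?S \<subseteq> carr UA" by (rule span_carr[OF vect_U S])
    show "carr UA \<subseteq> vspan UA ?S"
    proof
      fix t assume t: "t \<in> carr UA"
      have "tsum A A t (\<lambda>x y. ul x (ud y)) \<in> carr \<lparr> carr = vspan UA ?S, scl = scl UA \<rparr>"
      proof (rule tsum_into_subspace[OF vect_span[OF vect_U] vectA])
        show "t \<in> carr AA" using t by (simp add: U_simps)
        show "ul v (ud w) \<in> carr \<lparr> carr = vspan UA ?S, scl = scl UA \<rparr>" if "v \<in> carr A" "w \<in> carr A" for v w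
          unfolding vs.select_convs by (rule span_base'[OF vect_U]) (use that in \<open>auto simp: U_simps(3,5)\<close>)
      qed
      then show "t \<in> vspan UA ?S" using U_generated[OF t] by simp
    qed
  qed
qed

lemma uco_covariant: "linear_on UA (tensor UA H) (rcoact UA)"
proof (rule linear_onI)
  show "rcoact UA v \<in> carr (tensor UA H)" if "v \<in> carr UA" for v
    using uco_in[OF that] by (simp add: U_simps(6))
  show "rcoact UA (v + v') = rcoact UA v + rcoact UA v'" if "v \<in> carr UA" "v' \<in> carr UA" for v v'
    using that linear_on_add[OF uco_lin] by (simp add: U_simps)
  show "rcoact UA (scl UA c v) = scl (tensor UA H) c (rcoact UA v)" if "v \<in> carr UA" for c v
    using that linear_on_scl[OF uco_lin] by (simp add: U_simps scl_tensor)
qed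

lemma universal_covariant: "right_covariant_fodc H A UA"
proof -
  interpret C: comodule_fodc H A UA
  proof unfold_locales
    show "fodc A UA" by (rule universal_fodc)
    show "linear_on UA (tensor UA H) (rcoact UA)" by (rule uco_covariant)
  qed (use uco_gen in \<open>simp add: U_simps U_tensor\<close>)
  show ?thesis by (rule C.covariant)
qed

end

section \<open>Bicovariant calculi\<close>

lemma self_comodalg_codomain [simp]: "linear_on U (self_comodalg H) f = linear_on U H f"
  "bilinear_on U V (self_comodalg H) g = bilinear_on U V H g"
  by (simp_all add: linear_on_def bilinear_on_def)

context hopf begin

lemma self_comodule_algebra: "right_comodule_algebra H (self_comodalg H)"
proof -
  have "algebra (self_comodalg H)" using algH by (simp add: algebra_def vect_def)
  moreover have "right_comodule H (self_comodalg H) (comul H)"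
  proof -
    have v: "vect (self_comodalg H)" using vectH by (simp add: vect_def)
    note [simp] = tw push hopf_sw[where U="tensor H (tensor H H)"] hopf_sw[where U=H]
    note [cong] = sw_cong
    show ?thesis
      unfolding right_comodule_def cop_def self_comodalg_simps self_comodalg_tensor self_comodalg_linear
      using comulH v by simp
  qed
  ultimately show ?thesis by (simp add: right_comodule_algebra_def comul_one comul_mul)
qed

end

text \<open>
  The two-sided analogue of \<open>comodule_fodc\<close>: formulas for both coactions on generators imply bicovariance.
\<close>

locale bicov_generators = hopf H for H :: "('h::ab_group_add, 'k::field, 'z) hopf_scheme" +
  fixes \<Gamma> :: "('g::ab_group_add, 'k, 'h, 'h, 'w) bicalc_scheme"
  assumes fodcG: "fodc H \<Gamma>" and rco_lin: "linear_on \<Gamma> (tensor \<Gamma> H) (rcoact \<Gamma>)"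
    and lco_lin: "linear_on \<Gamma> (tensor H \<Gamma>) (lcoact \<Gamma>)"
    and rco_gen [push]: "\<And>x y. x \<in> carr H \<Longrightarrow> y \<in> carr H \<Longrightarrow> rcoact \<Gamma> (lmul \<Gamma> x (dif \<Gamma> y)) =
      sw x (\<lambda>x1 x2. sw y (\<lambda>y1 y2. ptensor \<Gamma> H (lmul \<Gamma> x1 (dif \<Gamma> y1)) (amul H x2 y2)))"
    and lco_gen [push]: "\<And>x y. x \<in> carr H \<Longrightarrow> y \<in> carr H \<Longrightarrow> lcoact \<Gamma> (lmul \<Gamma> x (dif \<Gamma> y)) =
      sw x (\<lambda>x1 x2. sw y (\<lambda>y1 y2. ptensor H \<Gamma> (amul H x1 y1) (lmul \<Gamma> x2 (dif \<Gamma> y2))))"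
begin

lemma vectG [tw]: "vect \<Gamma>" and lmul_bil: "bilinear_on H \<Gamma> \<Gamma> (lmul \<Gamma>)" and rmul_bil: "bilinear_on \<Gamma> H \<Gamma> (rmul \<Gamma>)"
  and dif_lin: "linear_on H \<Gamma> (dif \<Gamma>)"
  using fodcG by (simp_all add: fodc_def left_module_def right_module_def)

lemmas [tw] = bilinear_rules[OF lmul_bil vectH vectG vectG] bilinear_rules[OF rmul_bil vectG vectH vectG]
   linear_rules[OF dif_lin vectH vectG] linear_rules[OF rco_lin vectG vect_tensor] linear_rules[OF lco_lin vectG vect_tensor]
lemmas [push] = bilinear_push[OF lmul_bil vectH vectG vectG] bilinear_push[OF rmul_bil vectG vectH vectG]
   linear_push[OF dif_lin vectH vectG] linear_push[OF rco_lin vectG vect_tensor] linear_push[OF lco_lin vectG vect_tensor]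
lemmas [additive] = bilinear_additive[OF lmul_bil vectH vectG vectG] bilinear_additive[OF rmul_bil vectG vectH vectG]
   linear_additive[OF dif_lin vectH vectG] linear_additive[OF rco_lin vectG vect_tensor] linear_additive[OF
       lco_lin vectG vect_tensor]

lemma lmul_assoc: "a \<in> carr H \<Longrightarrow> b \<in> carr H \<Longrightarrow> w \<in> carr \<Gamma> \<Longrightarrow> lmul \<Gamma> a (lmul \<Gamma> b w) = lmul \<Gamma> (amul H a b) w"
  and lmul_one: "w \<in> carr \<Gamma> \<Longrightarrow> lmul \<Gamma> (aone H) w = w"
  and rmul_dif: "a \<in> carr H \<Longrightarrow> b \<in> carr H \<Longrightarrow> rmul \<Gamma> (dif \<Gamma> a) b = dif \<Gamma> (amul H a b) - lmul \<Gamma> a (dif \<Gamma> b)"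
  and lmul_rmul: "a \<in> carr H \<Longrightarrow> b \<in> carr H \<Longrightarrow> w \<in> carr \<Gamma> \<Longrightarrow> rmul \<Gamma> (lmul \<Gamma> a w) b = lmul \<Gamma> a (rmul \<Gamma> w b)"
  using fodcG by (simp_all add: fodc_def left_module_def)

lemma bicovariant: "bicovariant_fodc H \<Gamma>"
  unfolding bicovariant_fodc_def cop_def
proof (intro conjI ballI)
  interpret C: comodule_fodc H "self_comodalg H" \<Gamma>
  proof (unfold_locales, rule self_comodule_algebra)
    show "fodc (self_comodalg H) \<Gamma>" using fodcG by (simp add: fodc_def left_module_def right_module_def)
  qed (use rco_lin rco_gen in simp_all)
  show "right_covariant_fodc H (self_comodalg H) \<Gamma>" by (rule C.covariant)
next
  note [simp] = tw push srt lmul_assoc lmul_one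
  note [simp del] = minus_apply plus_fun_apply zero_fun_apply
  note [cong] = sw_cong
  show "left_comodule H \<Gamma> (lcoact \<Gamma>)"
    unfolding left_comodule_def cop_def
  proof (intro conjI ballI vectG lco_lin)
    fix w assume w [simp]: "w \<in> carr \<Gamma>"
    let ?V = "tensor H (tensor H \<Gamma>)"
    let ?F = "\<lambda>w. tsum H \<Gamma> (lcoact \<Gamma> w) (\<lambda>h v0. tsum H \<Gamma> (lcoact \<Gamma> v0) (\<lambda>x y. ptensor H (tensor H \<Gamma>) h (ptensor H \<Gamma> x y)))"
    let ?G = "\<lambda>w. tsum H \<Gamma> (lcoact \<Gamma> w) (\<lambda>h v0. sw h (\<lambda>h1 h2. ptensor H (tensor H \<Gamma>) h1 (ptensor H \<Gamma> h2 v0)))"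
    show "?F w = ?G w"
    proof (rule fodc_eqI[OF fodcG, where F="?F" and G="?G" and U="?V"])
      show "linear_on \<Gamma> ?V ?F" "linear_on \<Gamma> ?V ?G" by simp_all
      fix x y assume [simp]: "x \<in> carr H" "y \<in> carr H"
      show "?F (lmul \<Gamma> x (dif \<Gamma> y)) = ?G (lmul \<Gamma> x (dif \<Gamma> y))"
        by (simp add: hopf_sw[where U="?V"])
    qed (rule w)
    show "tsum H \<Gamma> (lcoact \<Gamma> w) (\<lambda>h v0. scl \<Gamma> (counit H h) v0) = w"
      by (rule fodc_eqI[OF fodcG _ _ _ w, where U=\<Gamma>]) (simp_all add: hopf_sw[where U="\<Gamma>"])
  qed
  fix w assume w [simp]: "w \<in> carr \<Gamma>"
  let ?V = "tensor H (tensor \<Gamma> H)"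
  let ?F = "\<lambda>\<gamma>. tsum \<Gamma> H (rcoact \<Gamma> \<gamma>) (\<lambda>g h. tsum H \<Gamma> (lcoact \<Gamma> g) (\<lambda>x y. ptensor H (tensor \<Gamma> H) x (ptensor \<Gamma> H y h)))"
  let ?G = "\<lambda>\<gamma>. tsum H \<Gamma> (lcoact \<Gamma> \<gamma>) (\<lambda>x g. tsum \<Gamma> H (rcoact \<Gamma> g) (\<lambda>y h. ptensor H (tensor \<Gamma> H) x (ptensor \<Gamma> H y h)))"
  show "?F w = ?G w"
  proof (rule fodc_eqI[OF fodcG, where F="?F" and G="?G" and U="?V"])
    show "linear_on \<Gamma> ?V ?F" "linear_on \<Gamma> ?V ?G" by simp_all
    fix x y assume [simp]: "x \<in> carr H" "y \<in> carr H"
    show "?F (lmul \<Gamma> x (dif \<Gamma> y)) = ?G (lmul \<Gamma> x (dif \<Gamma> y))"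
      by (simp add: hopf_sw[where U="?V"])
  qed (rule w)
next
  note [simp] = tw push srt lmul_assoc lmul_one hopf_sw[where U="tensor H \<Gamma>"]
  note [simp del] = minus_apply plus_fun_apply zero_fun_apply
  note [cong] = sw_cong
  fix h w assume h [simp]: "h \<in> carr H" and w [simp]: "w \<in> carr \<Gamma>"
  show "lcoact \<Gamma> (lmul \<Gamma> h w) = sw h (\<lambda>h1 h2. tsum H \<Gamma> (lcoact \<Gamma> w) (\<lambda>x g. ptensor H \<Gamma> (amul H h1 x) (lmul \<Gamma> h2 g)))"
    by (rule fodc_eqI[OF fodcG _ _ _ w, where U="tensor H \<Gamma>"]) simp_all
  show "lcoact \<Gamma> (rmul \<Gamma> w h) = tsum H \<Gamma> (lcoact \<Gamma> w) (\<lambda>x g. sw h (\<lambda>h1 h2. ptensor H \<Gamma> (amul H x h1) (rmul \<Gamma> g h2)))"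
    by (rule fodc_eqI[OF fodcG _ _ _ w, where U="tensor H \<Gamma>"]) (simp_all add: lmul_rmul rmul_dif additive)
next
  fix h assume h [simp]: "h \<in> carr H"
  note [simp] = tw hopf_sw[where U="tensor H \<Gamma>"]
  note [cong] = sw_cong
  have "lcoact \<Gamma> (lmul \<Gamma> (aone H) (dif \<Gamma> h)) = sw h (\<lambda>h1 h2. ptensor H \<Gamma> h1 (dif \<Gamma> h2))"
    by (simp add: push) (simp add: lmul_one)
  then show "lcoact \<Gamma> (dif \<Gamma> h) = sw h (\<lambda>h1 h2. ptensor H \<Gamma> h1 (dif \<Gamma> h2))"
    by (simp add: lmul_one)
qed

end

lemma linear_on_restrict:
  "linear_on V U f \<Longrightarrow> carr W \<subseteq> carr V \<Longrightarrow> scl W = scl V \<Longrightarrow> linear_on W U f"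
  unfolding linear_on_def by (simp add: subset_iff)

lemma fodc_cong:
  assumes "carr A = carr A'" "scl A = scl A'" "amul A = amul A'" "aone A = aone A'"
    and "carr \<Omega> = carr \<Omega>'" "scl \<Omega> = scl \<Omega>'" "lmul \<Omega> = lmul \<Omega>'" "rmul \<Omega> = rmul \<Omega>'" "dif \<Omega> = dif \<Omega>'"
  shows "fodc A \<Omega> = fodc A' \<Omega>'"
  using assms by (simp add: fodc_def left_module_def right_module_def vect_def bilinear_on_def linear_on_def)

locale bicov = hopf H for H :: "('h::ab_group_add, 'k::field, 'z) hopf_scheme" +
  fixes \<Gamma> :: "('g::ab_group_add, 'k, 'h, 'h, 'w) bicalc_scheme"
  assumes bicov: "bicovariant_fodc H \<Gamma>"
begin

lemma fodcG: "fodc H \<Gamma>"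
  using bicov by (simp add: bicovariant_fodc_def right_covariant_fodc_def fodc_def left_module_def right_module_def)

sublocale hopf_bimodule H \<Gamma> "lmul \<Gamma>" "lcoact \<Gamma>" "rmul \<Gamma>" "rcoact \<Gamma>"
proof unfold_locales
  show "left_module H \<Gamma> (lmul \<Gamma>)" "right_module H \<Gamma> (rmul \<Gamma>)"
    using fodcG by (simp_all add: fodc_def)
qed (use fodcG bicov in \<open>simp_all add: bicovariant_fodc_def right_covariant_fodc_def cop_def fodc_def\<close>)

lemma difG_lin: "linear_on H \<Gamma> (dif \<Gamma>)"
  using fodcG by (simp_all add: fodc_def left_module_def right_module_def)
lemmas [tw] = linear_rules[OF difG_lin vectH vectN]
lemmas [push] = linear_push[OF difG_lin vectH vectN]

lemma lco_dif [push]: "h \<in> carr H \<Longrightarrow> lcoact \<Gamma> (dif \<Gamma> h) = sw h (\<lambda>h1 h2. ptensor H \<Gamma> h1 (dif \<Gamma> h2))"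
  and rco_dif [push]: "h \<in> carr H \<Longrightarrow> rcoact \<Gamma> (dif \<Gamma> h) = sw h (\<lambda>h1 h2. ptensor \<Gamma> H (dif \<Gamma> h1) h2)"
  using bicov by (simp_all add: bicovariant_fodc_def right_covariant_fodc_def cop_def)

text \<open>
  The Maurer-Cartan map \<open>h \<mapsto> S(h\<^sub>1) dh\<^sub>2\<close>.
\<close>

definition varpi where "varpi h = proj (dif \<Gamma> h)"

lemma varpi_lin: "linear_on H coinv varpi"
  unfolding varpi_def by (rule linear_on_compose[OF proj_linear difG_lin])

lemma varpi_linN: "linear_on H \<Gamma> varpi"
  unfolding varpi_def by (rule linear_on_compose[OF proj_linear' difG_lin])

lemmas [tw] = linear_rules[OF varpi_lin vectH vect_coinv] linear_rules[OF varpi_linN vectH vectN]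
lemmas [push] = linear_push[OF varpi_linN vectH vectN]
lemmas [additive] = linear_additive[OF varpi_linN vectH vectN]

lemma varpi_eq: "h \<in> carr H \<Longrightarrow> varpi h = sw h (\<lambda>h1 h2. lmul \<Gamma> (antipode H h1) (dif \<Gamma> h2))"
  by (simp add: varpi_def proj_def tw push hopf_sw[where U=\<Gamma>] cong: sw_cong)

lemma varpi_one [push]: "varpi (aone H) = 0"
  by (simp add: varpi_def fodc_one[OF fodcG algH] linear_on_zero[OF proj_linear vectN])

text \<open>
  The coinvariant forms are the image of \<open>varpi\<close>, since \<open>proj (a db) = \<epsilon>(a) varpi b\<close>.
\<close>

lemma coinv_eqI:
  assumes F: "linear_on coinv U F" and G: "linear_on coinv U G"
    and eq: "\<And>h. h \<in> carr H \<Longrightarrow> F (varpi h) = G (varpi h)" and x: "x \<in> carr coinv"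
  shows "F x = G x"
proof -
  have p: "proj x = x" using proj_mult_coinv[OF oneH x] coinvD(1)[OF x] by (simp add: lN_one counit_one scl_one[OF vectN])
  have "F (proj x) = G (proj x)"
  proof (rule fodc_eqI[OF fodcG, where F="\<lambda>x. F (proj x)" and G="\<lambda>x. G (proj x)" and U=U])
    show "linear_on \<Gamma> U (\<lambda>x. F (proj x))" "linear_on \<Gamma> U (\<lambda>x. G (proj x))"
      by (rule linear_on_compose[OF F proj_linear] linear_on_compose[OF G proj_linear])+
    show "x \<in> carr \<Gamma>" by (rule coinvD(1)[OF x])
    fix a b assume [simp]: "a \<in> carr H" "b \<in> carr H"
    have "proj (lmul \<Gamma> a (dif \<Gamma> b)) = scl coinv (counit H a) (varpi b)"
      by (simp add: proj_mult tw varpi_def coinv_scl)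
    moreover have "varpi b \<in> carr coinv" by (rule linear_on_in[OF varpi_lin]) simp
    ultimately show "F (proj (lmul \<Gamma> a (dif \<Gamma> b))) = G (proj (lmul \<Gamma> a (dif \<Gamma> b)))"
      using linear_on_scl[OF F] linear_on_scl[OF G] eq by simp
  qed
  then show ?thesis by (simp add: p)
qed

text \<open>
  The Maurer-Cartan map is colinear for the adjoint coaction \<open>h \<mapsto> h\<^sub>2 \<otimes> S(h\<^sub>1) h\<^sub>3\<close>.  In particular the right
  coaction restricts to coinvariant forms.
\<close>

lemma rco_varpi:
  assumes h [simp]: "h \<in> carr H"
  shows "rcoact \<Gamma> (varpi h) = sw h (\<lambda>h1 r. sw r (\<lambda>h2 h3. ptensor \<Gamma> H (varpi h2) (amul H (antipode H h1) h3)))"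
proof -
  note [simp] = tw push hopf_sw[where U="tensor \<Gamma> H"] srt comul_antipode
  note [cong] = sw_cong
  show ?thesis by (simp add: varpi_eq)
qed

lemma coinv_ptensor: "ptensor coinv Y = ptensor \<Gamma> Y" "ptensor Y coinv = ptensor Y \<Gamma>"
  by (rule ptensor_cong; simp add: coinv_scl)+

lemma rco_coinv: "linear_on coinv (tensor coinv H) (rcoact \<Gamma>)"
proof (rule linear_onI)
  note [simp] = tw
  have g: "rcoact \<Gamma> (varpi h) \<in> carr (tensor coinv H)" if "h \<in> carr H" for h
    unfolding rco_varpi[OF that] coinv_ptensor(1)[symmetric] using that by simp
  have p: "rcoact \<Gamma> (proj y) \<in> carr (tensor coinv H)" if y: "y \<in> carr \<Gamma>" for y
  proof (rule fodc_into[OF y fodcG vectH, where U="tensor \<Gamma> H" and f="\<lambda>y. rcoact \<Gamma> (proj y)", OF _ vect_tensor])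
    show "linear_on \<Gamma> (tensor \<Gamma> H) (\<lambda>y. rcoact \<Gamma> (proj y))" by simp
    fix a b assume ab: "a \<in> carr H" "b \<in> carr H"
    then have "rcoact \<Gamma> (proj (lmul \<Gamma> a (dif \<Gamma> b))) = scl (tensor coinv H) (counit H a) (rcoact \<Gamma> (varpi b))"
      by (simp add: proj_mult varpi_def linear_on_scl[OF rco_lin] scl_tensor)
    then show "rcoact \<Gamma> (proj (lmul \<Gamma> a (dif \<Gamma> b))) \<in> carr (tensor coinv H)" using ab g by simp
  qed
  show "rcoact \<Gamma> x \<in> carr (tensor coinv H)" if x: "x \<in> carr coinv" for x
    using p[of x] proj_mult_coinv[OF oneH x] coinvD(1)[OF x] by (simp add: lN_one counit_one scl_one[OF vectN])
  show "rcoact \<Gamma> (v + v') = rcoact \<Gamma> v + rcoact \<Gamma> v'" if "v \<in> carr coinv" "v' \<in> carr coinv" for v v'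
    using that coinvD(1) linear_on_add[OF rco_lin] by blast
  show "rcoact \<Gamma> (scl coinv c v) = scl (tensor coinv H) c (rcoact \<Gamma> v)" if "v \<in> carr coinv" for c v
    using linear_on_scl[OF rco_lin coinvD(1)[OF that]] by (simp add: coinv_scl scl_tensor)
qed

lemma X_coinv: "left_coinv_forms H \<Gamma> = coinv"
  by (simp add: left_coinv_forms_def coinv_def)

end

section \<open>The universal bicovariant calculus\<close>

context hopf begin

abbreviation "HH \<equiv> tensor H H"
abbreviation "UH \<equiv> universal_bicalc H"
abbreviation "US \<equiv> universal_calc H (self_comodalg H)"

lemma UH_simps: "carr UH = carr US" "scl UH = scl US" "lmul UH = lmul US" "rmul UH = rmul US" "dif UH = dif US"
   "rcoact UH = rcoact US"
  by (simp_all add: universal_bicalc_def rcalc.defs bicalc.defs)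

definition ulco where "ulco t = tsum H H t (\<lambda>x y. sw x (\<lambda>x1 x2. sw y
  (\<lambda>y1 y2. ptensor H HH (amul H x1 y1) (ptensor H H x2 y2))))"

lemma UH_lcoact: "lcoact UH = ulco"
  by (simp add: universal_bicalc_def rcalc.defs bicalc.defs ulco_def cop_def fun_eq_iff)

lemma ulco_lin: "linear_on HH (tensor H HH) ulco"
proof -
  note [simp] = tw
  show ?thesis unfolding ulco_def by simp
qed

lemmas [tw] = linear_rules[OF ulco_lin vect_tensor vect_tensor]
lemmas [push] = linear_push[OF ulco_lin vect_tensor vect_tensor]
lemmas [additive] = linear_additive[OF ulco_lin vect_tensor vect_tensor] bilinear_additive[OF mulH vectH vectH vectH]

lemma ulco_eval [push]: "x \<in> carr H \<Longrightarrow> y \<in> carr H \<Longrightarrow> ulco (ptensor H H x y) = sw x (\<lambda>x1 x2. sw y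
  (\<lambda>y1 y2. ptensor H HH (amul H x1 y1) (ptensor H H x2 y2)))"
  by (simp add: ulco_def tw tsum_rules[where U="tensor H HH"] cong: sw_cong)

lemma UH_facts:
  shows UH_sub: "carr UH \<subseteq> carr HH" "scl UH = scl HH"
    and UH_fodc: "fodc H UH"
    and UH_rco: "linear_on UH (tensor UH H) (rcoact UH)"
    and UH_gen: "x \<in> carr H \<Longrightarrow> y \<in> carr H \<Longrightarrow> lmul UH x (dif UH y) = ptensor H H x y - ptensor H H (amul H x y) (aone H)"
    and UH_gen_in: "x \<in> carr H \<Longrightarrow> y \<in> carr H \<Longrightarrow> lmul UH x (dif UH y) \<in> carr UH"
    and UH_generated: "t \<in> carr UH \<Longrightarrow> tsum H H t (\<lambda>x y. lmul UH x (dif UH y)) = t"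
    and UH_rco_gen: "x \<in> carr H \<Longrightarrow> y \<in> carr H \<Longrightarrow> rcoact UH (lmul UH x (dif UH y)) =
      sw x (\<lambda>x1 x2. sw y (\<lambda>y1 y2. ptensor UH H (lmul UH x1 (dif UH y1)) (amul H x2 y2)))"
proof -
  interpret S: comodule_algebra H "self_comodalg H" by unfold_locales (rule self_comodule_algebra)
  have t: "tensor H (self_comodalg H) = HH" "ptensor H (self_comodalg H) = ptensor H H"
    "tsum H (self_comodalg H) = tsum H H"
    by (rule tensor_cong; simp)+
  have u: "tensor US H = tensor UH H" "ptensor US H = ptensor UH H" by (rule tensor_cong; simp add: UH_simps)+
  have p: "ptensor UH H = ptensor HH H" by (rule ptensor_cong) (simp_all add: UH_simps S.U_simps t)
  show "carr UH \<subseteq> carr HH" "scl UH = scl HH" by (auto simp: UH_simps S.U_simps t)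
  show "fodc H UH" using S.universal_fodc by (subst fodc_cong[where A'="self_comodalg H" and \<Omega>'=US]) (simp_all add: UH_simps)
  show "linear_on UH (tensor UH H) (rcoact UH)" using S.uco_covariant by (simp add: linear_on_def UH_simps u)
  show "x \<in> carr H \<Longrightarrow> y \<in> carr H \<Longrightarrow> lmul UH x (dif UH y) = ptensor H H x y - ptensor H H (amul H x y) (aone H)"
    using S.ul_ud[of x y] by (simp add: UH_simps S.U_simps t)
  show "x \<in> carr H \<Longrightarrow> y \<in> carr H \<Longrightarrow> lmul UH x (dif UH y) \<in> carr UH"
    using S.ul_ud_in[of x y] by (simp add: UH_simps S.U_simps(3,5))
  show "t \<in> carr UH \<Longrightarrow> tsum H H t (\<lambda>x y. lmul UH x (dif UH y)) = t"
    using S.U_generated[of t] by (simp add: UH_simps S.U_simps(3,5) t)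
  show "x \<in> carr H \<Longrightarrow> y \<in> carr H \<Longrightarrow> rcoact UH (lmul UH x (dif UH y)) =
      sw x (\<lambda>x1 x2. sw y (\<lambda>y1 y2. ptensor UH H (lmul UH x1 (dif UH y1)) (amul H x2 y2)))"
    unfolding p using S.uco_gen[of x y] by (simp add: UH_simps S.U_simps(3-6) t)
qed

lemma UH_bicovariant: "bicovariant_fodc H UH"
proof -
  have p: "ptensor H UH = ptensor H HH" by (rule ptensor_cong) (simp_all add: UH_sub)
  have g: "ulco (lmul UH x (dif UH y)) = sw x (\<lambda>x1 x2. sw y (\<lambda>y1 y2. ptensor H UH (amul H x1 y1) (lmul UH x2 (dif UH y2))))"
    if [simp]: "x \<in> carr H" "y \<in> carr H" for x y
  proof -
    note [simp] = tw push additive UH_gen hopf_sw[where U="tensor H HH"] hopf_sw[where U="HH"]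
    note [simp del] = minus_apply plus_fun_apply zero_fun_apply
    note [cong] = sw_cong
    show ?thesis unfolding p by simp
  qed
  have vUH: "vect UH" using UH_fodc by (simp add: fodc_def left_module_def)
  have i: "ulco t \<in> carr (tensor H UH)" if t: "t \<in> carr UH" for t
  proof -
    note [simp] = tw vUH
    have t': "t \<in> carr HH" using t UH_sub by auto
    have m: "lmul UH x (dif UH y) \<in> carr HH" if "x \<in> carr H" "y \<in> carr H" for x y
      using UH_gen_in[OF that] UH_sub by auto
    have e: "ulco t = tsum H H t (\<lambda>x y. ulco (lmul UH x (dif UH y)))"
      using UH_generated[OF t, THEN arg_cong, of ulco] t' m by (simp add: push)
    have "tsum H H t (\<lambda>x y. ulco (lmul UH x (dif UH y))) \<in> carr (tensor H UH)"
      using t' by (intro tsum_in) (simp_all add: g UH_gen_in)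
    then show ?thesis using e by simp
  qed
  interpret G: bicov_generators H UH
  proof unfold_locales
    show "fodc H UH" by (rule UH_fodc)
    show "linear_on UH (tensor UH H) (rcoact UH)" by (rule UH_rco)
    show "linear_on UH (tensor H UH) (lcoact UH)"
      unfolding UH_lcoact
    proof (rule linear_onI)
      show "ulco (v + v') = ulco v + ulco v'" if "v \<in> carr UH" "v' \<in> carr UH" for v v'
        using that UH_sub(1) linear_on_add[OF ulco_lin] by blast
      show "ulco (scl UH c v) = scl (tensor H UH) c (ulco v)" if "v \<in> carr UH" for c v
        using that UH_sub linear_on_scl[OF ulco_lin] by (auto simp: scl_tensor)
    qed (rule i)
  qed (use UH_rco_gen g in \<open>simp_all add: UH_lcoact\<close>)
  show ?thesis by (rule G.bicovariant)
qed

end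

section \<open>Cleft extensions\<close>

text \<open>
  A comodule algebra with a colinear section \<open>\<gamma>\<close> of \<open>H\<close> that has a convolution inverse \<open>\<delta>\<close>.  Such a
  cleft extension plays the role of a trivial bundle; the locale collects what regularity uses of a crossed product.
\<close>

locale cleft = comodule_algebra H A for H :: "('h::ab_group_add, 'k::field, 'z) hopf_scheme"
  and A :: "('a::ab_group_add, 'k, 'h, 'y) comodalg_scheme" +
  fixes \<gamma> \<delta> :: "'h \<Rightarrow> 'a"
  assumes gam_lin: "linear_on H A \<gamma>" and del_lin: "linear_on H A \<delta>"
    and gam_one: "\<gamma> (aone H) = aone A"
    and gam_del: "\<And>h. h \<in> carr H \<Longrightarrow> sw h (\<lambda>h1 h2. amul A (\<gamma> h1) (\<delta> h2)) = scl A (counit H h) (aone A)"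
    and del_gam: "\<And>h. h \<in> carr H \<Longrightarrow> sw h (\<lambda>h1 h2. amul A (\<delta> h1) (\<gamma> h2)) = scl A (counit H h) (aone A)"
    and coact_gam [push]: "\<And>h. h \<in> carr H \<Longrightarrow> coact A (\<gamma> h) = sw h (\<lambda>h1 h2. ptensor A H (\<gamma> h1) h2)"
    and coact_del [push]: "\<And>h. h \<in> carr H \<Longrightarrow> coact A (\<delta> h) = sw h (\<lambda>h1 h2. ptensor A H (\<delta> h2) (antipode H h1))"
begin

lemmas [tw] = linear_rules[OF gam_lin vectH vectA] linear_rules[OF del_lin vectH vectA]
lemmas [push] = linear_push[OF gam_lin vectH vectA] linear_push[OF del_lin vectH vectA]

sublocale UF: bicov H UH
  by unfold_locales (rule UH_bicovariant)

abbreviation "X \<equiv> UF.coinv"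
abbreviation "varpi \<equiv> UF.varpi"
abbreviation "AX \<equiv> tensor A X"

text \<open>
  A coinvariant form of the universal calculus is an element of \<open>H \<otimes> H\<close>, and \<open>\<epsilon> \<otimes> id\<close> recovers \<open>h\<close> from \<open>varpi h\<close>
  up to \<open>\<epsilon>(h) 1\<close> (\<open>eX_varpi\<close>).  This makes the connection \<open>cU\<close> definable on all coinvariant forms without choosing
  preimages under \<open>varpi\<close>.
\<close>

definition eX where "eX t = tsum H H t (\<lambda>x y. scl H (counit H x) y)"
definition verU where "verU t = tsum A A t (\<lambda>a a'. tsum A H (coact A a') (\<lambda>a0 h. ptensor A X (amul A a a0) (varpi h)))"
definition cU where "cU u = tsum A X u (\<lambda>a x. sw (eX x) (\<lambda>h1 h2. ptensor A A (amul A a (\<delta> h1)) (\<gamma> h2)))"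
definition lactU where "lactU a u = tsum A X u (\<lambda>a' x. ptensor A X (amul A a a') x)"
definition dcoX where "dcoX u = tsum A X u (\<lambda>v w. tsum A H (coact A v) (\<lambda>v0 v1. tsum X H (rcoact UH w)
         (\<lambda>w0 w1. ptensor AX H (ptensor A X v0 w0) (amul H v1 w1))))"
definition base where "base a = tsum A H (coact A a) (\<lambda>x k. amul A x (\<delta> k))"

lemma X_sub: "carr X \<subseteq> carr HH" "scl X = scl HH"
  using UF.coinvD(1) UH_sub by (auto simp: UF.coinv_scl)

lemma eX_lin: "linear_on X H eX"
proof (rule linear_on_restrict[OF _ X_sub])
  note [simp] = tw
  show "linear_on HH H eX" unfolding eX_def by simp
qed
lemmas [tw] = linear_rules[OF eX_lin UF.vect_coinv vectH] linear_rules[OF UF.rco_coinv UF.vect_coinv vect_tensor]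

lemma verU_lin: "linear_on AA AX verU" and cU_lin: "linear_on AX AA cU" and lactU_bil: "bilinear_on A AX AX lactU"
  and dcoX_lin: "linear_on AX (tensor AX H) dcoX" and base_lin: "linear_on A A base"
proof -
  note [simp] = tw
  show "linear_on AA AX verU" unfolding verU_def by simp
  show "linear_on AX AA cU" unfolding cU_def by simp
  show "bilinear_on A AX AX lactU" unfolding lactU_def by (intro bilinear_onI) simp_all
  show "linear_on AX (tensor AX H) dcoX" unfolding dcoX_def by simp
  show "linear_on A A base" unfolding base_def by simp
qed

lemmas [tw] = linear_rules[OF verU_lin vect_tensor vect_tensor] linear_rules[OF cU_lin vect_tensor vect_tensor]
  linear_rules[OF dcoX_lin vect_tensor vect_tensor] linear_rules[OF base_lin vectA vectA]
  bilinear_rules[OF lactU_bil vectA vect_tensor vect_tensor]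
lemmas [push] = linear_push[OF verU_lin vect_tensor vect_tensor] linear_push[OF cU_lin vect_tensor vect_tensor]
  linear_push[OF base_lin vectA vectA] linear_push[OF dcoX_lin vect_tensor vect_tensor]
  bilinear_push[OF lactU_bil vectA vect_tensor vect_tensor]
lemmas [additive] = linear_additive[OF verU_lin vect_tensor vect_tensor] linear_additive[OF cU_lin vect_tensor vect_tensor]
  linear_additive[OF base_lin vectA vectA] linear_additive[OF dcoX_lin vect_tensor vect_tensor]
  bilinear_additive[OF lactU_bil vectA vect_tensor vect_tensor]

lemma eX_varpi:
  assumes h [simp]: "h \<in> carr H"
  shows "eX (varpi h) = h - scl H (counit H h) (aone H)"
proof -
  note [simp] = tw push additive UF.varpi_eq UH_gen hopf_sw[where U=H]
  note [simp del] = minus_apply plus_fun_apply zero_fun_apply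
  note [cong] = sw_cong
  have l: "linear_on HH H eX" unfolding eX_def by simp
  note [simp] = linear_rules[OF l vect_tensor vectH] linear_push[OF l vect_tensor vectH] linear_additive[OF l
      vect_tensor vectH]
  have e: "eX (ptensor H H x y) = scl H (counit H x) y" if "x \<in> carr H" "y \<in> carr H" for x y
    using that by (simp add: eX_def)
  show ?thesis by (simp add: e scl_mult)
qed

lemma del_one: "\<delta> (aone H) = aone A"
proof -
  note [simp] = tw push tsum_rules[where U=A]
  show ?thesis using del_gam[OF oneH] by (simp add: gam_one scl_one)
qed

lemma verU_eval [push]: "a \<in> carr A \<Longrightarrow> a' \<in> carr A \<Longrightarrow>
    verU (ptensor A A a a') = tsum A H (coact A a') (\<lambda>a0 h. ptensor A X (amul A a a0) (varpi h))"
  by (simp add: verU_def tw tsum_rules[where U=AX] cong: sw_cong)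

lemma lactU_eval [push]: "a \<in> carr A \<Longrightarrow> a' \<in> carr A \<Longrightarrow> x \<in> carr X \<Longrightarrow>
    lactU a (ptensor A X a' x) = ptensor A X (amul A a a') x"
  by (simp add: lactU_def tw tsum_rules[where U=AX] cong: sw_cong)

lemma cU_eval [push]:
  assumes [simp]: "a \<in> carr A" "h \<in> carr H"
  shows "cU (ptensor A X a (varpi h)) = sw h (\<lambda>h1 h2. ptensor A A (amul A a (\<delta> h1)) (\<gamma> h2))
     - scl AA (counit H h) (ptensor A A a (aone A))"
proof -
  let ?F = "\<lambda>t. tsum H H t (\<lambda>h1 h2. ptensor A A (amul A a (\<delta> h1)) (\<gamma> h2))"
  have l: "linear_on HH AA ?F" by (simp add: tw)
  have "cU (ptensor A X a (varpi h)) = ?F (comul H (eX (varpi h)))"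
    by (simp add: cU_def tw tsum_rules[where U=AA] cong: sw_cong)
  also have "comul H (eX (varpi h)) = comul H h - scl HH (counit H h) (ptensor H H (aone H) (aone H))"
    by (simp add: eX_varpi tw linear_on_diff[OF comulH vectH] linear_on_scl[OF comulH] comul_one)
  also have "?F \<dots> = ?F (comul H h) - scl AA (counit H h) (?F (ptensor H H (aone H) (aone H)))"
    by (simp add: linear_on_diff[OF l vect_tensor] linear_on_scl[OF l] tw)
  also have "?F (ptensor H H (aone H) (aone H)) = ptensor A A a (aone A)"
    by (simp add: tw push tsum_rules[where U=AA] gam_one del_one cong: sw_cong)
  finally show ?thesis .
qed

lemma AX_eqI:
  assumes F: "linear_on AX U F" and G: "linear_on AX U G" and U: "vect U"
    and eq: "\<And>a h. a \<in> carr A \<Longrightarrow> h \<in> carr H \<Longrightarrow> F (ptensor A X a (varpi h)) = G (ptensor A X a (varpi h))"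
    and u: "u \<in> carr AX"
  shows "F u = G u"
proof (rule tensor_eqI[OF F G U _ u])
  fix a x assume a: "a \<in> carr A" and x: "x \<in> carr X"
  have p: "linear_on X AX (ptensor A X a)"
    by (rule bilinear_on_right[OF ptensor_bilinear[OF vectA UF.vect_coinv] a])
  show "F (ptensor A X a x) = G (ptensor A X a x)"
    by (rule UF.coinv_eqI[OF linear_on_compose[OF F p] linear_on_compose[OF G p] eq[OF a] x])
qed

lemma verU_cU: assumes u: "u \<in> carr AX" shows "verU (cU u) = u"
proof -
  note [simp] = tw push additive hopf_sw[where U=AX] srt
  note [simp del] = minus_apply plus_fun_apply zero_fun_apply
  note [cong] = sw_cong
  show ?thesis
  proof (rule AX_eqI[OF _ _ _ _ u, where U=AX])
    fix a h assume [simp]: "a \<in> carr A" "h \<in> carr H"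
    have "verU (cU (ptensor A X a (varpi h))) = sw h (\<lambda>p h3.
      ptensor A X (amul A a (sw p (\<lambda>h1 h2. amul A (\<delta> h1) (\<gamma> h2)))) (varpi h3))"
      by simp
    also have "\<dots> = ptensor A X a (varpi h)" by (simp add: del_gam)
    finally show "verU (cU (ptensor A X a (varpi h))) = ptensor A X a (varpi h)" .
  qed simp_all
qed

lemma um_cU: assumes u: "u \<in> carr AX" shows "um (cU u) = 0"
proof -
  note [simp] = tw push additive hopf_sw[where U=A] srt
  note [simp del] = minus_apply plus_fun_apply zero_fun_apply
  note [cong] = sw_cong
  show ?thesis
  proof (rule AX_eqI[OF _ _ _ _ u, where U=A and G="\<lambda>_. 0"])
    fix a h assume [simp]: "a \<in> carr A" "h \<in> carr H"
    have "um (cU (ptensor A X a (varpi h))) = amul A a (sw h (\<lambda>h1 h2. amul A (\<delta> h1) (\<gamma> h2))) - scl A (counit H h) a"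
      by simp
    also have "\<dots> = 0" by (simp add: del_gam)
    finally show "um (cU (ptensor A X a (varpi h))) = 0" .
  qed (simp_all add: linear_on_const_zero)
qed

lemma cU_in: "u \<in> carr AX \<Longrightarrow> cU u \<in> carr UA"
  by (simp add: U_simps um_cU tw)

lemma verU_ul: assumes a [simp]: "a \<in> carr A" and t: "t \<in> carr AA" shows "verU (ul a t) = lactU a (verU t)"
proof -
  note [simp] = tw push A_sw[where U=AX] srtA
  note [cong] = sw_cong
  show ?thesis by (rule tensor_eqI[OF _ _ _ _ t, where U=AX]) simp_all
qed

lemma cU_lact: assumes a [simp]: "a \<in> carr A" and u: "u \<in> carr AX" shows "cU (lactU a u) = ul a (cU u)"
proof -
  note [simp] = tw push additive hopf_sw[where U=AA] srt
  note [simp del] = minus_apply plus_fun_apply zero_fun_apply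
  note [cong] = sw_cong
  show ?thesis by (rule AX_eqI[OF _ _ _ _ u, where U=AA]) simp_all
qed

lemma lactU_module: "left_module A AX lactU"
proof -
  note [simp] = tw push
  note [cong] = sw_cong
  have 1: "lactU (aone A) u = u" if "u \<in> carr AX" for u
    by (rule tensor_eqI[OF _ _ _ _ that, where U=AX]) simp_all
  have 2: "lactU (amul A a b) u = lactU a (lactU b u)" if [simp]: "a \<in> carr A" "b \<in> carr A" and u: "u \<in> carr AX" for a b u
    by (rule tensor_eqI[OF _ _ _ _ u, where U=AX]) simp_all
  show ?thesis unfolding left_module_def using lactU_bil vect_tensor 1 2 by simp
qed

lemma cU_colinear:
  assumes u: "u \<in> carr AX"
  shows "uco (cU u) = tsum AX H (dcoX u) (\<lambda>u h. ptensor AA H (cU u) h)"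
proof -
  let ?U = "tensor AA H"
  note [simp] = tw push additive A_sw[where U="tensor AX H"] A_sw[where U="?U"] srtA
  note [simp del] = minus_apply plus_fun_apply zero_fun_apply
  have rv: "rcoact UH (varpi h) = sw h (\<lambda>h1 r. sw r (\<lambda>h2 h3. ptensor X H (varpi h2) (amul H (antipode H h1) h3)))"
    if "h \<in> carr H" for h using UF.rco_varpi[OF that] by (simp only: UF.coinv_ptensor)
  note [cong] = sw_cong
  show ?thesis
  proof (rule AX_eqI[OF _ _ _ _ u, where U="?U" and F="\<lambda>u. uco (cU u)" and G="\<lambda>u. tsum AX H (dcoX u) (\<lambda>u h.
      ptensor AA H (cU u) h)"])
    fix a h assume [simp]: "a \<in> carr A" "h \<in> carr H"
    have "tsum AX H (dcoX (ptensor A X a (varpi h))) (\<lambda>u h. ptensor AA H (cU u) h) =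
       tsum A H (coact A a) (\<lambda>a0 a1. sw h (\<lambda>h1 r. sw r (\<lambda>h2 s. sw s (\<lambda>h3 h4.
         ptensor AA H (ptensor A A (amul A a0 (\<delta> h2)) (\<gamma> h3)) (amul H a1 (amul H (antipode H h1) h4)))))) -
       tsum A H (coact A a) (\<lambda>a0 a1. ptensor AA H (ptensor A A a0 (aone A)) (amul H a1 (sw h (\<lambda>h1 h2. amul H
           (antipode H h1) h2))))"
      by (simp add: dcoX_def rv)
    also have "\<dots> = uco (cU (ptensor A X a (varpi h)))" by (simp add: antipode_left)
    finally show "uco (cU (ptensor A X a (varpi h))) = tsum AX H (dcoX (ptensor A X a (varpi h))) (\<lambda>u h. ptensor
        AA H (cU u) h)" ..
  qed simp_all
qed

text \<open>
  In \<open>a\<^sub>0 \<delta>(a\<^sub>1)\<close> the coaction of the second factor cancels that of the first by the antipode.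
\<close>

lemma base_coinv: assumes a [simp]: "a \<in> carr A" shows "base a \<in> right_coinv H A"
proof -
  have m: "base a \<in> carr A" by (simp add: tw)
  note [simp] = tw push A_sw[where U="tensor A H"] tsum_swap[of H H _ A H]
  note [cong] = sw_cong
  have "coact A (base a) = tsum A H (coact A a) (\<lambda>x k. sw k (\<lambda>p s.
      ptensor A H (amul A x (\<delta> s)) (sw p (\<lambda>h1 h2. amul H h1 (antipode H h2)))))"
    by (simp add: base_def)
  also have "\<dots> = ptensor A H (base a) (aone H)" by (simp add: antipode_right base_def)
  finally show ?thesis using m by (simp add: right_coinv_def)
qed

lemma base_gam:
  assumes a [simp]: "a \<in> carr A" shows "tsum A H (coact A a) (\<lambda>x h. amul A (base x) (\<gamma> h)) = a"
proof -
  note [simp] = tw push A_sw[where U=A] srtA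
  note [cong] = sw_cong
  have "tsum A H (coact A a) (\<lambda>x h. amul A (base x) (\<gamma> h)) = tsum A H (coact A a) (\<lambda>x p.
      amul A x (sw p (\<lambda>h1 h2. amul A (\<delta> h1) (\<gamma> h2))))"
    by (simp add: base_def)
  also have "\<dots> = a" by (simp add: del_gam)
  finally show ?thesis .
qed

text \<open>
  Both sides are \<open>1 \<otimes> a - a\<^sub>0 \<delta>(a\<^sub>1) \<otimes> \<gamma>(a\<^sub>2)\<close>.
\<close>

lemma strong_formula:
  assumes a [simp]: "a \<in> carr A"
  shows "ud a - cU (verU (ud a)) = tsum A H (coact A a) (\<lambda>x h. ur (ud (base x)) (\<gamma> h))"
proof -
  note [simp] = tw push additive A_sw[where U=AA] srtA
  note [simp del] = minus_apply plus_fun_apply zero_fun_apply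
  note [cong] = sw_cong
  have 1: "ud a - cU (verU (ud a)) = ptensor A A (aone A) a - tsum A H (coact A a) (\<lambda>x r. sw r (\<lambda>h1 h2. ptensor
      A A (amul A x (\<delta> h1)) (\<gamma> h2)))"
    by (simp add: ud_def gam_one del_one)
  have "tsum A H (coact A a) (\<lambda>x h. ur (ud (base x)) (\<gamma> h)) = ptensor A A (aone A) (tsum A H (coact A a) (\<lambda>x h.
      amul A (base x) (\<gamma> h)))
     - tsum A H (coact A a) (\<lambda>x h. ptensor A A (base x) (\<gamma> h))"
    by (simp add: ud_def)
  also have "tsum A H (coact A a) (\<lambda>x h. ptensor A A (base x) (\<gamma> h)) = tsum A H (coact A a) (\<lambda>x r. sw r (\<lambda>h1 h2.
      ptensor A A (amul A x (\<delta> h1)) (\<gamma> h2)))"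
    by (simp add: base_def)
  finally show ?thesis unfolding 1 by (simp only: base_gam[OF a])
qed

lemma universal_vertical: "vertical_map H A UA UH verU"
  unfolding vertical_map_def UF.X_coinv cop_def
proof (intro conjI ballI)
  show "linear_on UA AX verU" by (rule linear_on_restrict[OF verU_lin]) (auto simp: U_simps)
  fix a a' assume [simp]: "a \<in> carr A" "a' \<in> carr A"
  note [simp] = tw push additive tsum_rules[where U=AX]
  note [simp del] = minus_apply plus_fun_apply zero_fun_apply
  note [cong] = sw_cong
  have "verU (lmul UA a (dif UA a')) = tsum A H (coact A a') (\<lambda>a0 h. ptensor A X (amul A a a0) (varpi h))"
    unfolding U_simps by (simp add: ul_ud)
  also have "\<dots> = tsum A H (coact A a') (\<lambda>a0 h. ptensor A X (amul A a a0) (sw h (\<lambda>h1 h2. lmul UH (antipode H h1)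
      (dif UH h2))))"
    by (intro tsum_cong refl) (simp_all del: push add: UF.varpi_eq)
  finally show "verU (lmul UA a (dif UA a')) = tsum A H (coact A a') (\<lambda>a0 h. ptensor A X (amul A a a0) (sw h
      (\<lambda>h1 h2. lmul UH (antipode H h1) (dif UH h2))))" .
qed

lemma universal_module: "left_module A UA (lmul UA)"
  using universal_fodc by (simp add: fodc_def)

lemma one_coinv: "aone A \<in> right_coinv H A"
  by (simp add: right_coinv_def tw coact_one)

lemma coinv_sub: "right_coinv H A \<subseteq> carr A"
  by (auto simp: right_coinv_def)

lemma pullback_sub: "pullback_forms UA (right_coinv H A) \<subseteq> carr UA"
  unfolding pullback_forms_def
  by (rule span_carr[OF vect_U]) (use ul_ud_in coinv_sub in \<open>auto simp: U_simps(3,5)\<close>)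

lemma ud_base: assumes "x \<in> carr A" shows "ud (base x) \<in> pullback_forms UA (right_coinv H A)"
proof -
  have "ud (base x) = lmul UA (aone A) (dif UA (base x))"
    using left_module_def universal_module ud_in[of "base x"] base_lin assms linear_on_in[OF base_lin assms]
    by (simp add: left_module_def U_simps(5))
  then show ?thesis
    unfolding pullback_forms_def using base_coinv[OF assms] one_coinv by (intro span_base'[OF vect_U]) blast
qed

lemma universal_strong_connection:
  assumes a: "a \<in> carr A"
  shows "dif UA a - cU (verU (dif UA a)) \<in>
    vspan UA {rmul UA \<beta> a' | \<beta> a'. \<beta> \<in> pullback_forms UA (right_coinv H A) \<and> a' \<in> carr A}" (is "_ \<in> vspan UA ?S")
proof -
  let ?K = "\<lparr> carr = vspan UA ?S, scl = scl UA \<rparr>"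
  have "tsum A H (coact A a) (\<lambda>x h. ur (ud (base x)) (\<gamma> h)) \<in> carr ?K"
  proof (rule tsum_into_subspace[OF vect_span[OF vect_U] vectA])
    fix x h assume "x \<in> carr A" "h \<in> carr H"
    then have "ur (ud (base x)) (\<gamma> h) \<in> ?S" using ud_base linear_on_in[OF gam_lin] by (auto simp: U_simps(4))
    then show "ur (ud (base x)) (\<gamma> h) \<in> carr ?K" by (simp only: vs.select_convs span_base'[OF vect_U])
  qed (rule linear_on_in[OF coact_lin a])
  then show ?thesis using strong_formula[OF a] by (simp only: U_simps(5) vs.select_convs)
qed

lemma universal_connection: "strong_connection H A UA UH verU cU"
  unfolding strong_connection_def connection_def Let_def UF.X_coinv left_module_hom_def
proof (intro conjI ballI universal_strong_connection)
  have l: "left_act_tensor A X = lactU" by (simp add: fun_eq_iff left_act_tensor_def lactU_def)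
  have d: "diagonal_coaction H A (coact A) X (rcoact UH) = dcoX"
    by (simp add: fun_eq_iff diagonal_coaction_def dcoX_def)
  show "linear_on AX UA cU"
    using cU_in linear_on_add[OF cU_lin] linear_on_scl[OF cU_lin] by (intro linear_onI) (simp_all add: U_simps(2))
  show "cU (left_act_tensor A X a u) = lmul UA a (cU u)" if "a \<in> carr A" "u \<in> carr AX" for a u
    using cU_lact[OF that] by (simp add: l U_simps(3))
  fix u assume u: "u \<in> carr AX"
  show "rcoact UA (cU u) = tsum AX H (diagonal_coaction H A (coact A) X (rcoact UH) u) (\<lambda>u h. ptensor UA H (cU u) h)"
    using cU_colinear[OF u] by (simp only: d U_simps(6) U_tensor)
  show "verU (cU u) = u" by (rule verU_cU[OF u])
qed

text \<open>
  Elements of the base have trivial coaction, so for \<open>b\<close>, \<open>b'\<close> in the base the two terms of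
  \<open>a b (db') a' = a b \<otimes> b' a' - a b b' \<otimes> a'\<close> have the same image.
\<close>

lemma verU_horizontal_gen:
  assumes a: "a \<in> carr A" and b: "\<beta> \<in> pullback_forms UA (right_coinv H A)" and a': "a' \<in> carr A"
  shows "verU (ur (ul a \<beta>) a') = 0"
proof -
  let ?S = "{lmul UA b (dif UA b') | b b'. b \<in> right_coinv H A \<and> b' \<in> right_coinv H A}"
  have S: "?S \<subseteq> carr UA" using ul_ud_in coinv_sub by (auto simp: U_simps(3,5))
  have l: "linear_on AA AX (\<lambda>\<beta>. verU (ur (ul a \<beta>) a'))" using a a' by (simp add: tw)
  show ?thesis
  proof (rule span_eqI[OF vect_U S b[unfolded pullback_forms_def], where U=AX and F="\<lambda>\<beta>. verU (ur (ul a \<beta>) a')"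
      and G="\<lambda>_. 0"])
    show "linear_on UA AX (\<lambda>\<beta>. verU (ur (ul a \<beta>) a'))" by (rule linear_on_restrict[OF l]) (auto simp: U_simps)
    show "linear_on UA AX (\<lambda>_. 0)" by (rule linear_on_const_zero[OF vect_tensor])
    fix w assume "w \<in> ?S"
    then obtain b b' where w: "w = ul b (ud b')" and b: "b \<in> carr A" "b' \<in> carr A" "coact A b' = ptensor A H b' (aone H)"
      by (auto simp: right_coinv_def U_simps(3,5))
    note [simp] = tw push additive A_sw[where U=AX] a a' b
    note [simp del] = minus_apply plus_fun_apply zero_fun_apply
    note [cong] = sw_cong
    show "verU (ur (ul a w) a') = 0" unfolding w by (simp add: ul_ud)
  qed
qed

lemma ul_ur: assumes t: "t \<in> carr AA" and [simp]: "a \<in> carr A" "b \<in> carr A" shows "ur (ul a t) b = ul a (ur t b)"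
proof -
  note [simp] = tw push
  show ?thesis by (rule tensor_eqI[OF _ _ _ _ t, where U=AA]) simp_all
qed

text \<open>
  A form \<open>\<Sum> x dy\<close> with vanishing vertical part equals \<open>\<Sum> x (dy - c(ver(dy)))\<close>, as \<open>c \<circ> ver\<close> is left linear; by
  \<open>strong_formula\<close> this is horizontal.
\<close>

lemma universal_horizontal: "carr (horizontal_forms H A UA) = {t \<in> carr UA. verU t = 0}"
proof -
  let ?P = "pullback_forms UA (right_coinv H A)"
  let ?S = "{rmul UA (lmul UA a \<beta>) a' |a \<beta> a'. a \<in> carr A \<and> \<beta> \<in> ?P \<and> a' \<in> carr A}"
  let ?K = "\<lparr> carr = vspan UA ?S, scl = scl UA \<rparr>"
  have K: "vect ?K" by (rule vect_span[OF vect_U])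
  have S: "?S \<subseteq> carr UA"
  proof
    fix w assume "w \<in> ?S"
    then obtain a \<beta> a' where w: "w = rmul UA (lmul UA a \<beta>) a'" "a \<in> carr A" "\<beta> \<in> carr UA" "a' \<in> carr A"
      using pullback_sub by blast
    have "bilinear_on A UA UA (lmul UA)" "bilinear_on UA A UA (rmul UA)"
      using universal_fodc by (simp_all add: fodc_def left_module_def right_module_def)
    from bilinear_rules(1)[OF this(2) vect_U vectA vect_U bilinear_rules(1)[OF this(1) vectA vect_U vect_U w(2,3)] w(4)]
    show "w \<in> carr UA" by (simp only: w(1))
  qed
  have l: "linear_on UA AX verU" by (rule linear_on_restrict[OF verU_lin]) (auto simp: U_simps)
  have "verU t = 0" if "t \<in> vspan UA ?S" for t
    by (rule span_eqI[OF vect_U S that l linear_on_const_zero[OF vect_tensor]]) (auto simp: U_simps(3,4) verU_horizontal_gen)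
  moreover have "t \<in> vspan UA ?S" if t: "t \<in> carr UA" and z: "verU t = 0" for t
  proof -
    have t': "t \<in> carr AA" using t by (simp add: U_simps)
    have 1: "tsum A A t (\<lambda>x y. ul x (cU (verU (ud y)))) = 0"
    proof -
      note [simp] = tw push
      note [cong] = sw_cong
      have "cU (verU t) = cU (verU (tsum A A t (\<lambda>x y. ul x (ud y))))" by (simp only: U_generated[OF t])
      also have "\<dots> = tsum A A t (\<lambda>x y. ul x (cU (verU (ud y))))" using t' by (simp add: verU_ul cU_lact)
      finally show ?thesis using linear_on_zero[OF cU_lin vect_tensor] by (simp only: z)
    qed
    have "t = tsum A A t (\<lambda>x y. ul x (ud y)) - tsum A A t (\<lambda>x y. ul x (cU (verU (ud y))))"
      by (simp only: 1 U_generated[OF t] diff_zero)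
    also have "\<dots> = tsum A A t (\<lambda>x y. ul x (ud y - cU (verU (ud y))))"
      unfolding tsum_minus[symmetric] using t'
      by (intro tsum_cong refl vectA t' bilinear_additive(4)[OF ul_bil vectA vect_tensor vect_tensor,
          symmetric]) (simp_all add: tw)
    also have "\<dots> = tsum A A t (\<lambda>x y. tsum A H (coact A y) (\<lambda>z h. ur (ul x (ud (base z))) (\<gamma> h)))"
    proof -
      note [simp] = tw push
      note [cong] = sw_cong
      show ?thesis using t' by (simp add: strong_formula ul_ur)
    qed
    also have "\<dots> \<in> carr ?K"
    proof (intro tsum_into_subspace[OF K vectA] t' linear_on_in[OF coact_lin])
      fix x z h assume "x \<in> carr A" "z \<in> carr A" "h \<in> carr H"
      then have "ur (ul x (ud (base z))) (\<gamma> h) \<in> ?S"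
        unfolding U_simps(3,4) using ud_base linear_on_in[OF gam_lin] by blast
      then show "ur (ul x (ud (base z))) (\<gamma> h) \<in> carr ?K" by (simp only: vs.select_convs span_base'[OF vect_U])
    qed
    finally show ?thesis by (simp only: vs.select_convs)
  qed
  ultimately show ?thesis using span_carr[OF vect_U S] by (auto simp: horizontal_forms_def)
qed

lemma universal_qpb: "quantum_principal_bundle H A UA UH"
proof (rule quantum_principal_bundleI[OF comod_alg universal_covariant UH_bicovariant universal_vertical])
  have l: "left_act_tensor A X = lactU" by (simp add: fun_eq_iff left_act_tensor_def lactU_def)
  have lin: "linear_on UA AX verU" by (rule linear_on_restrict[OF verU_lin]) (auto simp: U_simps)
  show "left_module A (tensor A (left_coinv_forms H UH)) (left_act_tensor A (left_coinv_forms H UH))"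
    using lactU_module by (simp only: UF.X_coinv l)
  show "left_module_hom A UA (lmul UA) (tensor A (left_coinv_forms H UH)) (left_act_tensor A (left_coinv_forms H UH)) verU"
    using lin verU_ul by (simp add: left_module_hom_def UF.X_coinv l U_simps)
  show "verU ` carr UA = carr (tensor A (left_coinv_forms H UH))"
    unfolding UF.X_coinv using linear_on_in[OF lin] cU_in verU_cU by (auto intro!: image_eqI[OF sym])
qed (rule universal_horizontal)

abbreviation "E \<equiv> evaluation (balforms A (right_coinv H A))"
abbreviation "AB \<equiv> tensor_over A (right_coinv H A)"

lemma vect_over [tw]: "vect AB"
proof -
  interpret vector_space "\<lambda>(c::'k) t (\<phi> :: 'a \<Rightarrow> 'a \<Rightarrow> 'k). c * t \<phi>" by (rule vector_space_pointwise)
  show ?thesis by (simp add: vect_def tensor_over_def eval_space_def subspace_span vector_space_axioms)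
qed

lemma E_bil: "bilinear_on A A AB E"
proof -
  interpret vector_space "\<lambda>(c::'k) t (\<phi> :: 'a \<Rightarrow> 'a \<Rightarrow> 'k). c * t \<phi>" by (rule vector_space_pointwise)
  have *: "E v w \<in> carr AB" if "v \<in> carr A" "w \<in> carr A" for v w
    using that by (auto simp: tensor_over_def eval_space_def intro!: span_base)
  show ?thesis
    unfolding bilinear_on_def linear_on_def
    by (intro conjI ballI allI *; simp?; rule ext;
        simp add: tensor_over_def eval_space_def evaluation_def balforms_def bilforms_def linear_iff)
qed

lemmas [tw] = bilinear_rules[OF E_bil vectA vectA vect_over]
lemmas [push] = bilinear_push[OF E_bil vectA vectA vect_over]

definition can where
  "can t = tsum_over A (right_coinv H A) t (\<lambda>a a'. tsum A H (coact A a') (\<lambda>a0 a1. ptensor A H (amul A a a0) a1))"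

text \<open>
  The inverse of the Hopf-Galois map.  That it is a left inverse comes down to
  moving \<open>base x\<close>, an element of the base, across the balanced tensor product.
\<close>

definition canI where
  "canI s = tsum A H s (\<lambda>a h. sw h (\<lambda>h1 h2. E (amul A a (\<delta> h1)) (\<gamma> h2)))"

lemma can: "linear_on AB (tensor A H) can"
  and can_eval: "a \<in> carr A \<Longrightarrow> a' \<in> carr A \<Longrightarrow> can (E a a') = tsum A H (coact A a') (\<lambda>a0 a1. ptensor A H (amul A a a0) a1)"
proof -
  let ?f = "\<lambda>a a'. tsum A H (coact A a') (\<lambda>a0 a1. ptensor A H (amul A a a0) a1)"
  note [simp] = tw push
  have b: "bilinear_on A A (tensor A H) ?f" by (intro bilinear_onI) simp_all
  note [cong] = sw_cong
  have f: "?f (amul A a b) a' = ?f a (amul A b a')" if "a \<in> carr A" "b \<in> right_coinv H A" "a' \<in> carr A" for a b a'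
  proof -
    have b [simp]: "b \<in> carr A" "coact A b = ptensor A H b (aone H)" using that(2) by (simp_all add: right_coinv_def)
    show ?thesis using that(1,3) by (simp add: A_sw[where U="tensor A H"])
  qed
  show "linear_on AB (tensor A H) can" unfolding can_def
    by (rule tensor_over_universal(1)[OF algA coinv_sub vect_tensor b f])
  show "a \<in> carr A \<Longrightarrow> a' \<in> carr A \<Longrightarrow> can (E a a') = ?f a a'" unfolding can_def
    by (rule tensor_over_universal(2)[OF algA coinv_sub vect_tensor b f])
qed

lemmas [tw] = linear_rules[OF can vect_over vect_tensor]
lemmas [push] = linear_push[OF can vect_over vect_tensor] can_eval

lemma canI_lin: "linear_on (tensor A H) AB canI"
proof -
  note [simp] = tw
  show ?thesis unfolding canI_def by simp
qed

lemmas [tw] = linear_rules[OF canI_lin vect_tensor vect_over]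
lemmas [push] = linear_push[OF canI_lin vect_tensor vect_over]

lemma canI_eval: "a \<in> carr A \<Longrightarrow> h \<in> carr H \<Longrightarrow> canI (ptensor A H a h) = sw h (\<lambda>h1 h2. E (amul A a (\<delta> h1)) (\<gamma> h2))"
  by (simp add: canI_def tw tsum_rules[where U=AB] cong: sw_cong)

lemma can_canI: assumes s: "s \<in> carr (tensor A H)" shows "can (canI s) = s"
proof -
  note [simp] = tw push A_sw[where U="tensor A H"] srtA
  note [cong] = sw_cong
  show ?thesis
  proof (rule tensor_eqI[OF _ _ _ _ s, where U="tensor A H"])
    fix a h assume [simp]: "a \<in> carr A" "h \<in> carr H"
    have "can (canI (ptensor A H a h)) = sw h (\<lambda>p h3. ptensor A H (amul A a (sw p (\<lambda>h1 h2. amul A (\<delta> h1) (\<gamma> h2)))) h3)"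
      by (simp add: canI_eval)
    also have "\<dots> = ptensor A H a h" by (simp add: del_gam)
    finally show "can (canI (ptensor A H a h)) = ptensor A H a h" .
  qed simp_all
qed

lemma canI_can: assumes t: "t \<in> carr AB" shows "canI (can t) = t"
proof (rule eval_space_unique[where g="\<lambda>t. canI (can t)" and g'="\<lambda>t. t"])
  note [simp] = tw push A_sw[where U=AB] srtA
  show "vector_space (scl AB)" by (rule vect_vs[OF vect_over])
  show "linear_on (eval_space (balforms A (right_coinv H A)) (carr A) (carr A)) AB (\<lambda>t. canI (can t))"
    using linear_on_compose[OF canI_lin can] by (simp only: tensor_over_def)
  show "linear_on (eval_space (balforms A (right_coinv H A)) (carr A) (carr A)) AB (\<lambda>t. t)"
    using linear_on_id[of AB] by (simp only: tensor_over_def)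
  show "t \<in> carr (eval_space (balforms A (right_coinv H A)) (carr A) (carr A))"
    using t by (simp only: tensor_over_def)
  note [cong] = sw_cong
  fix a a' assume [simp]: "a \<in> carr A" "a' \<in> carr A"
  have "canI (can (E a a')) = tsum A H (coact A a') (\<lambda>x h. E (amul A a (base x)) (\<gamma> h))"
    by (simp add: canI_eval base_def)
  also have "\<dots> = tsum A H (coact A a') (\<lambda>x h. E a (amul A (base x) (\<gamma> h)))"
    by (intro tsum_cong refl vectA linear_on_in[OF coact_lin] balanced base_coinv) simp_all
  also have "\<dots> = E a (tsum A H (coact A a') (\<lambda>x h. amul A (base x) (\<gamma> h)))" by simp
  also have "\<dots> = E a a'" by (simp only: base_gam[OF \<open>a' \<in> carr A\<close>])
  finally show "canI (can (E a a')) = E a a'" .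
qed

lemma galois: "hopf_galois H A"
  unfolding hopf_galois_def Let_def can_def[symmetric]
  by (rule bij_betw_byWitness[where f'=canI])
    (use can_canI canI_can linear_on_in[OF can] linear_on_in[OF canI_lin] in auto)

end

section \<open>Quotients of the universal calculus\<close>

lemma (in comodule_algebra) covariant_comodule_fodc:
  assumes "right_covariant_fodc H A \<Omega>"
  shows "comodule_fodc H A \<Omega>"
proof unfold_locales
  show f: "fodc A \<Omega>" and r: "linear_on \<Omega> (tensor \<Omega> H) (rcoact \<Omega>)"
    using assms by (simp_all add: right_covariant_fodc_def right_comodule_def)
  fix x y assume [simp]: "x \<in> carr A" "y \<in> carr A"
  have v: "vect \<Omega>" and d: "linear_on A \<Omega> (dif \<Omega>)" and l: "bilinear_on A \<Omega> \<Omega> (lmul \<Omega>)"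
    using f by (simp_all add: fodc_def left_module_def)
  have "rcoact \<Omega> (lmul \<Omega> x (dif \<Omega> y)) = tsum A H (coact A x) (\<lambda>a0 a1. tsum \<Omega> H (tsum A H (coact A y) (\<lambda>a0 a1.
      ptensor \<Omega> H (dif \<Omega> a0) a1))
            (\<lambda>w0 w1. ptensor \<Omega> H (lmul \<Omega> a0 w0) (amul H a1 w1)))"
    using assms linear_on_in[OF d] by (simp add: right_covariant_fodc_def)
  also have "\<dots> = tsum A H (coact A x) (\<lambda>x0 x1. tsum A H (coact A y) (\<lambda>y0 y1. ptensor \<Omega> H (lmul \<Omega> x0 (dif \<Omega> y0))
      (amul H x1 y1)))"
    by (simp add: tw v linear_rules[OF d vectA v] bilinear_rules[OF l vectA v v] tsum_rules[where U="tensor \<Omega>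
        H"] cong: sw_cong)
  finally show "rcoact \<Omega> (lmul \<Omega> x (dif \<Omega> y)) = \<dots>" .
qed

context comodule_fodc begin

definition quot where "quot t = tsum A A t (\<lambda>x y. lmul \<Omega> x (dif \<Omega> y))"

lemma quot_lin: "linear_on AA \<Omega> quot"
proof -
  note [simp] = tw
  show ?thesis unfolding quot_def by simp
qed

lemma quot_lin_U: "linear_on UA \<Omega> quot"
  by (rule linear_on_restrict[OF quot_lin]) (auto simp: U_simps)

lemmas [tw] = linear_rules[OF quot_lin vect_tensor vectO] linear_rules[OF quot_lin_U vect_U vectO]
lemmas [push] = linear_push[OF quot_lin vect_tensor vectO]
lemmas [additive] = linear_additive[OF quot_lin vect_tensor vectO]

lemma quot_eval [push]: "x \<in> carr A \<Longrightarrow> y \<in> carr A \<Longrightarrow> quot (ptensor A A x y) = lmul \<Omega> x (dif \<Omega> y)"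
  by (simp add: quot_def tw tsum_rules[where U=\<Omega>] cong: sw_cong)

lemma dif_one [push]: "dif \<Omega> (aone A) = 0"
  by (rule fodc_one[OF fodcA algA])

lemma quot_gen: "x \<in> carr A \<Longrightarrow> y \<in> carr A \<Longrightarrow> quot (ul x (ud y)) = lmul \<Omega> x (dif \<Omega> y)"
  by (simp add: ul_ud additive tw push)

text \<open>
  On all of \<open>A \<otimes> A\<close> the map is not right linear; the defect is proportional to the product \<open>um t\<close>, which
  vanishes on the universal calculus.
\<close>

lemma quot_ur:
  assumes t: "t \<in> carr AA" and [simp]: "a \<in> carr A"
  shows "quot (ur t a) = rmul \<Omega> (quot t) a + lmul \<Omega> (um t) (dif \<Omega> a)"
proof -
  note [simp] = tw push additive lmul_rmul rmul_dif
  show ?thesis by (rule tensor_eqI[OF _ _ _ _ t, where U=\<Omega>]) simp_all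
qed

lemma quot_ul:
  assumes t: "t \<in> carr AA" and [simp]: "a \<in> carr A"
  shows "quot (ul a t) = lmul \<Omega> a (quot t)"
proof -
  note [simp] = tw push
  show ?thesis by (rule tensor_eqI[OF _ _ _ _ t, where U=\<Omega>]) simp_all
qed

lemma calc_quotient_universal: "calc_quotient H A UA \<Omega> quot"
  unfolding calc_quotient_def
proof (intro conjI ballI quot_lin_U)
  show "quot ` carr UA = carr \<Omega>"
  proof
    show "quot ` carr UA \<subseteq> carr \<Omega>" using linear_on_in[OF quot_lin_U] by auto
    have "\<exists>t\<in>carr UA. w = quot t" if "w \<in> carr \<Omega>" for w
      using that fodcA vectA
    proof (induction rule: fodc_induct)
      case zero then show ?case using vect_zero[OF vect_U] linear_on_zero[OF quot_lin_U vect_U] by metis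
    next
      case (add s t) then show ?case using vect_add[OF vect_U] linear_on_add[OF quot_lin_U] by metis
    next
      case (gen a b) then show ?case using ul_ud_in quot_gen by metis
    qed
    then show "carr \<Omega> \<subseteq> quot ` carr UA" by auto
  qed
next
  fix a t assume a [simp]: "a \<in> carr A" and "t \<in> carr UA"
  then have t [simp]: "t \<in> carr AA" "um t = 0" by (auto simp: U_simps)
  show "quot (lmul UA a t) = lmul \<Omega> a (quot t)" by (simp add: U_simps quot_ul)
  have "lmul \<Omega> 0 (dif \<Omega> a) = 0" using linear_on_in[OF dif_lin a] additive by simp
  then show "quot (rmul UA t a) = rmul \<Omega> (quot t) a" by (simp add: U_simps quot_ur)
next
  fix a assume a: "a \<in> carr A"
  have "quot (ul (aone A) (ud a)) = dif \<Omega> a" using a quot_gen[OF oneA a] linear_on_in[OF dif_lin a] lmul_one by simp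
  moreover have "ul (aone A) (ud a) = ud a"
    using universal_fodc ud_in[OF a] by (simp add: fodc_def left_module_def U_simps(3))
  ultimately show "quot (dif UA a) = dif \<Omega> a" by (simp add: U_simps(5))
next
  fix t assume t: "t \<in> carr UA"
  let ?G = "\<lambda>t. tsum UA H (rcoact UA t) (\<lambda>w h. ptensor \<Omega> H (quot w) h)"
  note [simp] = tw linear_rules[OF uco_covariant vect_U vect_tensor] ul_ud_in
  show "rcoact \<Omega> (quot t) = ?G t"
  proof (rule fodc_eqI[OF universal_fodc _ _ _ t, where U="tensor \<Omega> H"])
    show "linear_on UA (tensor \<Omega> H) (\<lambda>t. rcoact \<Omega> (quot t))" "linear_on UA (tensor \<Omega> H) ?G" by simp_all
    fix x y assume [simp]: "x \<in> carr A" "y \<in> carr A"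
    have g: "rcoact UA (lmul UA x (dif UA y)) = tsum A H (coact A x) (\<lambda>x0 x1. tsum A H (coact A y) (\<lambda>y0 y1.
        ptensor UA H (ul x0 (ud y0)) (amul H x1 y1)))"
      using uco_gen[of x y] by (simp add: U_simps(3,5,6) U_tensor)
    note [cong] = sw_cong
    show "rcoact \<Omega> (quot (lmul UA x (dif UA y))) = ?G (lmul UA x (dif UA y))"
      unfolding g by (simp add: U_simps(3,5) quot_gen rco_gen tsum_rules[where U="tensor \<Omega> H"])
  qed
qed

end

context bicov begin

lemma bicalc_quotient_universal: "\<exists>\<pi>. bicalc_quotient H UH \<Gamma> \<pi>"
proof -
  interpret S: comodule_algebra H "self_comodalg H" by unfold_locales (rule self_comodule_algebra)
  interpret Q: comodule_fodc H "self_comodalg H" \<Gamma>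
    by (rule S.covariant_comodule_fodc) (use bicov in \<open>simp add: bicovariant_fodc_def\<close>)
  interpret UF: bicov H UH by unfold_locales (rule UH_bicovariant)
  have u: "tensor US H = tensor UH H" "ptensor US H = ptensor UH H" "tsum US H = tsum UH H"
    by (rule tensor_cong; simp add: UH_simps)+
  have q: "calc_quotient H H UH \<Gamma> Q.quot"
    using Q.calc_quotient_universal unfolding calc_quotient_def
    by (simp add: UH_simps u linear_on_def)
  have lin: "linear_on UH \<Gamma> Q.quot" using q by (simp add: calc_quotient_def)
  have gen: "Q.quot (lmul UH x (dif UH y)) = lmul \<Gamma> x (dif \<Gamma> y)" if "x \<in> carr H" "y \<in> carr H" for x y
    using Q.quot_gen[of x y] that by (simp add: UH_simps S.U_simps(3,5))
  have "lcoact \<Gamma> (Q.quot t) = tsum H UH (lcoact UH t) (\<lambda>h w. ptensor H \<Gamma> h (Q.quot w))" if t: "t \<in> carr UH" for t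
  proof -
    let ?G = "\<lambda>t. tsum H UH (lcoact UH t) (\<lambda>h w. ptensor H \<Gamma> h (Q.quot w))"
    note [simp] = tw linear_rules[OF lin UF.vectN vectN]
    show ?thesis
    proof (rule fodc_eqI[OF UH_fodc _ _ _ t, where U="tensor H \<Gamma>"])
      show "linear_on UH (tensor H \<Gamma>) (\<lambda>t. lcoact \<Gamma> (Q.quot t))" "linear_on UH (tensor H \<Gamma>) ?G" by simp_all
      fix x y assume [simp]: "x \<in> carr H" "y \<in> carr H"
      note [simp] = push gen hopf_sw[where U="tensor H \<Gamma>"] hopf_sw[where U="tensor H UH"]
      note [cong] = sw_cong
      show "lcoact \<Gamma> (Q.quot (lmul UH x (dif UH y))) = ?G (lmul UH x (dif UH y))" by simp
    qed
  qed
  with q show ?thesis unfolding bicalc_quotient_def by blast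
qed

end

context cleft begin

lemma regular:
  assumes "right_covariant_fodc H A \<Omega>" "bicovariant_fodc H \<Gamma>"
  shows "regular_bundle H A \<Omega> \<Gamma>"
proof -
  interpret Q: comodule_fodc H A \<Omega> by (rule covariant_comodule_fodc[OF assms(1)])
  interpret G: bicov H \<Gamma> by unfold_locales (rule assms(2))
  show ?thesis
    unfolding regular_bundle_def
    using galois universal_qpb universal_vertical universal_connection Q.calc_quotient_universal G.bicalc_quotient_universal
    by blast
qed

end

section \<open>The quantum principal bundle on the crossed product\<close>

text \<open>
  The crossed product enters regularity only through its cleaving map.
\<close>

lemma (in twisted) crossed_cleft: "cleft H A gam del"
proof unfold_locales
  show "right_comodule_algebra H A" by (rule A_comodule_algebra)
qed (use gam_lin del_lin gam_one gam_del del_gam coA_gam coA_del in simp_all)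

theorem theorem3p17:
  fixes H :: "('h::ab_group_add, 'k::field) hopf"
    and B :: "('b::ab_group_add, 'k) alg"
    and act :: "'h \<Rightarrow> 'b \<Rightarrow> 'b"
    and \<sigma> \<sigma>i :: "'h \<Rightarrow> 'h \<Rightarrow> 'b"
    and \<Gamma> :: "('g::ab_group_add, 'k, 'h, 'h) bicalc"
    and \<Omega> :: "('o::ab_group_add, 'k, 'b) calc"
    and wact :: "'h \<Rightarrow> 'o \<Rightarrow> 'o"
  assumes "hopf_algebra H"
    and "bij_betw (antipode H) (carr H) (carr H)"
    and "twisted_module_algebra H B act \<sigma> \<sigma>i"
    and "bicovariant_fodc H \<Gamma>"
    and "twisted_module_fodc H B act \<sigma> \<Omega> wact"
  shows "let A = crossed_product H B act \<sigma>;
             \<Omega>A = crossed_calc H B act \<sigma> \<Omega> wact \<Gamma>;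
             X = left_coinv_forms H \<Gamma>
         in right_covariant_fodc H A \<Omega>A \<and>
            quantum_principal_bundle H A \<Omega>A \<Gamma> \<and>
            regular_bundle H A \<Omega>A \<Gamma> \<and>
            strong_bundle H A \<Omega>A \<and>
            (\<exists>ver. vertical_map H A \<Omega>A \<Gamma> ver \<and>
               short_exact A
                 (tensor \<Omega> H) (crossed_lmul_hor H B \<sigma> \<Omega> wact)
                 \<Omega>A (lmul \<Omega>A)
                 (tensor A X) (left_act_tensor A X)
                 (\<lambda>s. (s, 0)) ver)"
proof -
  interpret crossed_calculus H B act \<sigma> \<sigma>i \<Omega> wact \<Gamma> by unfold_locales (rule assms)+
  interpret C: cleft H "crossed_product H B act \<sigma>" gam del by (rule crossed_cleft)
  show ?thesis
    unfolding Let_def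
    using calc_covariant crossed_qpb C.regular[OF calc_covariant assms(4)] crossed_strong[OF assms(2)]
      vmap_vertical crossed_exact by blast
qed

end
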